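(* Let $h>0$, assume $g$ satisfies (H), and let $u(t,x)=\phi(\nu\cdot x+ct)$ be a traveling front of equation (1). Then there exist $s_0\in\mathbb{R}$ and $\sigma>0$ such that: 1) if $c>c_*$, then $\phi(t+s_0)=e^{\lambda_2(c)t}+O(e^{(\lambda_2(c)+\sigma)t})$ as $t\to-\infty$; 2) if $c=c_*>c_\#$, then $\phi(t+s_0)=e^{\lambda_1(c)t}+O(e^{(\lambda_1(c)+\sigma)t})$ as $t\to-\infty$.
   Context: Hypothesis (H): $g:\mathbb{R}_+\to\mathbb{R}_+$ is continuous and strictly increasing; $g(x)=x$ has exactly two nonnegative solutions $0$ and $\kappa>0$; $g$ is differentiable at $0,\kappa$ with $g'(0)>1$, $g'(\kappa)<1$; $g$ is $C^1$ near $\kappa$; and $|g(u)/u-g'(0)|\le Cu^\theta$ for $u\in(0,\delta]$ (some $C>0$, $\theta\in(0,1]$, $\delta>0$). Equation (1): $u_t(t,x)=\Delta u(t,x)-u(t,x)+g(u(t-h,x))$, $x\in\mathbb{R}^m$, $|\nu|=1$. A traveling front at velocity $c>0$ is $u=\phi(\nu\cdot x+ct)$ with $\phi$ $C^2$, positive, bounded, monotone, $\phi(-\infty)=0$, $\phi(+\infty)=\kappa$, $\phi''-c\phi'-\phi+g(\phi(\cdot-ch))=0$. $c_*$ denotes the infimum of the set of velocities $c\ge0$ for which (1) has a traveling front. $\chi(z,c)=z^2-cz-1+g'(0)e^{-zch}$; $c_\#>0$ is the unique $c>0$ for which $\chi(\cdot,c)$ has a double positive root; for $c>c_\#$, $\chi(\cdot,c)=0$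 has exactly two real roots $0<\lambda_2(c)<\lambda_1(c)$. *)

theory Defs
  imports "HOL-Analysis.Analysis" "HOL-Library.Landau_Symbols"
begin

definition hypH :: "(real \<Rightarrow> real) \<Rightarrow> real \<Rightarrow> real \<Rightarrow> real \<Rightarrow> bool" where
  "hypH g \<kappa> g0 gk \<longleftrightarrow>
     (\<forall>x\<ge>0. g x \<ge> 0) \<and>
     continuous_on {0..} g \<and>
     strict_mono_on {0..} g \<and>
     \<kappa> > 0 \<and>
     {x. x \<ge> 0 \<and> g x = x} = {0, \<kappa>} \<and>
     (g has_real_derivative g0) (at 0 within {0..}) \<and>
     (g has_real_derivative gk) (at \<kappa>) \<and>
     g0 > 1 \<and> gk < 1 \<and>
     (\<exists>\<epsilon>>0. \<exists>g'. (\<forall>x\<in>ball \<kappa> \<epsilon>. (g has_real_derivative g' x) (at x))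
                  \<and> continuous_on (ball \<kappa> \<epsilon>) g') \<and>
     (\<exists>C>0. \<exists>\<theta>>0. \<theta> \<le> 1 \<and> (\<exists>\<delta>>0. \<forall>u. 0 < u \<and> u \<le> \<delta> \<longrightarrow>
                  \<bar>g u / u - g0\<bar> \<le> C * u powr \<theta>))"

text \<open>Traveling front profile phi at velocity c for delay h (u(t,x) = phi(nu.x + c t)).\<close>
definition front :: "(real \<Rightarrow> real) \<Rightarrow> real \<Rightarrow> real \<Rightarrow> real \<Rightarrow> (real \<Rightarrow> real) \<Rightarrow> bool" where
  "front g \<kappa> h c \<phi> \<longleftrightarrow>
     c > 0 \<and>
     (\<exists>\<phi>' \<phi>''. (\<forall>t. (\<phi> has_real_derivative \<phi>' t) (at t)) \<and>
               (\<forall>t. (\<phi>' has_real_derivative \<phi>'' t) (at t)) \<and>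
               continuous_on UNIV \<phi>'' \<and>
               (\<forall>t. \<phi>'' t - c * \<phi>' t - \<phi> t + g (\<phi> (t - c * h)) = 0)) \<and>
     (\<forall>t. \<phi> t > 0) \<and> bounded (range \<phi>) \<and>
     (mono \<phi> \<or> antimono \<phi>) \<and>
     (\<phi> \<longlongrightarrow> 0) at_bot \<and> (\<phi> \<longlongrightarrow> \<kappa>) at_top"

definition c_star :: "(real \<Rightarrow> real) \<Rightarrow> real \<Rightarrow> real \<Rightarrow> real" where
  "c_star g \<kappa> h = Inf {c. c \<ge> 0 \<and> (\<exists>\<phi>. front g \<kappa> h c \<phi>)}"

definition chi :: "real \<Rightarrow> real \<Rightarrow> real \<Rightarrow> real \<Rightarrow> real" where
  "chi g0 h z c = z\<^sup>2 - c * z - 1 + g0 * exp (- z * c * h)"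

text \<open>c_# : the unique c>0 for which chi(.,c) has a double positive root.\<close>
definition c_sharp :: "real \<Rightarrow> real \<Rightarrow> real" where
  "c_sharp g0 h = (THE c. c > 0 \<and> (\<exists>z>0. chi g0 h z c = 0 \<and>
                      2 * z - c - g0 * c * h * exp (- z * c * h) = 0))"

text \<open>For c > c_#: the two real roots 0 < lambda2 c < lambda1 c.\<close>
definition lambda2 :: "real \<Rightarrow> real \<Rightarrow> real \<Rightarrow> real" where
  "lambda2 g0 h c = (THE z. z > 0 \<and> chi g0 h z c = 0 \<and> (\<exists>w>z. chi g0 h w c = 0))"

definition lambda1 :: "real \<Rightarrow> real \<Rightarrow> real \<Rightarrow> real" where
  "lambda1 g0 h c = (THE z. z > 0 \<and> chi g0 h z c = 0 \<and> (\<exists>w. 0 < w \<and> w < z \<and> chi g0 h w c = 0))"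

end

theory Submission
  imports Defs
begin

text \<open>Put $\chi(z) = z^2 - cz - 1 + g'(0)e^{-zch}$. Dividing $\chi$ by $D - z$ turns the profile
  equation into $I' = e^{-zt}N - \chi(z)e^{-zt}\phi$, where $I$ is an explicit functional of $\phi$ and $N$
  is the nonlinear remainder. While $\chi(z) > 0$ this forces $\phi$ to decay faster than $e^{zt}$ by a
  uniform amount, so $\phi = O(e^{zt})$ for every $z < \lambda_2$; the process cannot continue for ever because
  $\phi$ decays no faster than an exponential. Dividing by $D - \lambda_1$ gives a first-order delay
  equation for $\phi' - \lambda_1\phi$ with a positive kernel, which is marginally stable at the exponent
  $\lambda_2$ and strictly contracting between $\lambda_2$ and $\lambda_1$. Hence either $\phi \sim ae^{\lambda_2 t}$ or
  $\phi \sim ae^{\lambda_1 t}$, with $a > 0$ and an exponential error.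

  If $c > c_*$ there is a front of smaller speed; it is a strict supersolution at speed $c$ and decays
  more slowly than $e^{\lambda_1(c) t}$, so a front with the fast decay could be kept below all of its
  translates by sliding, which is absurd. If $c = c_* > c_\#$ and $\phi \sim ae^{\lambda_2 t}$, then $\phi$ can be
  perturbed to a supersolution for a slightly smaller speed, and a front of that speed exists below it,
  contradicting the definition of $c_*$.\<close>

section \<open>The operator $u'' - cu' - u$ on the line\<close>

text \<open>Nothing bounds g(u) by g'(0)u, so linearization at 0 yields only c \<ge> c_#, and which
  exponent a front of minimal speed has is not decided by its behaviour near -\<infinity>: whole
  profiles must be compared. Each comparison uses exponents near -\<infinity>, compactness in
  between, and near +\<infinity> a contraction constant q < 1 of g close to \<kappa>, which prevents
  a difference of profiles from having a negative minimum there. Away from 0 and \<kappa> g is only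
  continuous and increasing, so the equation is never differentiated; estimates of second
  derivatives come from differences of translates. The operator u'' - cu' - u has real roots of
  opposite sign, so the sign of the derivative of a factor times an exponential replaces Green's
  functions and Laplace transforms. The exponent \<lambda>_2 is the delicate point: there the delay
  equation has gain exactly one, and the missing bound comes from the functional I, whose derivative
  at a zero of \<chi> contains only the nonlinear remainder.\<close>

definition twice_diff :: "(real \<Rightarrow> real) \<Rightarrow> (real \<Rightarrow> real) \<Rightarrow> (real \<Rightarrow> real) \<Rightarrow> bool" where
  "twice_diff u u1 u2 \<longleftrightarrow> (\<forall>t. (u has_real_derivative u1 t) (at t)) \<and>
                        (\<forall>t. (u1 has_real_derivative u2 t) (at t))"

definition root_neg :: "real \<Rightarrow> real" where "root_neg c = (c - sqrt (c\<^sup>2 + 4)) / 2"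
definition root_pos :: "real \<Rightarrow> real" where "root_pos c = (c + sqrt (c\<^sup>2 + 4)) / 2"

lemma root_sum: "root_neg c + root_pos c = c"
  by (simp add: root_neg_def root_pos_def field_simps)

lemma root_prod: "root_neg c * root_pos c = -1"
proof -
  have "sqrt (c\<^sup>2 + 4) * sqrt (c\<^sup>2 + 4) = c\<^sup>2 + 4"
    by (rule real_sqrt_mult_self[THEN trans]) simp
  then show ?thesis
    by (simp add: root_neg_def root_pos_def field_simps power2_eq_square)
qed

lemma root_neg_neg: "root_neg c < 0" and root_pos_pos: "root_pos c > 0"
proof -
  have "\<bar>c\<bar> < sqrt (c\<^sup>2 + 4)"
    by (rule real_less_rsqrt) simp
  then show "root_neg c < 0" "root_pos c > 0"
    by (auto simp: root_neg_def root_pos_def)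
qed

lemma root_pos_eq: "(root_pos c)\<^sup>2 - c * root_pos c - 1 = 0"
proof -
  have "(root_pos c)\<^sup>2 - (root_neg c + root_pos c) * root_pos c + root_neg c * root_pos c = 0"
    by (simp add: power2_eq_square algebra_simps)
  then show ?thesis by (simp add: root_sum root_prod)
qed

section \<open>Comparison principles from signs of derivatives\<close>

lemma deriv_nonneg_le:
  fixes f :: "real \<Rightarrow> real"
  assumes "a \<le> b" "\<And>x. a \<le> x \<Longrightarrow> x \<le> b \<Longrightarrow> (f has_real_derivative f' x) (at x)"
    "\<And>x. a \<le> x \<Longrightarrow> x \<le> b \<Longrightarrow> f' x \<ge> 0"
  shows "f a \<le> f b"
  using DERIV_nonneg_imp_nondecreasing[of a b f] assms by blast

lemma deriv_nonpos_ge: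
  fixes f :: "real \<Rightarrow> real"
  assumes "a \<le> b" "\<And>x. a \<le> x \<Longrightarrow> x \<le> b \<Longrightarrow> (f has_real_derivative f' x) (at x)"
    "\<And>x. a \<le> x \<Longrightarrow> x \<le> b \<Longrightarrow> f' x \<le> 0"
  shows "f b \<le> f a"
  using DERIV_nonpos_imp_nonincreasing[of a b f] assms by blast

lemma antiderivative_exists:
  fixes f :: "real \<Rightarrow> real"
  assumes "continuous_on UNIV f"
  obtains F where "\<And>t. (F has_real_derivative f t) (at t)"
proof -
  have "\<exists>F. \<forall>x::real. -\<infinity> < ereal x \<longrightarrow> ereal x < \<infinity> \<longrightarrow> (F has_vector_derivative f x) (at x)"
    by (rule einterval_antiderivative) (use assms in \<open>auto simp: continuous_on_eq_continuous_at\<close>)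
  then show ?thesis
    using that by (auto simp: has_real_derivative_iff_has_vector_derivative)
qed

text \<open>Factor $D^2 - cD - 1 = (D - \alpha)(D - \beta)$: each first-order factor, multiplied by its
  exponential, is monotone.\<close>
lemma twice_diff_factor_neg:
  assumes "twice_diff w w1 w2"
  shows "((\<lambda>t. (w1 t - root_neg c * w t) * exp (- root_pos c * t)) has_real_derivative
     (w2 t - c * w1 t - w t) * exp (- root_pos c * t)) (at t)"
proof -
  have w: "(w has_real_derivative w1 t) (at t)" "(w1 has_real_derivative w2 t) (at t)"
    using assms by (auto simp: twice_diff_def)
  have eq: "w2 t - c * w1 t - w t = w2 t - (root_neg c + root_pos c) * w1 t + (root_neg c * root_pos c) * w t"
    by (simp add: root_sum root_prod)
  show ?thesis
    unfolding eq by (auto intro!: derivative_eq_intros w simp: algebra_simps)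
qed

lemma twice_diff_factor_pos:
  assumes "twice_diff w w1 w2"
  shows "((\<lambda>t. (w1 t - root_pos c * w t) * exp (- root_neg c * t)) has_real_derivative
     (w2 t - c * w1 t - w t) * exp (- root_neg c * t)) (at t)"
proof -
  have w: "(w has_real_derivative w1 t) (at t)" "(w1 has_real_derivative w2 t) (at t)"
    using assms by (auto simp: twice_diff_def)
  have eq: "w2 t - c * w1 t - w t = w2 t - (root_neg c + root_pos c) * w1 t + (root_neg c * root_pos c) * w t"
    by (simp add: root_sum root_prod)
  show ?thesis
    unfolding eq by (auto intro!: derivative_eq_intros w simp: algebra_simps)
qed

text \<open>If w' - aw (a the negative root) were -m < 0 at t, the nonincreasing product of
  \<open>twice_diff_factor_neg\<close> would keep it below -m afterwards; since aw \<le> 0, w would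
  fall with slope at least m and become negative. The other bound is the mirror image, run towards
  -\<infinity>. Together they are the Harnack inequality of the proof.\<close>

lemma supersolution_deriv_bounds:
  assumes w: "twice_diff w w1 w2" and nn: "\<And>t. w t \<ge> 0"
    and le: "\<And>t. w2 t - c * w1 t - w t \<le> 0"
  shows "root_neg c * w t \<le> w1 t" "w1 t \<le> root_pos c * w t"
proof -
  let ?a = "root_neg c" and ?b = "root_pos c"
  have d: "\<And>t. (w has_real_derivative w1 t) (at t)" using w by (auto simp: twice_diff_def)
  show "?a * w t \<le> w1 t"
  proof (rule ccontr)
    define m where "m = ?a * w t - w1 t"
    assume "\<not> ?thesis"
    then have m: "m > 0" by (simp add: m_def)
    have low: "w1 s \<le> - m" if "s \<ge> t" for s
    proof -
      have "(w1 s - ?a * w s) * exp (- ?b * s) \<le> (w1 t - ?a * w t) * exp (- ?b * t)"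
        by (rule deriv_nonpos_ge[OF that twice_diff_factor_neg[OF w]])
           (use le in \<open>auto intro: mult_nonpos_nonneg\<close>)
      then have "(w1 s - ?a * w s) * exp (- ?b * s) * exp (?b * s)
        \<le> (w1 t - ?a * w t) * exp (- ?b * t) * exp (?b * s)"
        by (rule mult_right_mono) simp
      then have "w1 s - ?a * w s \<le> - m * exp (?b * (s - t))"
        by (simp add: mult.assoc flip: exp_add) (simp add: m_def algebra_simps)
      also have "\<dots> \<le> - m * 1"
        using m that root_pos_pos[of c] by (intro mult_left_mono_neg) auto
      finally have "w1 s \<le> - m + ?a * w s" by simp
      also have "?a * w s \<le> 0" using root_neg_neg[of c] nn[of s] by (simp add: mult_nonpos_nonneg)
      finally show ?thesis by simp
    qed
    define s where "s = t + (w t + 1) / m"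
    have st: "s \<ge> t" using m nn[of t] by (simp add: s_def)
    have "w s + m * s \<le> w t + m * t"
    proof (rule deriv_nonpos_ge[OF st, where f' = "\<lambda>x. w1 x + m"])
      show "w1 x + m \<le> 0" if "t \<le> x" for x using low[OF that] by simp
    qed (auto intro!: derivative_eq_intros d)
    then have "w s \<le> w t - m * (s - t)" by (simp add: algebra_simps)
    also have "\<dots> = -1" using m by (simp add: s_def)
    finally show False using nn[of s] by simp
  qed
  show "w1 t \<le> ?b * w t"
  proof (rule ccontr)
    define m where "m = w1 t - ?b * w t"
    assume "\<not> ?thesis"
    then have m: "m > 0" by (simp add: m_def)
    have low: "w1 s \<ge> m" if "s \<le> t" for s
    proof -
      have "(w1 t - ?b * w t) * exp (- ?a * t) \<le> (w1 s - ?b * w s) * exp (- ?a * s)"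
        by (rule deriv_nonpos_ge[OF that twice_diff_factor_pos[OF w]])
           (use le in \<open>auto intro: mult_nonpos_nonneg\<close>)
      then have "(w1 t - ?b * w t) * exp (- ?a * t) * exp (?a * s)
         \<le> (w1 s - ?b * w s) * exp (- ?a * s) * exp (?a * s)"
        by (rule mult_right_mono) simp
      then have "m * exp (?a * (s - t)) \<le> w1 s - ?b * w s"
        by (simp add: mult.assoc flip: exp_add) (simp add: m_def algebra_simps)
      moreover have "m * 1 \<le> m * exp (?a * (s - t))"
        using m that root_neg_neg[of c] by (intro mult_left_mono) (auto simp: mult_nonpos_nonpos)
      moreover have "?b * w s \<ge> 0" using root_pos_pos[of c] nn[of s] by simp
      ultimately show ?thesis by simp
    qed
    define s where "s = t - (w t + 1) / m"
    have st: "s \<le> t" using m nn[of t] by (simp add: s_def)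
    have "w s - m * s \<le> w t - m * t"
      by (rule deriv_nonneg_le[OF st, where f' = "\<lambda>x. w1 x - m"])
         (use low in \<open>auto intro!: derivative_eq_intros d\<close>)
    then have "w s \<le> w t - m * (t - s)" by (simp add: algebra_simps)
    also have "\<dots> = -1" using m by (simp add: s_def)
    finally show False using nn[of s] by simp
  qed
qed

lemma growth_upper:
  fixes w w1 :: "real \<Rightarrow> real"
  assumes "\<And>t. (w has_real_derivative w1 t) (at t)" "\<And>t. w1 t \<le> b * w t" "s \<le> t"
  shows "w t \<le> exp (b * (t - s)) * w s"
proof -
  have "w t * exp (- b * t) \<le> w s * exp (- b * s)"
    by (rule deriv_nonpos_ge[OF assms(3), where f' = "\<lambda>x. (w1 x - b * w x) * exp (- b * x)"])
       (use assms(2) in \<open>auto intro!: derivative_eq_intros assms(1) mult_nonpos_nonneg simp: algebra_simps\<close>)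
  then have "w t * exp (- b * t) * exp (b * t) \<le> w s * exp (- b * s) * exp (b * t)"
    by (rule mult_right_mono) simp
  then show ?thesis
    by (simp add: mult.assoc flip: exp_add) (simp add: algebra_simps)
qed

lemma growth_lower:
  fixes w w1 :: "real \<Rightarrow> real"
  assumes "\<And>t. (w has_real_derivative w1 t) (at t)" "\<And>t. a * w t \<le> w1 t" "s \<le> t"
  shows "exp (a * (t - s)) * w s \<le> w t"
  using growth_upper[of "\<lambda>t. - w t" "\<lambda>t. - w1 t" a s t] assms
  by (auto intro: derivative_intros)

text \<open>The two first-order inequalities carry a zero to the right and to the left. Fed with
  \<open>supersolution_deriv_bounds\<close>, this replaces the strong maximum principle for the
  second-order operator.\<close>

lemma strong_maximum:
  fixes w w1 :: "real \<Rightarrow> real"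
  assumes d: "\<And>t. (w has_real_derivative w1 t) (at t)" and nn: "\<And>t. w t \<ge> 0"
    and "\<And>t. a * w t \<le> w1 t" "\<And>t. w1 t \<le> b * w t" "w t0 = 0"
  shows "w t = 0"
proof (cases "t0 \<le> t")
  case True
  then show ?thesis using growth_upper[of w w1 b t0 t] assms nn[of t] by auto
next
  case False
  then have "exp (a * (t0 - t)) * w t \<le> 0" using growth_lower[of w w1 a t t0] assms by auto
  then show ?thesis using nn[of t] by (simp add: mult_le_0_iff)
qed

text \<open>The sign of w being unknown, aw can only be bounded by -aK; the exponential growth of w'
  - aw overtakes that constant and drives w to -\<infinity>. Once aw \<le> w' is established, a
  negative value of w would be amplified exponentially to the left, against boundedness.\<close>

lemma bounded_supersolution_nonneg:
  assumes w: "twice_diff w w1 w2" and bd: "\<And>t. \<bar>w t\<bar> \<le> K"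
    and le: "\<And>t. w2 t - c * w1 t - w t \<le> 0"
  shows "w t \<ge> 0"
proof -
  let ?a = "root_neg c" and ?b = "root_pos c"
  have d: "\<And>t. (w has_real_derivative w1 t) (at t)" using w by (auto simp: twice_diff_def)
  have K: "K \<ge> 0" using bd[of 0] by simp
  have low: "?a * w r \<le> w1 r" for r
  proof (rule ccontr)
    define m where "m = ?a * w r - w1 r"
    assume "\<not> ?thesis"
    then have m: "m > 0" by (simp add: m_def)
    have b1: "w1 s \<le> - ?a * K - m * (1 + ?b * (s - r))" if "s \<ge> r" for s
    proof -
      have "(w1 s - ?a * w s) * exp (- ?b * s) \<le> (w1 r - ?a * w r) * exp (- ?b * r)"
        by (rule deriv_nonpos_ge[OF that twice_diff_factor_neg[OF w]])
           (use le in \<open>auto intro: mult_nonpos_nonneg\<close>)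
      then have "(w1 s - ?a * w s) * exp (- ?b * s) * exp (?b * s)
        \<le> (w1 r - ?a * w r) * exp (- ?b * r) * exp (?b * s)"
        by (rule mult_right_mono) simp
      then have "w1 s - ?a * w s \<le> - m * exp (?b * (s - r))"
        by (simp add: mult.assoc flip: exp_add) (simp add: m_def algebra_simps)
      also have "\<dots> \<le> - m * (1 + ?b * (s - r))"
        using m by (intro mult_left_mono_neg exp_ge_add_one_self) auto
      finally have "w1 s \<le> - m * (1 + ?b * (s - r)) + ?a * w s" by simp
      moreover have "?a * w s \<le> - ?a * K"
        using mult_left_mono_neg[of "- K" "w s" ?a] bd[of s] root_neg_neg[of c] by (simp add: abs_le_iff)
      ultimately show ?thesis by simp
    qed
    define r1 where "r1 = r + (- ?a * K) / (m * ?b)"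
    have aK: "- ?a * K \<ge> 0" using K root_neg_neg[of c] by (simp add: mult_nonpos_nonneg)
    have r1: "r1 \<ge> r" using m root_pos_pos[of c] divide_nonneg_pos[OF aK, of "m * ?b"] by (simp add: r1_def)
    have b2: "w1 s \<le> - m" if "s \<ge> r1" for s
    proof -
      have "- ?a * K = m * ?b * (r1 - r)" using m root_pos_pos[of c] by (simp add: r1_def)
      also have "\<dots> \<le> m * ?b * (s - r)" using that m root_pos_pos[of c] by (intro mult_left_mono) auto
      finally show ?thesis using b1[of s] that r1 by (simp add: algebra_simps)
    qed
    define s where "s = r1 + (2 * K + 1) / m"
    have st: "s \<ge> r1" using m K by (simp add: s_def)
    have "w s + m * s \<le> w r1 + m * r1"
    proof (rule deriv_nonpos_ge[OF st, where f' = "\<lambda>x. w1 x + m"])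
      show "w1 x + m \<le> 0" if "r1 \<le> x" for x using b2[OF that] by simp
    qed (auto intro!: derivative_eq_intros d)
    then have "w s \<le> w r1 - m * (s - r1)" by (simp add: algebra_simps)
    also have "m * (s - r1) = 2 * K + 1" using m by (simp add: s_def)
    finally show False using bd[of s] bd[of r1] by (simp add: abs_le_iff)
  qed
  show ?thesis
  proof (rule ccontr)
    assume "\<not> ?thesis"
    then have neg: "w t < 0" by simp
    have a: "- ?a > 0" using root_neg_neg[of c] by simp
    define s where "s = t - (K / (- w t)) / (- ?a)"
    have st: "s \<le> t" using neg K a divide_nonneg_pos[OF K mult_neg_neg[of "w t" ?a]] by (simp add: s_def)
    have "exp (?a * (t - s)) * w s \<le> w t" by (rule growth_lower[OF d low st])
    then have "exp (- ?a * (t - s)) * (exp (?a * (t - s)) * w s) \<le> exp (- ?a * (t - s)) * w t"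
      by (rule mult_left_mono) simp
    then have "w s \<le> exp (- ?a * (t - s)) * w t"
      by (simp add: mult.assoc[symmetric] flip: exp_add)
    also have "\<dots> \<le> (1 + - ?a * (t - s)) * w t"
      using neg by (intro mult_right_mono_neg exp_ge_add_one_self) auto
    also have "- ?a * (t - s) = K / (- w t)" using a by (simp add: s_def)
    also have "(1 + K / (- w t)) * w t = w t - K" using neg by (simp add: field_simps)
    finally show False using neg bd[of s] by (simp add: abs_le_iff)
  qed
qed

text \<open>The bounded solution of $u'' - cu' - u = -G$ is obtained by integrating the factor with
  positive root from $+\infty$ and the one with negative root from $-\infty$.\<close>
lemma bounded_solution_exists:
  assumes G: "continuous_on UNIV G" and G0: "\<And>t. 0 \<le> G t" and GK: "\<And>t. G t \<le> (K::real)"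
  shows "\<exists>u u1 u2. twice_diff u u1 u2 \<and> (\<forall>t. u2 t - c * u1 t - u t = - G t) \<and> (\<forall>t. 0 \<le> u t \<and> u t \<le> K)"
proof -
  let ?a = "root_neg c" and ?b = "root_pos c"
  have b: "?b > 0" and a: "?a < 0" by (rule root_pos_pos root_neg_neg)+
  have K: "K \<ge> 0" using G0[of 0] GK[of 0] by simp
  have "continuous_on UNIV (\<lambda>s. exp (- ?b * s) * G s)" by (intro continuous_intros G)
  then obtain E where E: "\<And>t. (E has_real_derivative exp (- ?b * t) * G t) (at t)"
    by (rule antiderivative_exists) auto
  have Emono: "E s \<le> E t" if "s \<le> t" for s t
    by (rule deriv_nonneg_le[OF that E]) (use G0 in auto)
  have Ebd: "E s - E t \<le> K / ?b * exp (- ?b * t)" if "t \<le> s" for s t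
  proof -
    have "E s + K / ?b * exp (- ?b * s) \<le> E t + K / ?b * exp (- ?b * t)"
      by (rule deriv_nonpos_ge[OF that, where f' = "\<lambda>x. exp (- ?b * x) * G x - K * exp (- ?b * x)"])
         (use b GK in \<open>auto intro!: derivative_eq_intros E simp: algebra_simps\<close>)
    moreover have "K / ?b * exp (- ?b * s) \<ge> 0" using b K by simp
    ultimately show ?thesis by simp
  qed
  have bddE: "bdd_above (range E)"
  proof (rule bdd_aboveI2)
    fix s
    have "E s \<le> E (max s 0)" by (rule Emono) simp
    then show "E s \<le> E 0 + K / ?b" using Ebd[of 0 "max s 0"] by simp
  qed
  \<comment> \<open>\<open>E\<close> is nondecreasing and bounded above, so \<open>L\<close> is its
    limit at +\<infinity>, and \<open>V\<close> is exp(bt) times the integral of exp(-bs) G(s) from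
    t to +\<infinity>: the only bounded solution of V' = bV - G.\<close>
  define L where "L = Sup (range E)"
  define V where "V t = exp (?b * t) * (L - E t)" for t
  have V0: "V t \<ge> 0" for t
    using cSup_upper[OF _ bddE, of "E t"] by (simp add: V_def L_def)
  have VK: "V t \<le> K / ?b" for t
  proof -
    have "L \<le> E t + K / ?b * exp (- ?b * t)"
      unfolding L_def
    proof (rule cSup_least)
      fix x assume "x \<in> range E"
      then obtain s where s: "x = E s" by auto
      have "E s \<le> E (max s t)" by (rule Emono) simp
      then show "x \<le> E t + K / ?b * exp (- ?b * t)" using Ebd[of t "max s t"] s by simp
    qed simp
    then have "exp (?b * t) * (L - E t) \<le> exp (?b * t) * (K / ?b * exp (- ?b * t))"
      by (intro mult_left_mono) auto
    also have "\<dots> = K / ?b" by (simp add: exp_minus field_simps)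
    finally show ?thesis by (simp add: V_def)
  qed
  have V: "(V has_real_derivative ?b * V t - G t) (at t)" for t
  proof -
    have "exp (?b * t) * exp (- ?b * t) = 1" by (simp flip: exp_add)
    then have "exp (?b * t) * (exp (- ?b * t) * G t) = G t" by (simp add: mult.assoc[symmetric])
    then show ?thesis
      unfolding V_def[abs_def] by (auto intro!: derivative_eq_intros E simp: algebra_simps)
  qed
  have "continuous_on UNIV V"
    using V by (auto intro!: DERIV_isCont simp: continuous_on_eq_continuous_at)
  then have "continuous_on UNIV (\<lambda>s. exp (- ?a * s) * V s)" by (intro continuous_intros)
  then obtain F where F: "\<And>t. (F has_real_derivative exp (- ?a * t) * V t) (at t)"
    by (rule antiderivative_exists) auto
  have Fmono: "F s \<le> F t" if "s \<le> t" for s t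
    by (rule deriv_nonneg_le[OF that F]) (use V0 in auto)
  have Fbd: "F t - F s \<le> K * exp (- ?a * t)" if "s \<le> t" for s t
  proof -
    have ab: "?a * ?b = -1" by (rule root_prod)
    have "F t - K * exp (- ?a * t) \<le> F s - K * exp (- ?a * s)"
    proof (rule deriv_nonpos_ge[OF that, where f' = "\<lambda>x. exp (- ?a * x) * V x + ?a * K * exp (- ?a * x)"])
      fix x
      \<comment> \<open>The product of the roots being -1, the factors 1/b and -1/a of the two
        integrations cancel and the bound K survives unchanged.\<close>
      have "- ?a = 1 / ?b" using ab b by (simp add: field_simps)
      then have "V x \<le> - ?a * K" using VK[of x] by simp
      then have "exp (- ?a * x) * V x \<le> exp (- ?a * x) * (- ?a * K)" by (intro mult_left_mono) auto
      then show "exp (- ?a * x) * V x + ?a * K * exp (- ?a * x) \<le> 0" by (simp add: algebra_simps)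
    qed (auto intro!: derivative_eq_intros F simp: algebra_simps)
    moreover have "K * exp (- ?a * s) \<ge> 0" using K by simp
    ultimately show ?thesis by simp
  qed
  have bddF: "bdd_below (range F)"
  proof (rule bdd_belowI2)
    fix s
    have "F (min s 0) \<le> F s" by (rule Fmono) simp
    then show "F 0 - K \<le> F s" using Fbd[of "min s 0" 0] by simp
  qed
  \<comment> \<open>Dually, \<open>M\<close> is the limit of \<open>F\<close> at -\<infinity>, which
    removes the mode exp(at) that is unbounded there.\<close>
  define M where "M = Inf (range F)"
  define u where "u t = exp (?a * t) * (F t - M)" for t
  have u0: "u t \<ge> 0" for t
    using cInf_lower[OF _ bddF, of "F t"] by (simp add: u_def M_def)
  have uK: "u t \<le> K" for t
  proof -
    have "F t - K * exp (- ?a * t) \<le> M"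
      unfolding M_def
    proof (rule cInf_greatest)
      fix x assume "x \<in> range F"
      then obtain s where s: "x = F s" by auto
      have "F (min s t) \<le> F s" by (rule Fmono) simp
      then show "F t - K * exp (- ?a * t) \<le> x" using Fbd[of "min s t" t] s by simp
    qed simp
    then have "exp (?a * t) * (F t - M) \<le> exp (?a * t) * (K * exp (- ?a * t))"
      by (intro mult_left_mono) auto
    also have "\<dots> = K" by (simp add: exp_minus field_simps)
    finally show ?thesis by (simp add: u_def)
  qed
  have du: "(u has_real_derivative ?a * u t + V t) (at t)" for t
  proof -
    have "exp (?a * t) * exp (- ?a * t) = 1" by (simp flip: exp_add)
    then have "exp (?a * t) * (exp (- ?a * t) * V t) = V t" by (simp add: mult.assoc[symmetric])
    then show ?thesis
      unfolding u_def[abs_def] by (auto intro!: derivative_eq_intros F simp: algebra_simps)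
  qed
  define u1 where "u1 t = ?a * u t + V t" for t
  define u2 where "u2 t = ?a * u1 t + (?b * V t - G t)" for t
  have "twice_diff u u1 u2"
    unfolding twice_diff_def u1_def[abs_def] u2_def
    by (auto intro!: derivative_eq_intros du V)
  moreover have "u2 t - c * u1 t - u t = - G t" for t
  proof -
    have "u2 t - c * u1 t - u t = u2 t - (?a + ?b) * u1 t + (?a * ?b) * u t"
      by (simp add: root_sum root_prod)
    then show ?thesis by (simp add: u2_def u1_def algebra_simps)
  qed
  ultimately show ?thesis using u0 uK by blast
qed

section \<open>Minima and limits at infinity\<close>

lemma difference_quotient:
  assumes "(f has_real_derivative f') (at (t::real))"
  shows "((\<lambda>d. (f (t + d) - f t) / d) \<longlongrightarrow> f') (at_right 0)"
  using assms by (simp add: DERIV_def filterlim_at_split)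

text \<open>Were w2 negative, w' would be negative just to the right of the critical point and w
  would decrease there. The second derivative is asked for at \<open>t0\<close> only, which is all
  that functions touching a supersolution have to provide.\<close>

lemma local_min_second_deriv:
  fixes w w1 :: "real \<Rightarrow> real"
  assumes ev: "eventually (\<lambda>t. (w has_real_derivative w1 t) (at t)) (nhds t0)"
    and d2: "(w1 has_real_derivative w2) (at t0)"
    and mn: "eventually (\<lambda>t. w t0 \<le> w t) (nhds t0)"
  shows "w1 t0 = 0" "w2 \<ge> 0"
proof -
  obtain e where e: "e > 0" "\<And>t. dist t t0 < e \<Longrightarrow> (w has_real_derivative w1 t) (at t) \<and> w t0 \<le> w t"
    using eventually_conj[OF ev mn] by (auto simp: eventually_nhds_metric)
  show z: "w1 t0 = 0"
    by (rule DERIV_local_min[of w "w1 t0" t0 e]) (use e in \<open>auto simp: dist_real_def abs_minus_commute\<close>)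
  show "w2 \<ge> 0"
  proof (rule ccontr)
    assume "\<not> ?thesis"
    then obtain r where r: "r > 0" "\<And>h. 0 < h \<Longrightarrow> h < r \<Longrightarrow> w1 (t0 + h) < w1 t0"
      using DERIV_neg_dec_right[OF d2] by auto
    define h where "h = min r e / 2"
    have h: "0 < h" "h < r" "h < e" using r(1) e(1) by (auto simp: h_def)
    have "w (t0 + h) < w t0"
    proof (rule DERIV_neg_imp_decreasing_open[of t0 "t0 + h"])
      show "t0 < t0 + h" using h by simp
      fix x assume x: "t0 < x" "x < t0 + h"
      then have "w1 (t0 + (x - t0)) < w1 t0" using h by (intro r(2)) auto
      then show "\<exists>y. DERIV w x :> y \<and> y < 0"
        using e(2)[of x] x h z by (intro exI[of _ "w1 x"]) (auto simp: dist_real_def)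
    next
      show "continuous_on {t0..t0 + h} w"
      proof (intro continuous_at_imp_continuous_on ballI)
        fix x assume "x \<in> {t0..t0 + h}"
        then show "isCont w x"
          using e(2)[of x] h by (intro DERIV_isCont[of w "w1 x"]) (auto simp: dist_real_def)
      qed
    qed
    then show False using e(2)[of "t0 + h"] h by (auto simp: dist_real_def)
  qed
qed

text \<open>A nonzero limit m would make v change by more than 2K on a long interval where v' stays
  within |m|/2 of m.\<close>

lemma deriv_limit_zero:
  fixes v v1 :: "real \<Rightarrow> real"
  assumes d: "\<And>t. (v has_real_derivative v1 t) (at t)" and bd: "\<And>t. \<bar>v t\<bar> \<le> K"
    and lim: "(v1 \<longlongrightarrow> m) F" and F: "F = at_top \<or> F = at_bot"
  shows "m = 0"
proof (rule ccontr)
  assume m: "m \<noteq> 0"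
  have K: "K \<ge> 0" using bd[of 0] by simp
  have "eventually (\<lambda>t. dist (v1 t) m < \<bar>m\<bar> / 2) F" using lim m by (intro tendstoD) auto
  then have "\<exists>a. \<forall>t\<in>{a..a + (4 * K + 4) / \<bar>m\<bar>}. \<bar>v1 t - m\<bar> < \<bar>m\<bar> / 2"
  proof (cases "F = at_top")
    case True
    then obtain N where N: "\<And>t. t \<ge> N \<Longrightarrow> \<bar>v1 t - m\<bar> < \<bar>m\<bar> / 2" using \<open>eventually _ F\<close>
      by (auto simp: eventually_at_top_linorder dist_real_def)
    show ?thesis by (rule exI[of _ N]) (use N in auto)
  next
    case False
    then obtain N where N: "\<And>t. t \<le> N \<Longrightarrow> \<bar>v1 t - m\<bar> < \<bar>m\<bar> / 2" using \<open>eventually _ F\<close> F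
      by (auto simp: eventually_at_bot_linorder dist_real_def)
    show ?thesis by (rule exI[of _ "N - (4 * K + 4) / \<bar>m\<bar>"]) (use N in auto)
  qed
  then obtain a where a: "\<And>t. a \<le> t \<Longrightarrow> t \<le> a + (4 * K + 4) / \<bar>m\<bar> \<Longrightarrow> \<bar>v1 t - m\<bar> < \<bar>m\<bar> / 2"
    by (metis atLeastAtMost_iff)
  have ab: "a \<le> a + (4 * K + 4) / \<bar>m\<bar>" using K by simp
  define b where "b = a + (4 * K + 4) / \<bar>m\<bar>"
  have ba: "\<bar>m\<bar> / 2 * (b - a) = 2 * K + 2" using m by (simp add: b_def)
  have aleb: "a \<le> b" using ab b_def by simp
  show False
  proof (cases "m > 0")
    case True
    have "v a - m / 2 * a \<le> v b - m / 2 * b"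
    proof (rule deriv_nonneg_le[OF aleb, where f' = "\<lambda>x. v1 x - m / 2"])
      show "0 \<le> v1 x - m / 2" if "a \<le> x" "x \<le> b" for x
        using a[of x] that True unfolding b_def abs_real_def by (auto split: if_splits)
    qed (auto intro!: derivative_eq_intros d)
    moreover have "m / 2 * b - m / 2 * a = 2 * K + 2" using ba True by (simp add: algebra_simps)
    ultimately show False using bd[of a] bd[of b] by linarith
  next
    case False
    have "v b - m / 2 * b \<le> v a - m / 2 * a"
    proof (rule deriv_nonpos_ge[OF aleb, where f' = "\<lambda>x. v1 x - m / 2"])
      show "v1 x - m / 2 \<le> 0" if "a \<le> x" "x \<le> b" for x
        using a[of x] that False m unfolding b_def abs_real_def by (auto split: if_splits)
    qed (auto intro!: derivative_eq_intros d)
    moreover have "m / 2 * a - m / 2 * b = 2 * K + 2" using ba False m by (simp add: field_simps)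
    ultimately show False using bd[of a] bd[of b] by linarith
  qed
qed

lemma solution_limit:
  assumes u: "twice_diff u u1 u2" and eq: "\<And>t. u2 t - c * u1 t - u t = - G t"
    and bd: "\<And>t. \<bar>u t\<bar> \<le> K" "\<And>t. \<bar>u1 t\<bar> \<le> K1"
    and "(u \<longlongrightarrow> l) F" "(G \<longlongrightarrow> m) F" "F = at_top \<or> F = at_bot"
  shows "l = m"
proof -
  have "l - m = 0"
  proof (rule deriv_limit_zero[of "\<lambda>t. u1 t - c * u t" "\<lambda>t. u t - G t" "K1 + \<bar>c\<bar> * K"])
    fix t
    have "u2 t - c * u1 t = u t - G t" using eq[of t] by simp
    then show "((\<lambda>t. u1 t - c * u t) has_real_derivative u t - G t) (at t)"
      using u by (auto simp: twice_diff_def mult.commute intro!: derivative_eq_intros)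
    have "\<bar>u1 t - c * u t\<bar> \<le> \<bar>u1 t\<bar> + \<bar>c\<bar> * \<bar>u t\<bar>" by (simp add: abs_mult[symmetric])
    also have "\<dots> \<le> K1 + \<bar>c\<bar> * K" by (intro add_mono mult_left_mono bd) auto
    finally show "\<bar>u1 t - c * u t\<bar> \<le> K1 + \<bar>c\<bar> * K" .
  qed (use assms in \<open>auto intro: tendsto_diff\<close>)
  then show ?thesis by simp
qed

section \<open>The characteristic function\<close>

text \<open>The derivative of \<open>chi\<close> in \<open>z\<close>.\<close>

definition chi1 :: "real \<Rightarrow> real \<Rightarrow> real \<Rightarrow> real \<Rightarrow> real" where
  "chi1 g0 h z c = 2 * z - c - g0 * c * h * exp (- z * c * h)"

text \<open>The square has quadratic remainder exactly (z - w)^2, and the exponential lies above its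
  tangents. This strict convexity is the source of nearly all sign information about
  \<open>chi\<close> below.\<close>

lemma chi_tangent:
  assumes "g0 \<ge> 0"
  shows "chi g0 h z c \<ge> chi g0 h w c + chi1 g0 h w c * (z - w) + (z - w)\<^sup>2"
proof -
  have "exp (- z * c * h) = exp (- w * c * h) * exp (- (z - w) * (c * h))"
    by (simp flip: exp_add add: algebra_simps)
  moreover have "exp (- w * c * h) * exp (- (z - w) * (c * h)) \<ge> exp (- w * c * h) * (1 + - (z - w) * (c * h))"
    by (intro mult_left_mono exp_ge_add_one_self) auto
  ultimately have "g0 * exp (- z * c * h) \<ge> g0 * (exp (- w * c * h) * (1 + - (z - w) * (c * h)))"
    using assms by (intro mult_left_mono) auto
  then show ?thesis
    by (simp add: chi_def chi1_def power2_eq_square algebra_simps)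
qed

lemma chi_cont: "isCont (\<lambda>z. chi g0 h z c) z"
  unfolding chi_def by (intro continuous_intros)

lemma chi_cont_speed: "isCont (\<lambda>c. chi g0 h z c) c"
  unfolding chi_def by (intro continuous_intros)

lemma chi_antimono_speed:
  assumes "z > 0" "c' < c" "g0 \<ge> 0" "h \<ge> 0"
  shows "chi g0 h z c < chi g0 h z c'"
proof -
  have "c' * z < c * z" using assms by simp
  moreover have "g0 * exp (- z * c * h) \<le> g0 * exp (- z * c' * h)"
    using assms by (intro mult_left_mono) (auto intro!: mult_right_mono)
  ultimately show ?thesis by (simp add: chi_def)
qed

text \<open>Follow the tangent at z in the direction in which it does not decrease: it reaches one
  of the two zeros, where \<open>chi_tangent\<close> would make chi positive if chi were nonnegative
  at z.\<close>

lemma chi_neg_between: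
  assumes "g0 \<ge> 0" "chi g0 h a c = 0" "chi g0 h b c = 0" "a < z" "z < b"
  shows "chi g0 h z c < 0"
proof (cases "chi1 g0 h z c \<ge> 0")
  case True
  have "chi1 g0 h z c * (b - z) \<ge> 0" "(b - z)\<^sup>2 > 0" using True assms by auto
  then show ?thesis using chi_tangent[OF assms(1), of h z c b] assms by linarith
next
  case False
  have "chi1 g0 h z c * (a - z) \<ge> 0" "(a - z)\<^sup>2 > 0" using False assms by (auto simp: mult_nonpos_nonpos)
  then show ?thesis using chi_tangent[OF assms(1), of h z c a] assms by linarith
qed

lemma chi1_signs:
  assumes "g0 \<ge> 0" "chi g0 h a c = 0" "chi g0 h b c = 0" "a < b"
  shows "chi1 g0 h a c < 0" "chi1 g0 h b c > 0"
proof -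
  have p: "(b - a)\<^sup>2 > 0" using assms by simp
  have "chi1 g0 h a c * (b - a) < 0" using chi_tangent[OF assms(1), of h a c b] assms p by linarith
  then show "chi1 g0 h a c < 0" using assms by (simp add: mult_less_0_iff)
  have "chi1 g0 h b c * (a - b) < 0"
    using chi_tangent[OF assms(1), of h b c a] assms p unfolding power2_commute[of a b] by linarith
  then show "chi1 g0 h b c > 0" using assms by (simp add: mult_less_0_iff)
qed

lemma chi_pos_right:
  assumes "g0 \<ge> 0" "chi g0 h b c = 0" "chi1 g0 h b c \<ge> 0" "b < z"
  shows "chi g0 h z c > 0"
proof -
  have "chi1 g0 h b c * (z - b) \<ge> 0" "(z - b)\<^sup>2 > 0" using assms by auto
  then show ?thesis using chi_tangent[OF assms(1), of h b c z] assms by linarith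
qed

lemma chi_pos_left:
  assumes "g0 \<ge> 0" "chi g0 h a c = 0" "chi1 g0 h a c \<le> 0" "z < a"
  shows "chi g0 h z c > 0"
proof -
  have "chi1 g0 h a c * (z - a) \<ge> 0" "(z - a)\<^sup>2 > 0" using assms by (auto simp: mult_nonpos_nonpos)
  then show ?thesis using chi_tangent[OF assms(1), of h a c z] assms by linarith
qed

lemma chi_root_pos:
  assumes "g0 > 0"
  shows "chi g0 h (root_pos c) c > 0"
  using root_pos_eq[of c] assms by (simp add: chi_def)

text \<open>In the variable $x = zc$ the double-root conditions decouple: $x$ is the zero of
  $g_0 e^{-xh}(xh+2) - x - 2$, and then $c$ is determined.\<close>
lemma double_root_iff:
  assumes "c > 0"
  shows "(chi g0 h z c = 0 \<and> chi1 g0 h z c = 0) \<longleftrightarrow>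
    (g0 * exp (- (z * c) * h) * (z * c * h + 2) - z * c - 2 = 0 \<and>
     2 * (z * c) = c\<^sup>2 * (1 + g0 * h * exp (- (z * c) * h)))"
proof -
  define e where "e = g0 * exp (- (z * c) * h)"
  have 1: "chi g0 h z c = z\<^sup>2 - c * z - 1 + e" by (simp add: chi_def e_def mult.assoc)
  have 2: "chi1 g0 h z c = 2 * z - c - c * h * e" by (simp add: chi1_def e_def algebra_simps)
  have 3: "c * (2 * z - c - c * h * e) = 2 * (z * c) - c\<^sup>2 * (1 + h * e)"
    by (simp add: power2_eq_square algebra_simps)
  have 4: "e * (z * c * h + 2) - z * c - 2 = 2 * (z\<^sup>2 - c * z - 1 + e) - z * (2 * z - c - c * h * e)"
    by (simp add: power2_eq_square algebra_simps)
  have 5: "g0 * h * exp (- (z * c) * h) = h * e" by (simp add: e_def)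
  show ?thesis
    unfolding 1 2 5 e_def[symmetric] 4
    using assms 3 by auto
qed

section \<open>The double root and the critical speed c_#\<close>

locale delayed_char =
  fixes g0 h :: real
  assumes g0: "g0 > 1" and h: "h > 0"
begin

lemma g0_nonneg: "g0 \<ge> 0" and g0_pos: "g0 > 0" using g0 by auto

lemma unique_critical:
  "\<exists>!x. x > 0 \<and> g0 * exp (- x * h) * (x * h + 2) - x - 2 = 0"
proof -
  define n where "n x = g0 * exp (- x * h) * (x * h + 2) - x - 2" for x
  have d: "(n has_real_derivative (- 1 - g0 * h * exp (- x * h) * (x * h + 1))) (at x)" for x
    unfolding n_def[abs_def] by (auto intro!: derivative_eq_intros simp: algebra_simps)
  have dec: "n y < n x" if "0 \<le> x" "x < y" for x y
  proof (rule DERIV_neg_imp_decreasing[OF that(2)])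
    fix s assume "x \<le> s" "s \<le> y"
    then have "g0 * h * exp (- s * h) * (s * h + 1) \<ge> 0" using that g0 h by simp
    then have "- 1 - g0 * h * exp (- s * h) * (s * h + 1) < 0" by linarith
    then show "\<exists>y. (n has_real_derivative y) (at s) \<and> y < 0" using d by blast
  qed
  have n0: "n 0 > 0" using g0 by (simp add: n_def)
  \<comment> \<open>At 2 * g0 the bound exp(-y)(y + 2) \<le> 2 already leaves a value of at most
    -2.\<close>
  have "n (2 * g0) < 0"
  proof -
    define y where "y = 2 * g0 * h"
    have y: "y \<ge> 0" using g0 h by (simp add: y_def)
    have "y + 2 \<le> 2 * exp y" using exp_ge_add_one_self[of y] y by linarith
    then have "exp (- y) * (y + 2) \<le> exp (- y) * (2 * exp y)" by (intro mult_left_mono) auto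
    also have "\<dots> = 2" by (simp add: exp_minus)
    finally have "g0 * (exp (- y) * (y + 2)) \<le> g0 * 2" using g0 by (intro mult_left_mono) auto
    then show ?thesis by (simp add: n_def y_def mult.assoc)
  qed
  moreover have "\<forall>x. 0 \<le> x \<and> x \<le> 2 * g0 \<longrightarrow> isCont n x" using d by (auto intro: DERIV_isCont)
  ultimately obtain x where x: "0 \<le> x" "x \<le> 2 * g0" "n x = 0"
    using IVT2[of n "2 * g0" 0 0] n0 g0 by auto
  have "x > 0" using x n0 by (cases "x = 0") auto
  moreover have "y = x" if "y > 0" "n y = 0" for y
    using dec[of x y] dec[of y x] x that by (cases x y rule: linorder_cases) auto
  ultimately show ?thesis using x unfolding n_def by blast
qed

text \<open>Makes the definite description usable: the unique x of \<open>unique_critical\<close>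
  determines c through the slope condition c^2 D = 2x, and then z = x/c.\<close>

lemma c_sharp_double_root:
  obtains z where "c_sharp g0 h > 0" "z > 0" "chi g0 h z (c_sharp g0 h) = 0" "chi1 g0 h z (c_sharp g0 h) = 0"
proof -
  obtain x where x: "x > 0" "g0 * exp (- x * h) * (x * h + 2) - x - 2 = 0"
    and xu: "\<And>y. y > 0 \<Longrightarrow> g0 * exp (- y * h) * (y * h + 2) - y - 2 = 0 \<Longrightarrow> y = x"
    using unique_critical by blast
  define D where "D = 1 + g0 * h * exp (- x * h)"
  have D: "D > 0" using g0 h by (simp add: D_def add_pos_pos)
  define c0 where "c0 = sqrt (2 * x / D)"
  have c0: "c0 > 0" "c0\<^sup>2 * D = 2 * x" using x D by (auto simp: c0_def)
  have r: "chi g0 h (x / c0) c0 = 0 \<and> chi1 g0 h (x / c0) c0 = 0"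
    using c0 x by (subst double_root_iff) (auto simp: D_def)
  have "c_sharp g0 h = c0"
    unfolding c_sharp_def
  proof (rule the_equality)
    show "c0 > 0 \<and> (\<exists>z>0. chi g0 h z c0 = 0 \<and> 2 * z - c0 - g0 * c0 * h * exp (- z * c0 * h) = 0)"
      using c0 x r by (intro conjI exI[of _ "x / c0"]) (auto simp: chi1_def)
    fix c assume "c > 0 \<and> (\<exists>z>0. chi g0 h z c = 0 \<and> 2 * z - c - g0 * c * h * exp (- z * c * h) = 0)"
    then obtain z where z: "c > 0" "z > 0" "chi g0 h z c = 0" "chi1 g0 h z c = 0"
      by (auto simp: chi1_def)
    then have e: "g0 * exp (- (z * c) * h) * (z * c * h + 2) - z * c - 2 = 0"
      "2 * (z * c) = c\<^sup>2 * (1 + g0 * h * exp (- (z * c) * h))"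
      using double_root_iff[of c g0 h z] by auto
    have zc: "z * c = x" using e(1) z by (intro xu) auto
    then have "c\<^sup>2 * D = 2 * x" using e(2) by (simp add: D_def)
    then have "c\<^sup>2 * D = c0\<^sup>2 * D" using c0 by simp
    then have "c\<^sup>2 = c0\<^sup>2" using D by simp
    then show "c = c0" using z c0 by (simp add: power2_eq_iff_nonneg)
  qed
  then show ?thesis using that[of "x / c0"] r c0 x by auto
qed

text \<open>With the product zc held fixed, the linear and the delay term of chi do not depend on
  the speed; only the square does. This reduces every speed to c_#, where chi is nonnegative with a
  double zero.\<close>

lemma chi_rescale:
  assumes "c > 0" "c' > 0"
  shows "chi g0 h z c = chi g0 h (z * c / c') c' + (z * c)\<^sup>2 * (1 / c\<^sup>2 - 1 / c'\<^sup>2)"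
  using assms by (simp add: chi_def field_simps)

lemma chi_pos_below_c_sharp:
  assumes "0 < c" "c < c_sharp g0 h" "z \<ge> 0"
  shows "chi g0 h z c > 0"
proof (cases "z = 0")
  case True
  then show ?thesis using g0 by (simp add: chi_def)
next
  case False
  obtain w where w: "c_sharp g0 h > 0" "w > 0" "chi g0 h w (c_sharp g0 h) = 0" "chi1 g0 h w (c_sharp g0 h) = 0"
    by (rule c_sharp_double_root)
  have "chi g0 h (z * c / c_sharp g0 h) (c_sharp g0 h) \<ge> (z * c / c_sharp g0 h - w)\<^sup>2"
    using chi_tangent[OF g0_nonneg, of h w "c_sharp g0 h" "z * c / c_sharp g0 h"] w by simp
  then have "chi g0 h (z * c / c_sharp g0 h) (c_sharp g0 h) \<ge> 0"
    by (meson order_trans zero_le_power2)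
  moreover have "1 / c\<^sup>2 - 1 / (c_sharp g0 h)\<^sup>2 > 0"
    using assms by (simp add: frac_less2 power_strict_mono)
  then have "(z * c)\<^sup>2 * (1 / c\<^sup>2 - 1 / (c_sharp g0 h)\<^sup>2) > 0" using False assms by simp
  ultimately show ?thesis using chi_rescale[of c "c_sharp g0 h" z] assms w by simp
qed

text \<open>Rescaling the double zero to a larger speed gives a point where chi < 0. Since chi is
  positive at 0 and at \<open>root_pos c\<close>, there is a zero on each side.\<close>

lemma roots_above_c_sharp:
  assumes "c > c_sharp g0 h"
  obtains a b where "0 < a" "a < b" "chi g0 h a c = 0" "chi g0 h b c = 0"
proof -
  obtain w where w: "c_sharp g0 h > 0" "w > 0" "chi g0 h w (c_sharp g0 h) = 0" "chi1 g0 h w (c_sharp g0 h) = 0"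
    by (rule c_sharp_double_root)
  define z where "z = w * c_sharp g0 h / c"
  have z: "z > 0" "z * c / c_sharp g0 h = w" using w assms by (auto simp: z_def)
  have "1 / c\<^sup>2 - 1 / (c_sharp g0 h)\<^sup>2 < 0"
    using assms w by (simp add: frac_less2 power_strict_mono)
  then have "(z * c)\<^sup>2 * (1 / c\<^sup>2 - 1 / (c_sharp g0 h)\<^sup>2) < 0"
    using z w assms by (intro mult_pos_neg) auto
  then have neg: "chi g0 h z c < 0" using chi_rescale[of c "c_sharp g0 h" z] assms w z by simp
  have c0: "chi g0 h 0 c > 0" using g0 by (simp add: chi_def)
  obtain a where a: "0 \<le> a" "a \<le> z" "chi g0 h a c = 0"
    using IVT2[of "\<lambda>z. chi g0 h z c" z 0 0] neg c0 z chi_cont by (auto simp: less_imp_le)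
  have "z < root_pos c"
  proof (rule ccontr)
    assume "\<not> ?thesis"
    then have "z \<ge> root_pos c" by simp
    have "z\<^sup>2 - c * z - 1 = (z - root_neg c) * (z - root_pos c)"
    proof -
      have "(z - root_neg c) * (z - root_pos c) = z\<^sup>2 - (root_neg c + root_pos c) * z + root_neg c * root_pos c"
        by (simp add: power2_eq_square algebra_simps)
      then show ?thesis by (simp add: root_sum root_prod)
    qed
    moreover have "(z - root_neg c) * (z - root_pos c) \<ge> 0"
      using \<open>z \<ge> root_pos c\<close> z root_neg_neg[of c] by (intro mult_nonneg_nonneg) auto
    ultimately have "chi g0 h z c \<ge> 0" using g0 by (simp add: chi_def)
    then show False using neg by simp
  qed
  then obtain b where b: "z \<le> b" "b \<le> root_pos c" "chi g0 h b c = 0"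
    using IVT[of "\<lambda>z. chi g0 h z c" z 0 "root_pos c"] neg chi_root_pos[OF g0_pos, of h c] chi_cont
    by (auto simp: less_imp_le)
  have "a \<noteq> 0" "a \<noteq> z" "b \<noteq> z" using a b c0 neg by auto
  then show ?thesis using that[of a b] a b by auto
qed

lemma root_unique:
  assumes "chi g0 h a c = 0" "chi g0 h b c = 0" "a < b" "chi g0 h z c = 0"
  shows "z = a \<or> z = b"
  using chi_neg_between[OF g0_nonneg assms(1,2), of z] chi_pos_right[OF g0_nonneg assms(2), of z]
    chi_pos_left[OF g0_nonneg assms(1), of z] chi1_signs[OF g0_nonneg assms(1-3)] assms(4)
  by (cases z a rule: linorder_cases; cases z b rule: linorder_cases) auto

lemma lambda_eq:
  assumes "chi g0 h a c = 0" "chi g0 h b c = 0" "0 < a" "a < b"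
  shows "lambda2 g0 h c = a" "lambda1 g0 h c = b"
proof -
  note u = root_unique[OF assms(1,2,4)]
  show "lambda2 g0 h c = a"
    unfolding lambda2_def
  proof (rule the_equality)
    fix z assume "z > 0 \<and> chi g0 h z c = 0 \<and> (\<exists>w>z. chi g0 h w c = 0)"
    then obtain w where "chi g0 h z c = 0" "w > z" "chi g0 h w c = 0" by auto
    then show "z = a" using u[of z] u[of w] assms by auto
  qed (use assms in auto)
  show "lambda1 g0 h c = b"
    unfolding lambda1_def
  proof (rule the_equality)
    fix z assume "z > 0 \<and> chi g0 h z c = 0 \<and> (\<exists>w. 0 < w \<and> w < z \<and> chi g0 h w c = 0)"
    then obtain w where "chi g0 h z c = 0" "w < z" "chi g0 h w c = 0" by auto
    then show "z = b" using u[of z] u[of w] assms by auto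
  qed (use assms in auto)
qed

end

section \<open>Exponential decay of fronts\<close>

lemma tendsto_exp_at_bot:
  assumes "(a::real) > 0"
  shows "((\<lambda>t. exp (a * t)) \<longlongrightarrow> 0) at_bot"
  by (rule filterlim_compose[OF exp_at_bot])
     (rule filterlim_tendsto_pos_mult_at_bot[OF tendsto_const assms filterlim_ident])

text \<open>Induction along a real interval for a property that can be improved by a fixed amount d;
  the minimum caps the last step at b. It drives both the gain of decay exponents where chi > 0 and
  the bootstrap between \<lambda>_2 and \<lambda>_1.\<close>

lemma min_step_induct [consumes 3, case_names step]:
  fixes a b d :: real
  assumes "a \<le> b" "d > 0" "P a" "\<And>z. a \<le> z \<Longrightarrow> z \<le> b \<Longrightarrow> P z \<Longrightarrow> P (min b (z + d))"
  shows "P b"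
proof -
  have "P (min b (a + real n * d))" for n
  proof (induction n)
    case 0
    then show ?case using assms by simp
  next
    case (Suc n)
    have "a \<le> min b (a + real n * d)" using assms by simp
    then have "P (min b (min b (a + real n * d) + d))" using Suc assms(4) by auto
    moreover have "min b (min b (a + real n * d) + d) = min b (a + real (Suc n) * d)"
      using assms by (auto simp: min_def algebra_simps)
    ultimately show ?case by simp
  qed
  moreover obtain n where "real n > (b - a) / d" using reals_Archimedean2 by blast
  then have "min b (a + real n * d) = b" using assms by (simp add: field_simps)
  ultimately show ?thesis by metis
qed

section \<open>The balance functional\<close>

context delayed_char
begin

text \<open>The functional obtained by dividing the symbol $\chi$ by $D - z$, applied to $u$ and
  multiplied by $e^{-zt}$; $Y$ is an antiderivative of $e^{-zt}u$.\<close>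
definition balance :: "real \<Rightarrow> real \<Rightarrow> (real \<Rightarrow> real) \<Rightarrow> (real \<Rightarrow> real) \<Rightarrow> (real \<Rightarrow> real) \<Rightarrow> real \<Rightarrow> real" where
  "balance c z u u1 Y t =
     exp (- z * t) * (u1 t + (z - c) * u t) - g0 * exp (- z * (c * h)) * (Y t - Y (t - c * h))"

text \<open>The increment of \<open>Y\<close> over one delay is weighted so that its derivative
  exchanges the delayed value of u for exp(-zch) times the present one; what remains multiplies u by
  exactly -chi(z).\<close>

lemma balance_deriv:
  assumes u: "twice_diff u u1 u2" and Y: "\<And>t. (Y has_real_derivative exp (- z * t) * u t) (at t)"
    and N: "u2 t - c * u1 t - u t + g0 * u (t - c * h) = N"
  shows "(balance c z u u1 Y has_real_derivative exp (- z * t) * (N - chi g0 h z c * u t)) (at t)"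
proof -
  have d: "(u has_real_derivative u1 t) (at t)" "(u1 has_real_derivative u2 t) (at t)"
    using u by (auto simp: twice_diff_def)
  have Y': "((\<lambda>t. Y (t - c * h)) has_real_derivative exp (- z * (t - c * h)) * u (t - c * h)) (at t)"
    using DERIV_shift[of Y "exp (- z * (t - c * h)) * u (t - c * h)" t "- (c * h)"] Y[of "t - c * h"] by simp
  have e: "exp (- z * (t - c * h)) = exp (- z * t) * exp (z * (c * h))"
    by (simp flip: exp_add add: algebra_simps)
  have e1: "exp (- z * (c * h)) * exp (z * (c * h)) = 1" by (simp flip: exp_add)
  have "(balance c z u u1 Y has_real_derivative
     - z * exp (- z * t) * (u1 t + (z - c) * u t) + exp (- z * t) * (u2 t + (z - c) * u1 t)
     - g0 * exp (- z * (c * h)) * (exp (- z * t) * u t - exp (- z * (t - c * h)) * u (t - c * h))) (at t)"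
    unfolding balance_def[abs_def]
    by (auto intro!: derivative_eq_intros d Y Y' simp: algebra_simps)
  moreover have "- z * exp (- z * t) * (u1 t + (z - c) * u t) + exp (- z * t) * (u2 t + (z - c) * u1 t)
     - g0 * exp (- z * (c * h)) * (exp (- z * t) * u t - exp (- z * (t - c * h)) * u (t - c * h))
     = exp (- z * t) * (N - chi g0 h z c * u t)" (is "?l = ?r")
  proof -
    have "?l = exp (- z * t) * (- z * (u1 t + (z - c) * u t) + (u2 t + (z - c) * u1 t)
      - g0 * exp (- z * (c * h)) * u t + g0 * (exp (- z * (c * h)) * exp (z * (c * h))) * u (t - c * h))"
      unfolding e by (simp add: algebra_simps)
    also have "\<dots> = ?r"
      unfolding e1 N[symmetric] chi_def by (simp add: algebra_simps power2_eq_square)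
    finally show ?thesis .
  qed
  ultimately show ?thesis by simp
qed

end

text \<open>The quantitative content of (H): \<open>g_near_0\<close> is the condition on g(u)/u
  multiplied by u, and \<open>g_near_kappa\<close> is the mean value form of g' < 1 near \<kappa>,
  with \<open>q\<close> a contraction constant on [\<kappa> - \<epsilon>, \<kappa>].\<close>

locale monostable =
  fixes g :: "real \<Rightarrow> real" and \<kappa> g0 h Kg \<theta> \<delta> q \<epsilon> :: real
  assumes h: "h > 0" and g0: "g0 > 1" and kappa: "\<kappa> > 0"
    and g_nonneg: "\<And>x. 0 \<le> x \<Longrightarrow> 0 \<le> g x"
    and g_strict: "\<And>x y. 0 \<le> x \<Longrightarrow> x < y \<Longrightarrow> g x < g y"
    and g_cont: "continuous_on {0..} g"
    and g_zero: "g 0 = 0" and g_kappa: "g \<kappa> = \<kappa>"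
    and g_fixed: "\<And>x. 0 \<le> x \<Longrightarrow> g x = x \<Longrightarrow> x = 0 \<or> x = \<kappa>"
    and Kg: "Kg > 0" and theta: "\<theta> > 0" and delta: "\<delta> > 0"
    and g_near_0: "\<And>u. 0 < u \<Longrightarrow> u \<le> \<delta> \<Longrightarrow> \<bar>g u - g0 * u\<bar> \<le> Kg * u powr (1 + \<theta>)"
    and q: "0 < q" "q < 1" and eps: "0 < \<epsilon>" "\<epsilon> < \<kappa>"
    and g_near_kappa: "\<And>x y. \<kappa> - \<epsilon> \<le> x \<Longrightarrow> x \<le> y \<Longrightarrow> y \<le> \<kappa> \<Longrightarrow> g y - g x \<le> q * (y - x)"
begin

sublocale delayed_char g0 h
  by unfold_locales (rule g0 h)+

lemma g_mono: "0 \<le> x \<Longrightarrow> x \<le> y \<Longrightarrow> g x \<le> g y"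
  using g_strict[of x y] by (cases "x = y") auto

text \<open>Where X exceeds Y the constant q acts, elsewhere monotonicity of g does; so X itself may
  lie anywhere below Y + e. This is how the contraction is applied to a perturbed profile.\<close>

lemma g_diff_bound:
  assumes X: "0 \<le> X" "X \<le> \<kappa>" and Y: "\<kappa> - \<epsilon> \<le> Y" "Y \<le> \<kappa>" and XY: "X \<le> Y + e" "0 \<le> e"
  shows "g X \<le> g Y + q * e"
proof (cases "X \<le> Y")
  case True
  have "g X \<le> g Y" by (rule g_mono[OF X(1) True])
  moreover have "0 \<le> q * e" using q XY by simp
  ultimately show ?thesis by simp
next
  case False
  then have "g X - g Y \<le> q * (X - Y)" using X Y by (intro g_near_kappa) auto
  also have "\<dots> \<le> q * e" using q XY by (intro mult_left_mono) auto
  finally show ?thesis by simp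
qed

end

section \<open>Elementary properties of a front profile\<close>

locale front_profile = monostable +
  fixes c :: real and \<phi> \<phi>1 \<phi>2 :: "real \<Rightarrow> real"
  assumes c: "c > 0" and phi: "twice_diff \<phi> \<phi>1 \<phi>2"
    and eq: "\<And>t. \<phi>2 t - c * \<phi>1 t - \<phi> t = - g (\<phi> (t - c * h))"
    and pos: "\<And>t. \<phi> t > 0" and mono: "mono \<phi>"
    and lim_bot: "(\<phi> \<longlongrightarrow> 0) at_bot" and lim_top: "(\<phi> \<longlongrightarrow> \<kappa>) at_top"
begin

abbreviation \<beta> where "\<beta> \<equiv> root_pos c"

lemma beta_pos: "\<beta> > 0" by (rule root_pos_pos)

lemma d1: "(\<phi> has_real_derivative \<phi>1 t) (at t)" and d2: "(\<phi>1 has_real_derivative \<phi>2 t) (at t)"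
  using phi by (auto simp: twice_diff_def)

lemma cont: "isCont \<phi> t" using d1 by (rule DERIV_isCont)

lemma cont_on: "continuous_on A \<phi>"
  using cont by (simp add: continuous_at_imp_continuous_on)

lemma phi_mono: "s \<le> t \<Longrightarrow> \<phi> s \<le> \<phi> t"
  using mono by (rule monoD)

lemma tau: "c * h > 0" using c h by simp

lemma le_kappa: "\<phi> t \<le> \<kappa>"
proof (rule tendsto_lowerbound[OF lim_top])
  show "\<forall>\<^sub>F s in at_top. \<phi> t \<le> \<phi> s"
    using eventually_ge_at_top[of t] by eventually_elim (rule phi_mono)
qed simp

lemma deriv_bounds: "root_neg c * \<phi> t \<le> \<phi>1 t" "\<phi>1 t \<le> \<beta> * \<phi> t"
  by (rule supersolution_deriv_bounds[OF phi]; use pos g_nonneg eq in \<open>auto simp: less_imp_le\<close>)+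

text \<open>Differences of translates are nonnegative because \<phi> is increasing, and
  supersolutions because g is as well; so the Harnack bounds hold for all increments with constants
  independent of d.\<close>

lemma shift_deriv_bounds:
  assumes "d \<ge> 0"
  shows "root_neg c * (\<phi> (t + d) - \<phi> t) \<le> \<phi>1 (t + d) - \<phi>1 t"
    "\<phi>1 (t + d) - \<phi>1 t \<le> \<beta> * (\<phi> (t + d) - \<phi> t)"
proof -
  have td: "twice_diff (\<lambda>t. \<phi> (t + d) - \<phi> t) (\<lambda>t. \<phi>1 (t + d) - \<phi>1 t) (\<lambda>t. \<phi>2 (t + d) - \<phi>2 t)"
    unfolding twice_diff_def
    by (auto intro!: derivative_eq_intros DERIV_shift[THEN iffD1] d1 d2)
  have nn: "\<phi> (t + d) - \<phi> t \<ge> 0" for t using phi_mono[of t "t + d"] assms by simp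
  have le: "(\<phi>2 (t + d) - \<phi>2 t) - c * (\<phi>1 (t + d) - \<phi>1 t) - (\<phi> (t + d) - \<phi> t) \<le> 0" for t
  proof -
    have "\<phi> (t - c * h) \<le> \<phi> (t + d - c * h)" using assms by (intro phi_mono) simp
    then have "g (\<phi> (t - c * h)) \<le> g (\<phi> (t + d - c * h))" using pos by (intro g_mono) (auto simp: less_imp_le)
    then show ?thesis using eq[of t] eq[of "t + d"] by (simp add: algebra_simps)
  qed
  show "root_neg c * (\<phi> (t + d) - \<phi> t) \<le> \<phi>1 (t + d) - \<phi>1 t"
    "\<phi>1 (t + d) - \<phi>1 t \<le> \<beta> * (\<phi> (t + d) - \<phi> t)"
    using supersolution_deriv_bounds[OF td nn le] by auto
qed

text \<open>Equality at two points spreads by the strong maximum principle and makes \<phi>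
  periodic, which is incompatible with positivity and the limit 0 at -\<infinity>.\<close>

lemma strict: "s < t \<Longrightarrow> \<phi> s < \<phi> t"
proof (rule ccontr)
  assume st: "s < t" and "\<not> \<phi> s < \<phi> t"
  then have e: "\<phi> s = \<phi> t" using phi_mono[of s t] by simp
  define d where "d = t - s"
  have d: "d > 0" using st by (simp add: d_def)
  have z: "\<phi> (r + d) - \<phi> r = 0" for r
  proof (rule strong_maximum[of "\<lambda>t. \<phi> (t + d) - \<phi> t" "\<lambda>t. \<phi>1 (t + d) - \<phi>1 t" "root_neg c" \<beta> s])
    show "\<phi> (s + d) - \<phi> s = 0" using e by (simp add: d_def)
    show "((\<lambda>t. \<phi> (t + d) - \<phi> t) has_real_derivative \<phi>1 (t + d) - \<phi>1 t) (at t)" for t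
      by (auto intro!: derivative_eq_intros DERIV_shift[THEN iffD1] d1)
    show "\<phi> (t + d) - \<phi> t \<ge> 0" for t using phi_mono[of t "t + d"] d by simp
  qed (use shift_deriv_bounds d in auto)
  have zn: "\<phi> (0 - real n * d) = \<phi> 0" for n
  proof (induction n)
    case (Suc n)
    then show ?case using z[of "0 - real (Suc n) * d"] by (simp add: algebra_simps)
  qed simp
  have "filterlim (\<lambda>n. 0 - real n * d) at_bot sequentially"
    using d by real_asymp
  then have "(\<lambda>n. \<phi> (0 - real n * d)) \<longlonglongrightarrow> 0" by (rule filterlim_compose[OF lim_bot])
  then have "\<phi> 0 = 0" unfolding zn by (simp add: LIMSEQ_const_iff)
  then show False using pos[of 0] by simp
qed

lemma phi1_nonneg: "\<phi>1 t \<ge> 0"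
proof (rule ccontr)
  assume "\<not> ?thesis"
  then obtain r where "r > 0" "\<And>h. 0 < h \<Longrightarrow> h < r \<Longrightarrow> \<phi> (t + h) < \<phi> t"
    using DERIV_neg_dec_right[OF d1[of t]] by auto
  then have "\<phi> (t + r / 2) < \<phi> t" by auto
  then show False using strict[of t "t + r / 2"] \<open>r > 0\<close> by simp
qed

text \<open>Divide \<open>shift_deriv_bounds\<close> by d and let d tend to 0; the equation itself
  cannot be differentiated, as g need not be differentiable along the profile.\<close>

lemma second_deriv_bounds: "root_neg c * \<phi>1 t \<le> \<phi>2 t" "\<phi>2 t \<le> \<beta> * \<phi>1 t"
proof -
  have ev: "eventually (\<lambda>d. d > (0::real)) (at_right 0)" by (simp add: eventually_at_right_less)
  note l1 = difference_quotient[OF d1[of t]] and l2 = difference_quotient[OF d2[of t]]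
  show "root_neg c * \<phi>1 t \<le> \<phi>2 t"
  proof (rule tendsto_le[OF _ l2 tendsto_mult[OF tendsto_const l1]])
    show "\<forall>\<^sub>F d in at_right 0. root_neg c * ((\<phi> (t + d) - \<phi> t) / d) \<le> (\<phi>1 (t + d) - \<phi>1 t) / d"
      using ev by eventually_elim (use shift_deriv_bounds in \<open>auto simp: divide_right_mono\<close>)
  qed simp
  show "\<phi>2 t \<le> \<beta> * \<phi>1 t"
  proof (rule tendsto_le[OF _ tendsto_mult[OF tendsto_const l1] l2])
    show "\<forall>\<^sub>F d in at_right 0. (\<phi>1 (t + d) - \<phi>1 t) / d \<le> \<beta> * ((\<phi> (t + d) - \<phi> t) / d)"
      using ev by eventually_elim (use shift_deriv_bounds in \<open>auto simp: divide_right_mono\<close>)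
  qed simp
qed

lemma phi1_pos: "\<phi>1 t > 0"
proof (rule ccontr)
  assume "\<not> ?thesis"
  then have z: "\<phi>1 t = 0" using phi1_nonneg[of t] by simp
  have "\<phi>1 r = 0" for r
    by (rule strong_maximum[OF d2 phi1_nonneg second_deriv_bounds z])
  then have "\<phi> 1 \<le> \<phi> 0" using deriv_nonpos_ge[of 0 1 \<phi> \<phi>1] d1 by simp
  then show False using strict[of 0 1] by simp
qed

lemma harnack: "s \<le> t \<Longrightarrow> \<phi> t \<le> exp (\<beta> * (t - s)) * \<phi> s"
  by (rule growth_upper[OF d1 deriv_bounds(2)])

definition N where "N t = g0 * \<phi> (t - c * h) - g (\<phi> (t - c * h))"

lemma linear_eq: "\<phi>2 t - c * \<phi>1 t - \<phi> t + g0 * \<phi> (t - c * h) = N t"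
  using eq[of t] by (simp add: N_def)

lemma phi_small:
  assumes "r > 0"
  obtains T where "T \<le> 0" "\<And>t. t \<le> T \<Longrightarrow> \<phi> t < r"
proof -
  have "eventually (\<lambda>t. \<phi> t < r) at_bot" using lim_bot assms by (rule order_tendstoD)
  then obtain T where "\<And>t. t \<le> T \<Longrightarrow> \<phi> t < r" by (auto simp: eventually_at_bot_linorder)
  then show ?thesis by (intro that[of "min T 0"]) auto
qed

lemma N_powr_bound:
  assumes "\<phi> t \<le> \<delta>"
  shows "\<bar>N t\<bar> \<le> Kg * \<phi> (t - c * h) powr (1 + \<theta>)"
proof -
  have "\<phi> (t - c * h) \<le> \<delta>" using monoD[OF mono, of "t - c * h" t] tau assms by simp
  then show ?thesis using g_near_0[of "\<phi> (t - c * h)"] pos by (simp add: N_def abs_minus_commute)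
qed

lemma N_small:
  assumes "\<eta> > 0"
  obtains T where "T \<le> 0" "\<And>t. t \<le> T \<Longrightarrow> \<bar>N t\<bar> \<le> \<eta> * \<phi> t"
proof -
  \<comment> \<open>The second entry solves \<open>Kg * r powr \<theta> = \<eta>\<close>.\<close>
  define r where "r = min \<delta> ((\<eta> / Kg) powr (1 / \<theta>))"
  have "r > 0" using delta assms Kg by (simp add: r_def)
  then obtain T where T: "T \<le> 0" "\<And>t. t \<le> T \<Longrightarrow> \<phi> t < r" using phi_small by blast
  show ?thesis
  proof (rule that[OF T(1)])
    fix t assume t: "t \<le> T"
    define x where "x = \<phi> (t - c * h)"
    have x: "x > 0" "x \<le> \<phi> t" using pos monoD[OF mono, of "t - c * h" t] tau by (auto simp: x_def)
    have "\<bar>N t\<bar> \<le> Kg * x powr (1 + \<theta>)"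
      unfolding x_def by (rule N_powr_bound) (use T(2)[OF t] in \<open>simp add: r_def\<close>)
    also have "\<dots> = Kg * x powr \<theta> * x" using x by (simp add: powr_add)
    also have "x powr \<theta> \<le> ((\<eta> / Kg) powr (1 / \<theta>)) powr \<theta>"
      using x T(2)[OF t] theta by (intro powr_mono2) (auto simp: r_def)
    also have "\<dots> = \<eta> / Kg" using theta assms Kg by (simp add: powr_powr)
    finally have "\<bar>N t\<bar> \<le> \<eta> * x" using Kg x by (simp add: mult_left_mono mult_right_mono)
    also have "\<dots> \<le> \<eta> * \<phi> t" using x assms by simp
    finally show "\<bar>N t\<bar> \<le> \<eta> * \<phi> t" .
  qed
qed

lemma antiderivative_weighted:
  obtains Y where "\<And>t. (Y has_real_derivative exp (- z * t) * \<phi> t) (at t)"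
proof -
  have "continuous_on UNIV (\<lambda>t. exp (- z * t) * \<phi> t)" by (intro continuous_intros cont_on)
  then show ?thesis using antiderivative_exists that by blast
qed

context
  fixes z :: real and Y
  assumes z: "z \<ge> 0" and Y: "\<And>t. (Y has_real_derivative exp (- z * t) * \<phi> t) (at t)"
begin

abbreviation (input) I where "I \<equiv> balance c z \<phi> \<phi>1 Y"

lemma balance_front_deriv:
  "(I has_real_derivative exp (- z * t) * (N t - chi g0 h z c * \<phi> t)) (at t)"
  using phi Y linear_eq by (rule balance_deriv)

lemma weighted_window:
  "0 \<le> Y t - Y (t - c * h)" "Y t - Y (t - c * h) \<le> c * h * (exp (z * (c * h)) * (exp (- z * t) * \<phi> t))"
proof -
  have le: "t - c * h \<le> t" using tau by simp
  have "Y (t - c * h) \<le> Y t"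
    by (rule deriv_nonneg_le[OF le Y]) (use pos in \<open>auto simp: less_imp_le\<close>)
  then show "0 \<le> Y t - Y (t - c * h)" by simp
  define m where "m = exp (z * (c * h)) * (exp (- z * t) * \<phi> t)"
  have "Y t - m * t \<le> Y (t - c * h) - m * (t - c * h)"
  proof (rule deriv_nonpos_ge[OF le, where f' = "\<lambda>s. exp (- z * s) * \<phi> s - m"])
    fix s assume s: "t - c * h \<le> s" "s \<le> t"
    have "z * t \<le> z * s + z * (c * h)" using mult_left_mono[OF s(1) z] by (simp add: algebra_simps)
    then have "exp (- z * s) \<le> exp (z * (c * h)) * exp (- z * t)" by (simp flip: exp_add)
    then have "exp (- z * s) * \<phi> s \<le> exp (z * (c * h)) * exp (- z * t) * \<phi> t"
      using s phi_mono[of s t] pos[of s] by (intro mult_mono) (auto simp: less_imp_le)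
    then show "exp (- z * s) * \<phi> s - m \<le> 0" by (simp add: m_def mult.assoc)
  qed (auto intro!: derivative_eq_intros Y)
  then show "Y t - Y (t - c * h) \<le> c * h * m" by (simp add: algebra_simps)
qed

text \<open>With \<open>balance_upper\<close> this compares the functional with exp(-zt)\<phi>,
  using \<phi>' \<ge> 0 here and \<phi>' \<le> \<beta>\<phi> there. In the window term exp(-zch) and
  exp(zch) cancel, so the constant does not depend on z and the later gain in the exponent is
  uniform.\<close>

lemma balance_lower: "- (c + g0 * (c * h)) * (exp (- z * t) * \<phi> t) \<le> I t"
proof -
  define y where "y = exp (- z * t) * \<phi> t"
  have "z * \<phi> t \<ge> 0" using z pos[of t] by simp
  then have "\<phi>1 t + (z - c) * \<phi> t \<ge> - c * \<phi> t" using phi1_nonneg[of t] by (simp add: algebra_simps)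
  then have "exp (- z * t) * (- c * \<phi> t) \<le> exp (- z * t) * (\<phi>1 t + (z - c) * \<phi> t)"
    by (rule mult_left_mono) simp
  then have 1: "- (c * y) \<le> exp (- z * t) * (\<phi>1 t + (z - c) * \<phi> t)" by (simp add: y_def mult.left_commute)
  have "g0 * exp (- z * (c * h)) * (Y t - Y (t - c * h))
      \<le> g0 * exp (- z * (c * h)) * (c * h * (exp (z * (c * h)) * y))"
    unfolding y_def using g0_pos by (intro mult_left_mono weighted_window) auto
  also have "\<dots> = g0 * (c * h) * y * (exp (- z * (c * h)) * exp (z * (c * h)))"
    by (simp only: ac_simps)
  also have "exp (- z * (c * h)) * exp (z * (c * h)) = 1" by (simp flip: exp_add)
  finally have 2: "g0 * exp (- z * (c * h)) * (Y t - Y (t - c * h)) \<le> g0 * (c * h) * y"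
    by (simp only: mult_1_right)
  have "- (c + g0 * (c * h)) * y = - (c * y) - g0 * (c * h) * y" by (simp add: algebra_simps)
  then show ?thesis using 1 2 unfolding balance_def y_def[symmetric] by linarith
qed

lemma balance_upper: "I t \<le> (\<beta> + z) * (exp (- z * t) * \<phi> t)"
proof -
  have "0 \<le> g0 * exp (- z * (c * h))" using g0_pos by simp
  then have 1: "0 \<le> g0 * exp (- z * (c * h)) * (Y t - Y (t - c * h))"
    by (rule mult_nonneg_nonneg) (rule weighted_window(1))
  have "c * \<phi> t \<ge> 0" using c pos[of t] by simp
  then have "\<phi>1 t + (z - c) * \<phi> t \<le> (\<beta> + z) * \<phi> t"
    using deriv_bounds(2)[of t] by (simp add: algebra_simps)
  then have "exp (- z * t) * (\<phi>1 t + (z - c) * \<phi> t) \<le> exp (- z * t) * ((\<beta> + z) * \<phi> t)"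
    by (rule mult_left_mono) simp
  then have "exp (- z * t) * (\<phi>1 t + (z - c) * \<phi> t) \<le> (\<beta> + z) * (exp (- z * t) * \<phi> t)"
    by (simp add: mult.left_commute)
  then show ?thesis using 1 unfolding balance_def by linarith
qed

lemma balance_deriv_upper:
  assumes "chi0 \<le> chi g0 h z c" "\<bar>N t\<bar> \<le> chi0 / 2 * \<phi> t"
  shows "exp (- z * t) * (N t - chi g0 h z c * \<phi> t) \<le> - (chi0 / 2) * (exp (- z * t) * \<phi> t)"
proof -
  have "chi0 * \<phi> t \<le> chi g0 h z c * \<phi> t" using assms pos[of t] by simp
  then have "N t - chi g0 h z c * \<phi> t \<le> - (chi0 / 2) * \<phi> t" using assms(2) by (simp add: abs_le_iff)
  then have "exp (- z * t) * (N t - chi g0 h z c * \<phi> t) \<le> exp (- z * t) * (- (chi0 / 2) * \<phi> t)"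
    by (intro mult_left_mono) auto
  then show ?thesis by (simp add: algebra_simps)
qed

text \<open>Put y = exp(-zt)\<phi>. The derivative of I is at most -(chi0/2)y, while -I \<le> C1 y;
  hence I' \<le> dI with d = chi0/(2 C1), and a nonpositive I decays like exp(dt) towards
  -\<infinity>. This decay then passes to y.\<close>

lemma decay_from_balance:
  assumes chi0: "0 < chi0" "chi0 \<le> chi g0 h z c"
    and N: "\<And>t. t \<le> T \<Longrightarrow> \<bar>N t\<bar> \<le> chi0 / 2 * \<phi> t" and I: "\<And>t. t \<le> T \<Longrightarrow> I t \<le> 0"
  shows "((\<lambda>t. exp (- (z + chi0 / (4 * (c + g0 * (c * h)))) * t) * \<phi> t) \<longlongrightarrow> 0) at_bot"
proof -
  define C1 where "C1 = c + g0 * (c * h)"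
  have C1: "C1 > 0" using c tau g0_pos by (simp add: C1_def add_pos_pos)
  define d where "d = chi0 / (2 * C1)"
  have d: "d > 0" using chi0 C1 by (simp add: d_def)
  define y where "y t = exp (- z * t) * \<phi> t" for t
  have y: "y t > 0" for t using pos by (simp add: y_def)
  note I' = balance_front_deriv
  have I'le: "exp (- z * t) * (N t - chi g0 h z c * \<phi> t) \<le> - (chi0 / 2) * y t" if "t \<le> T" for t
    unfolding y_def by (rule balance_deriv_upper[OF chi0(2) N[OF that]])
  have lowI: "- C1 * y t \<le> I t" for t using balance_lower[of t] by (simp add: C1_def y_def)
  have exp_bd: "- I t \<le> - I T * exp (d * (t - T))" if "t \<le> T" for t
  proof -
    have "I T * exp (- d * T) \<le> I t * exp (- d * t)"
    proof (rule deriv_nonpos_ge[OF that, where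
          f' = "\<lambda>s. (exp (- z * s) * (N s - chi g0 h z c * \<phi> s) - d * I s) * exp (- d * s)"])
      fix s assume s: "t \<le> s" "s \<le> T"
      have "- d * I s \<le> d * (C1 * y s)" using mult_left_mono[OF lowI[of s], of d] d by simp
      also have "\<dots> = chi0 / 2 * y s" using C1 by (simp add: d_def)
      finally show "(exp (- z * s) * (N s - chi g0 h z c * \<phi> s) - d * I s) * exp (- d * s) \<le> 0"
        using I'le[OF s(2)] by (intro mult_nonpos_nonneg) auto
    qed (auto intro!: derivative_eq_intros I' simp: algebra_simps)
    then have "I T * exp (- d * T) * exp (d * t) \<le> I t * exp (- d * t) * exp (d * t)"
      by (rule mult_right_mono) simp
    then show ?thesis by (simp add: mult.assoc flip: exp_add) (simp add: algebra_simps)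
  qed
  \<comment> \<open>The inequality -I \<le> C1 y bounds y from below only. An upper bound comes from
    integrating I' over [t - 1, t], where the Harnack inequality keeps y above exp(-\<beta>)y(t);
    the term I(t - 1) is nonpositive and drops out.\<close>
  have y_bd: "y t \<le> 2 * exp \<beta> / chi0 * (- I T * exp (d * (t - T)))" if t: "t \<le> T" for t
  proof -
    define m where "m = chi0 / 2 * (exp (- \<beta>) * y t)"
    have "I t + m * t \<le> I (t - 1) + m * (t - 1)"
    proof (rule deriv_nonpos_ge[of "t - 1" t "\<lambda>s. I s + m * s" "\<lambda>s. exp (- z * s) * (N s - chi g0 h z c * \<phi> s) + m"])
      fix s assume s: "t - 1 \<le> s" "s \<le> t"
      have "\<phi> t \<le> exp (\<beta> * (t - s)) * \<phi> s" by (rule harnack[OF s(2)])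
      also have "\<dots> \<le> exp \<beta> * \<phi> s" using s beta_pos pos[of s] by (intro mult_right_mono) auto
      finally have "exp (- z * t) * \<phi> t \<le> exp (- z * s) * (exp \<beta> * \<phi> s)"
        using s z pos[of t] by (intro mult_mono) (auto intro!: mult_left_mono)
      then have "y t \<le> exp \<beta> * y s" by (simp add: y_def algebra_simps)
      then have "exp (- \<beta>) * y t \<le> exp (- \<beta>) * (exp \<beta> * y s)" by (intro mult_left_mono) auto
      also have "\<dots> = y s" by (simp add: mult.assoc[symmetric] flip: exp_add)
      finally have "m \<le> chi0 / 2 * y s" using chi0 by (simp add: m_def)
      then show "exp (- z * s) * (N s - chi g0 h z c * \<phi> s) + m \<le> 0" using I'le[of s] s t by simp
    qed (auto intro!: derivative_eq_intros I')
    moreover have "I (t - 1) \<le> 0" using I t by simp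
    ultimately have "m \<le> - I t" by (simp add: algebra_simps)
    then have "m \<le> - I T * exp (d * (t - T))" using exp_bd[OF t] by simp
    then have "2 * exp \<beta> / chi0 * m \<le> 2 * exp \<beta> / chi0 * (- I T * exp (d * (t - T)))"
      by (rule mult_left_mono) (use chi0 in simp)
    moreover have "2 * exp \<beta> / chi0 * m = y t" using chi0 by (simp add: m_def exp_minus field_simps)
    ultimately show ?thesis by simp
  qed
  define C where "C = 2 * exp \<beta> / chi0 * (- I T * exp (- d * T))"
  have "y t \<le> C * exp (d * t)" if "t \<le> T" for t
    using y_bd[OF that] by (simp add: C_def algebra_simps exp_diff exp_minus divide_inverse)
  \<comment> \<open>Half of the gained rate is given up to turn a bound into convergence to
    0.\<close>
  then have le: "exp (- (z + d / 2) * t) * \<phi> t \<le> C * exp (d / 2 * t)" if "t \<le> T" for t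
  proof -
    have "exp (- (z + d / 2) * t) * \<phi> t = y t * exp (- (d / 2) * t)"
      by (simp add: y_def algebra_simps flip: exp_add)
    also have "\<dots> \<le> C * exp (d * t) * exp (- (d / 2) * t)"
      using that \<open>\<And>t. t \<le> T \<Longrightarrow> y t \<le> C * exp (d * t)\<close> by (intro mult_right_mono) auto
    also have "\<dots> = C * exp (d / 2 * t)" by (simp add: mult.assoc flip: exp_add)
    finally show ?thesis .
  qed
  have "((\<lambda>t. exp (- (z + d / 2) * t) * \<phi> t) \<longlongrightarrow> 0) at_bot"
  proof (rule tendsto_sandwich[where f = "\<lambda>_. 0" and h = "\<lambda>t. C * exp (d / 2 * t)"])
    show "\<forall>\<^sub>F t in at_bot. 0 \<le> exp (- (z + d / 2) * t) * \<phi> t" using pos by (simp add: less_imp_le)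
    show "\<forall>\<^sub>F t in at_bot. exp (- (z + d / 2) * t) * \<phi> t \<le> C * exp (d / 2 * t)"
      using eventually_le_at_bot[of T] by eventually_elim (rule le)
    show "((\<lambda>t. C * exp (d / 2 * t)) \<longlongrightarrow> 0) at_bot"
      using tendsto_mult[OF tendsto_const tendsto_exp_at_bot, of "d / 2" C] d by simp
  qed simp
  then show ?thesis by (simp add: d_def C1_def)
qed

end

section \<open>Raising the decay exponent while chi is positive\<close>

definition decays :: "real \<Rightarrow> bool" where
  "decays z \<longleftrightarrow> ((\<lambda>t. exp (- z * t) * \<phi> t) \<longlongrightarrow> 0) at_bot"

lemma decays_0: "decays 0" using lim_bot by (simp add: decays_def)

lemma decays_le:
  assumes "decays z" "w \<le> z"
  shows "decays w"
  unfolding decays_def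
proof (rule tendsto_sandwich[OF _ _ tendsto_const assms(1)[unfolded decays_def]])
  show "\<forall>\<^sub>F t in at_bot. exp (- w * t) * \<phi> t \<le> exp (- z * t) * \<phi> t"
    using eventually_le_at_bot[of 0]
    by eventually_elim (use assms pos in \<open>auto intro!: mult_right_mono mult_right_mono_neg simp: less_imp_le\<close>)
qed (use pos in \<open>auto simp: less_imp_le\<close>)

text \<open>Decay at z squeezes I to 0 at -\<infinity>. As I is nonincreasing near -\<infinity>, it
  is nonpositive there, and \<open>decay_from_balance\<close> applies.\<close>

lemma decays_step:
  assumes z: "z \<ge> 0" and chi0: "0 < chi0" "chi0 \<le> chi g0 h z c" and dec: "decays z"
  shows "decays (z + chi0 / (4 * (c + g0 * (c * h))))"
proof -
  obtain T where T: "\<And>t. t \<le> T \<Longrightarrow> \<bar>N t\<bar> \<le> chi0 / 2 * \<phi> t" using N_small[of "chi0 / 2"] chi0 by auto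
  obtain Y where Y: "\<And>t. (Y has_real_derivative exp (- z * t) * \<phi> t) (at t)"
    by (rule antiderivative_weighted[of z]) auto
  let ?I = "balance c z \<phi> \<phi>1 Y"
  note d = dec[unfolded decays_def]
  have lim: "(?I \<longlongrightarrow> 0) at_bot"
  proof (rule tendsto_sandwich)
    show "((\<lambda>t. - (c + g0 * (c * h)) * (exp (- z * t) * \<phi> t)) \<longlongrightarrow> 0) at_bot"
      using tendsto_mult[OF tendsto_const d] by simp
    show "((\<lambda>t. (\<beta> + z) * (exp (- z * t) * \<phi> t)) \<longlongrightarrow> 0) at_bot"
      using tendsto_mult[OF tendsto_const d] by simp
  qed (use balance_lower[OF z Y] balance_upper[OF z Y] in auto)
  have "?I t \<le> 0" if t: "t \<le> T" for t
  proof (rule tendsto_lowerbound[OF lim])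
    show "\<forall>\<^sub>F s in at_bot. ?I t \<le> ?I s"
      using eventually_le_at_bot[of t]
    proof eventually_elim
      case (elim s)
      show ?case
      proof (rule deriv_nonpos_ge[OF elim balance_front_deriv[OF z Y]])
        fix x assume "x \<le> t"
        then have "exp (- z * x) * (N x - chi g0 h z c * \<phi> x) \<le> - (chi0 / 2) * (exp (- z * x) * \<phi> x)"
          using t by (intro balance_deriv_upper[OF z Y chi0(2) T]) auto
        also have "\<dots> \<le> 0" using chi0 pos[of x] by (simp add: less_imp_le)
        finally show "exp (- z * x) * (N x - chi g0 h z c * \<phi> x) \<le> 0" .
      qed
    qed
  qed simp
  then show ?thesis
    unfolding decays_def by (intro decay_from_balance[OF z Y chi0 T]) auto
qed

text \<open>On the compact interval chi has a positive minimum, so every step gains at least the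
  same amount.\<close>

lemma decays_upto:
  assumes "0 \<le> a" "a \<le> b" and chi: "\<And>z. a \<le> z \<Longrightarrow> z \<le> b \<Longrightarrow> chi g0 h z c > 0" and "decays a"
  shows "decays b"
proof -
  have "continuous_on {a..b} (\<lambda>z. chi g0 h z c)"
    using chi_cont by (auto intro: continuous_at_imp_continuous_on)
  then obtain m where m: "m \<in> {a..b}" "\<And>z. z \<in> {a..b} \<Longrightarrow> chi g0 h m c \<le> chi g0 h z c"
    using continuous_attains_inf[of "{a..b}" "\<lambda>z. chi g0 h z c"] assms by auto
  define chi0 where "chi0 = chi g0 h m c"
  have chi0: "chi0 > 0" using chi m by (simp add: chi0_def)
  have "0 < chi0 / (4 * (c + g0 * (c * h)))" using chi0 c tau g0_pos by (simp add: add_pos_pos)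
  from \<open>a \<le> b\<close> this \<open>decays a\<close> show ?thesis
  proof (induction rule: min_step_induct)
    case (step z)
    then have "decays (z + chi0 / (4 * (c + g0 * (c * h))))"
      using chi0 m(2)[of z] assms by (intro decays_step) (auto simp: chi0_def)
    then show ?case by (rule decays_le) simp
  qed
qed

lemma phi_lower: "t \<le> 0 \<Longrightarrow> exp (\<beta> * t) * \<phi> 0 \<le> \<phi> t"
proof -
  assume "t \<le> 0"
  then have "exp (\<beta> * t) * \<phi> 0 \<le> exp (\<beta> * t) * (exp (\<beta> * (0 - t)) * \<phi> t)"
    using harnack[of t 0] by (intro mult_left_mono) auto
  also have "\<dots> = \<phi> t" by (simp add: mult.assoc[symmetric] flip: exp_add)
  finally show ?thesis .
qed

text \<open>Otherwise decay would propagate up to the exponent \<beta>, but the Harnack inequality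
  gives \<phi>(t) \<ge> exp(\<beta>t)\<phi>(0) for t \<le> 0.\<close>

lemma not_decays:
  assumes "0 \<le> a" "\<And>z. a \<le> z \<Longrightarrow> chi g0 h z c > 0"
  shows "\<not> decays a"
proof
  assume "decays a"
  with assms(1) have "decays (max a \<beta>)"
    by (intro decays_upto[of a "max a \<beta>"] assms(2)) simp_all
  then have "decays \<beta>" by (rule decays_le) simp
  then have "\<phi> 0 \<le> 0"
    unfolding decays_def
  proof (rule tendsto_lowerbound)
    show "\<forall>\<^sub>F t in at_bot. \<phi> 0 \<le> exp (- \<beta> * t) * \<phi> t"
      using eventually_le_at_bot[of 0]
    proof eventually_elim
      case (elim t)
      have "\<phi> 0 = exp (- \<beta> * t) * (exp (\<beta> * t) * \<phi> 0)" by (simp add: exp_minus)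
      also have "\<dots> \<le> exp (- \<beta> * t) * \<phi> t"
        by (rule mult_left_mono[OF phi_lower[OF elim]]) simp
      finally show ?case .
    qed
  qed simp
  then show False using pos[of 0] by simp
qed

lemma speed_ge_c_sharp: "c \<ge> c_sharp g0 h"
proof (rule ccontr)
  assume "\<not> ?thesis"
  then have "\<not> decays 0" using c chi_pos_below_c_sharp by (intro not_decays) auto
  then show False using decays_0 by simp
qed

text \<open>Faster decay is excluded by \<open>not_decays\<close>, so by contraposition of
  \<open>decay_from_balance\<close> the functional I is positive somewhere near -\<infinity>. Being
  nonincreasing there, it is at least as large further left, and \<open>balance_upper\<close> turns
  this into a lower bound for \<phi>.\<close>

lemma weak_lower_bound:
  assumes z: "0 \<le> z" and chi: "\<And>w. z \<le> w \<Longrightarrow> chi g0 h w c > 0"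
  obtains k where "k > 0" "\<And>t. t \<le> 0 \<Longrightarrow> k * exp (z * t) \<le> \<phi> t"
proof -
  define chi0 where "chi0 = chi g0 h z c"
  have chi0: "0 < chi0" "chi0 \<le> chi g0 h z c" using chi by (auto simp: chi0_def)
  obtain T where T: "T \<le> 0" "\<And>t. t \<le> T \<Longrightarrow> \<bar>N t\<bar> \<le> chi0 / 2 * \<phi> t" using N_small[of "chi0 / 2"] chi0 by auto
  obtain Y where Y: "\<And>t. (Y has_real_derivative exp (- z * t) * \<phi> t) (at t)"
    by (rule antiderivative_weighted[of z]) auto
  let ?I = "balance c z \<phi> \<phi>1 Y"
  have "0 < chi0 / (4 * (c + g0 * (c * h)))" using chi0 c tau g0_pos by (simp add: add_pos_pos)
  then have "\<not> decays (z + chi0 / (4 * (c + g0 * (c * h))))"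
    using chi z by (intro not_decays) auto
  then obtain T1 where T1: "T1 \<le> T" "?I T1 > 0"
    using decay_from_balance[OF z Y chi0 T(2)] unfolding decays_def by (meson linorder_not_le)
  have bz: "\<beta> + z > 0" using beta_pos z by simp
  define k where "k = min (?I T1 / (\<beta> + z)) (\<phi> T1)"
  have k: "k > 0" using T1 bz pos by (simp add: k_def)
  show ?thesis
  proof (rule that[OF k])
    fix t :: real assume t: "t \<le> 0"
    show "k * exp (z * t) \<le> \<phi> t"
    proof (cases "t \<le> T1")
      case True
      have "?I T1 \<le> ?I t"
      proof (rule deriv_nonpos_ge[OF True balance_front_deriv[OF z Y]])
        fix x assume "x \<le> T1"
        then have "exp (- z * x) * (N x - chi g0 h z c * \<phi> x) \<le> - (chi0 / 2) * (exp (- z * x) * \<phi> x)"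
          using T1 by (intro balance_deriv_upper[OF z Y chi0(2) T(2)]) auto
        also have "\<dots> \<le> 0" using chi0 pos[of x] by (simp add: less_imp_le)
        finally show "exp (- z * x) * (N x - chi g0 h z c * \<phi> x) \<le> 0" .
      qed
      also have "\<dots> \<le> (\<beta> + z) * (exp (- z * t) * \<phi> t)" by (rule balance_upper[OF z Y])
      finally have "?I T1 / (\<beta> + z) \<le> exp (- z * t) * \<phi> t" using bz by (simp add: field_simps)
      then have "k \<le> exp (- z * t) * \<phi> t" by (simp add: k_def)
      then have "k * exp (z * t) \<le> exp (- z * t) * \<phi> t * exp (z * t)" by (rule mult_right_mono) simp
      also have "\<dots> = \<phi> t" by (simp add: exp_minus)
      finally show ?thesis .
    next
      case False
      have "k * exp (z * t) \<le> k * 1" using k z t by (intro mult_left_mono) (auto simp: mult_nonneg_nonpos)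
      also have "\<dots> \<le> \<phi> T1" by (simp add: k_def)
      also have "\<dots> \<le> \<phi> t" using False by (intro phi_mono) simp
      finally show ?thesis .
    qed
  qed
qed

end

section \<open>Asymptotic expansion at $-\infty$\<close>

definition exp_order :: "(real \<Rightarrow> real) \<Rightarrow> real \<Rightarrow> bool" where
  "exp_order f \<nu> \<longleftrightarrow> (\<exists>C T. \<forall>t\<le>T. \<bar>f t\<bar> \<le> C * exp (\<nu> * t))"

lemma exp_orderI: "(\<And>t. t \<le> T \<Longrightarrow> \<bar>f t\<bar> \<le> C * exp (\<nu> * t)) \<Longrightarrow> exp_order f \<nu>"
  unfolding exp_order_def by blast

lemma exp_orderE:
  assumes "exp_order f \<nu>"
  obtains C T where "C \<ge> 0" "T \<le> 0" "\<And>t. t \<le> T \<Longrightarrow> \<bar>f t\<bar> \<le> C * exp (\<nu> * t)"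
proof -
  obtain C T where CT: "\<And>t. t \<le> T \<Longrightarrow> \<bar>f t\<bar> \<le> C * exp (\<nu> * t)"
    using assms unfolding exp_order_def by blast
  have "0 \<le> C * exp (\<nu> * T)" using CT[of T] by linarith
  then have "C \<ge> 0" by (simp add: zero_le_mult_iff)
  then show ?thesis using CT by (intro that[of C "min T 0"]) auto
qed

lemma exp_order_le:
  assumes "exp_order f \<nu>" "\<mu> \<le> \<nu>"
  shows "exp_order f \<mu>"
proof -
  obtain C T where CT: "C \<ge> 0" "T \<le> 0" "\<And>t. t \<le> T \<Longrightarrow> \<bar>f t\<bar> \<le> C * exp (\<nu> * t)"
    by (rule exp_orderE[OF assms(1)]) (rule that)
  show ?thesis
  proof (rule exp_orderI)
    fix t assume t: "t \<le> T"
    have "\<nu> * t \<le> \<mu> * t" using t CT(2) assms(2) by (intro mult_right_mono_neg) auto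
    then have "C * exp (\<nu> * t) \<le> C * exp (\<mu> * t)" using CT(1) by (intro mult_left_mono) auto
    then show "\<bar>f t\<bar> \<le> C * exp (\<mu> * t)" using CT(3)[OF t] by linarith
  qed
qed

lemma exp_order_add:
  assumes "exp_order f \<nu>" "exp_order f' \<nu>"
  shows "exp_order (\<lambda>t. f t + f' t) \<nu>"
proof -
  obtain C T C' T' where CT: "\<And>t. t \<le> T \<Longrightarrow> \<bar>f t\<bar> \<le> C * exp (\<nu> * t)" "\<And>t. t \<le> T' \<Longrightarrow> \<bar>f' t\<bar> \<le> C' * exp (\<nu> * t)"
    using assms unfolding exp_order_def by blast
  then have "\<bar>f t + f' t\<bar> \<le> (C + C') * exp (\<nu> * t)" if "t \<le> min T T'" for t
  proof -
    have "\<bar>f t + f' t\<bar> \<le> \<bar>f t\<bar> + \<bar>f' t\<bar>" by (rule abs_triangle_ineq)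
    also have "\<dots> \<le> C * exp (\<nu> * t) + C' * exp (\<nu> * t)" using that CT by (intro add_mono) auto
    finally show ?thesis by (simp add: algebra_simps)
  qed
  then show ?thesis by (rule exp_orderI)
qed

lemma exp_order_cmult:
  assumes "exp_order f \<nu>"
  shows "exp_order (\<lambda>t. c * f t) \<nu>"
proof -
  obtain C T where "\<And>t. t \<le> T \<Longrightarrow> \<bar>f t\<bar> \<le> C * exp (\<nu> * t)"
    using assms unfolding exp_order_def by blast
  then have "\<bar>c * f t\<bar> \<le> (\<bar>c\<bar> * C) * exp (\<nu> * t)" if "t \<le> T" for t
    using that mult_left_mono[of "\<bar>f t\<bar>" "C * exp (\<nu> * t)" "\<bar>c\<bar>"] by (simp add: abs_mult mult.assoc)
  then show ?thesis by (rule exp_orderI)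
qed

lemma exp_order_exp: "exp_order (\<lambda>t. exp (\<nu> * t)) \<nu>"
  by (rule exp_orderI[of _ _ 1]) simp

text \<open>With E the antiderivative of the bound for |f'|, f - E is nonincreasing and f + E
  nondecreasing near -\<infinity>, so the supremum of the former separates the two and lies within
  E(t) of f(t).\<close>

lemma exp_order_convergent:
  fixes f f' :: "real \<Rightarrow> real"
  assumes d: "\<And>t. (f has_real_derivative f' t) (at t)" and ord: "exp_order f' \<epsilon>" and e: "\<epsilon> > 0"
  obtains L where "exp_order (\<lambda>t. f t - L) \<epsilon>"
proof -
  obtain K T where K: "K \<ge> 0" "\<And>t. t \<le> T \<Longrightarrow> \<bar>f' t\<bar> \<le> K * exp (\<epsilon> * t)"
    by (rule exp_orderE[OF ord]) (rule that)
  define E where "E t = K / \<epsilon> * exp (\<epsilon> * t)" for t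
  have E: "(E has_real_derivative K * exp (\<epsilon> * t)) (at t)" for t
    unfolding E_def[abs_def] using e by (auto intro!: derivative_eq_intros)
  have E0: "E t \<ge> 0" for t using K e by (simp add: E_def)
  have up: "f t - E t \<le> f s - E s" if "s \<le> t" "t \<le> T" for s t
  proof (rule deriv_nonpos_ge[OF that(1), where f' = "\<lambda>x. f' x - K * exp (\<epsilon> * x)"])
    fix x assume "s \<le> x" "x \<le> t"
    then show "f' x - K * exp (\<epsilon> * x) \<le> 0" using K(2)[of x] that by (simp add: abs_le_iff)
  qed (auto intro!: derivative_eq_intros d E)
  have lo: "f s + E s \<le> f t + E t" if "s \<le> t" "t \<le> T" for s t
  proof (rule deriv_nonneg_le[OF that(1), where f' = "\<lambda>x. f' x + K * exp (\<epsilon> * x)"])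
    fix x assume "s \<le> x" "x \<le> t"
    then show "0 \<le> f' x + K * exp (\<epsilon> * x)" using K(2)[of x] that by (simp add: abs_le_iff)
  qed (auto intro!: derivative_eq_intros d E)
  have both: "f s - E s \<le> f t + E t" if "s \<le> T" "t \<le> T" for s t
    using up[of t s] lo[of s t] E0[of s] E0[of t] that by (cases "s \<le> t") linarith+
  define L where "L = Sup ((\<lambda>s. f s - E s) ` {..T})"
  have bdd: "bdd_above ((\<lambda>s. f s - E s) ` {..T})"
    by (rule bdd_aboveI2[of _ _ "f T + E T"]) (use both in auto)
  have "\<bar>f t - L\<bar> \<le> K / \<epsilon> * exp (\<epsilon> * t)" if t: "t \<le> T" for t
  proof -
    have "f t - E t \<le> L" unfolding L_def using t by (intro cSUP_upper[OF _ bdd]) auto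
    moreover have "L \<le> f t + E t" unfolding L_def using both t by (intro cSUP_least) auto
    ultimately show ?thesis by (simp add: abs_le_iff E_def)
  qed
  then have "exp_order (\<lambda>t. f t - L) \<epsilon>" by (rule exp_orderI[of T])
  then show ?thesis by (rule that)
qed

text \<open>Integrating exp(-lt)u from a fixed T towards -\<infinity>, the constant of integration
  contributes exp(lt), which exp(\<nu>t) dominates because \<nu> < l.\<close>

lemma exp_order_integrate:
  fixes u u1 :: "real \<Rightarrow> real"
  assumes d: "\<And>t. (u has_real_derivative u1 t) (at t)"
    and ord: "exp_order (\<lambda>t. u1 t - l * u t) \<nu>" and nu: "\<nu> < l"
  shows "exp_order u \<nu>"
proof -
  obtain K T where K: "K \<ge> 0" "T \<le> 0" "\<And>t. t \<le> T \<Longrightarrow> \<bar>u1 t - l * u t\<bar> \<le> K * exp (\<nu> * t)"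
    by (rule exp_orderE[OF ord]) (rule that)
  define p where "p t = exp (- l * t) * u t" for t
  have p: "(p has_real_derivative exp (- l * t) * (u1 t - l * u t)) (at t)" for t
    unfolding p_def[abs_def] by (auto intro!: derivative_eq_intros d simp: algebra_simps)
  define E where "E t = K / (l - \<nu>) * exp ((\<nu> - l) * t)" for t
  have E: "(E has_real_derivative - K * exp ((\<nu> - l) * t)) (at t)" for t
  proof -
    have "K / (l - \<nu>) * (\<nu> - l) = - K" using nu by (simp add: field_simps)
    then have "K / (l - \<nu>) * ((\<nu> - l) * exp ((\<nu> - l) * t)) = - K * exp ((\<nu> - l) * t)"
      by (simp only: mult.assoc[symmetric])
    moreover have "(E has_real_derivative K / (l - \<nu>) * ((\<nu> - l) * exp ((\<nu> - l) * t))) (at t)"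
      unfolding E_def[abs_def] using nu by (auto intro!: derivative_eq_intros)
    ultimately show ?thesis by simp
  qed
  have E0: "E t \<ge> 0" for t using K nu by (simp add: E_def)
  have bd: "\<bar>exp (- l * x) * (u1 x - l * u x)\<bar> \<le> K * exp ((\<nu> - l) * x)" if "x \<le> T" for x
  proof -
    have "\<bar>exp (- l * x) * (u1 x - l * u x)\<bar> \<le> exp (- l * x) * (K * exp (\<nu> * x))"
      using K(3)[OF that] by (simp add: abs_mult)
    also have "\<dots> = K * exp ((\<nu> - l) * x)" by (simp add: algebra_simps flip: exp_add)
    finally show ?thesis .
  qed
  have pb: "\<bar>p t\<bar> \<le> \<bar>p T\<bar> + E t" if t: "t \<le> T" for t
  proof -
    have "p t - E t \<le> p T - E T"
    proof (rule deriv_nonneg_le[OF t, where f' = "\<lambda>x. exp (- l * x) * (u1 x - l * u x) + K * exp ((\<nu> - l) * x)"])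
      fix x assume "t \<le> x" "x \<le> T"
      then show "0 \<le> exp (- l * x) * (u1 x - l * u x) + K * exp ((\<nu> - l) * x)"
        using bd[of x] by linarith
    qed (auto intro!: derivative_eq_intros p E)
    moreover have "p T + E T \<le> p t + E t"
    proof (rule deriv_nonpos_ge[OF t, where f' = "\<lambda>x. exp (- l * x) * (u1 x - l * u x) - K * exp ((\<nu> - l) * x)"])
      fix x assume "t \<le> x" "x \<le> T"
      then show "exp (- l * x) * (u1 x - l * u x) - K * exp ((\<nu> - l) * x) \<le> 0"
        using bd[of x] by linarith
    qed (auto intro!: derivative_eq_intros p E)
    ultimately show ?thesis using E0[of T] by linarith
  qed
  show ?thesis
  proof (rule exp_orderI)
    fix t assume t: "t \<le> T"
    have e1: "exp (l * t) * exp (- l * t) = 1" by (simp flip: exp_add)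
    have "u t = exp (l * t) * p t" unfolding p_def mult.assoc[symmetric] e1 by simp
    then have "\<bar>u t\<bar> = exp (l * t) * \<bar>p t\<bar>" by (simp add: abs_mult)
    also have "\<dots> \<le> exp (l * t) * (\<bar>p T\<bar> + E t)" by (rule mult_left_mono[OF pb[OF t]]) simp
    also have "\<dots> = \<bar>p T\<bar> * exp (l * t) + K / (l - \<nu>) * (exp (l * t) * exp ((\<nu> - l) * t))"
      by (simp add: E_def algebra_simps)
    also have "exp (l * t) * exp ((\<nu> - l) * t) = exp (\<nu> * t)" by (simp add: algebra_simps flip: exp_add)
    also have "\<bar>p T\<bar> * exp (l * t) \<le> \<bar>p T\<bar> * exp (\<nu> * t)"
      using t K(2) nu by (intro mult_left_mono) (auto intro!: mult_right_mono_neg)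
    finally show "\<bar>u t\<bar> \<le> (\<bar>p T\<bar> + K / (l - \<nu>)) * exp (\<nu> * t)" by (simp add: algebra_simps)
  qed
qed

section \<open>The first-order delay equation for u' - l1 u\<close>

lemma linear_decay:
  fixes r r' :: "real \<Rightarrow> real"
  assumes A: "A > 0" and "a \<le> t"
    and d: "\<And>s. a \<le> s \<Longrightarrow> s \<le> t \<Longrightarrow> (r has_real_derivative r' s) (at s)"
    and le: "\<And>s. a \<le> s \<Longrightarrow> s \<le> t \<Longrightarrow> r' s \<le> - A * r s + D"
  shows "r t - D / A \<le> exp (- A * (t - a)) * (r a - D / A)"
proof -
  have "(r t - D / A) * exp (A * t) \<le> (r a - D / A) * exp (A * a)"
  proof (rule deriv_nonpos_ge[OF assms(2), where f' = "\<lambda>s. (r' s + A * (r s - D / A)) * exp (A * s)"])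
    fix s assume s: "a \<le> s" "s \<le> t"
    have "A * (r s - D / A) = A * r s - D" using A by (simp add: field_simps)
    then show "(r' s + A * (r s - D / A)) * exp (A * s) \<le> 0"
      using le[OF s] by (intro mult_nonpos_nonneg) auto
    show "((\<lambda>s. (r s - D / A) * exp (A * s)) has_real_derivative (r' s + A * (r s - D / A)) * exp (A * s)) (at s)"
      by (auto intro!: derivative_eq_intros d[OF s] simp: algebra_simps)
  qed
  then have "(r t - D / A) * exp (A * t) * exp (- A * t) \<le> (r a - D / A) * exp (A * a) * exp (- A * t)"
    by (rule mult_right_mono) simp
  moreover have "(r t - D / A) * exp (A * t) * exp (- A * t) = r t - D / A"
    by (simp add: mult.assoc flip: exp_add)
  moreover have "(r a - D / A) * exp (A * a) * exp (- A * t) = exp (- A * (t - a)) * (r a - D / A)"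
    by (simp add: mult.assoc flip: exp_add) (simp add: algebra_simps)
  ultimately show ?thesis by linarith
qed

text \<open>Dividing the symbol $\chi$ by $D - l_1$ turns the equation for $u$ into a first-order
  equation for $w = u' - l_1 u$ whose delayed term has a positive kernel.\<close>
locale linear_solution = delayed_char +
  fixes c l1 :: real and u u1 u2 N :: "real \<Rightarrow> real"
  assumes c: "c > 0" and l1: "chi g0 h l1 c = 0"
    and u: "twice_diff u u1 u2"
    and eq: "\<And>t. u2 t - c * u1 t - u t + g0 * u (t - c * h) = N t"
begin

definition w where "w t = u1 t - l1 * u t"
definition k1 where "k1 = g0 * exp (- l1 * (c * h))"
text \<open>On w = exp(\<zeta>t) the operator w' + (l1 - c)w acts as \<open>A \<zeta>\<close> and
  the delayed term as \<open>B \<zeta>\<close>; their difference is chi(\<zeta>)/(\<zeta> - l1). At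
  \<zeta> = l1 division by zero makes \<open>B\<close> vanish instead of taking its limit, hence the
  exclusion in \<open>AB_chi\<close>.\<close>

definition A where "A \<zeta> = \<zeta> + l1 - c"
definition B where "B \<zeta> = k1 * ((exp ((l1 - \<zeta>) * (c * h)) - 1) / (l1 - \<zeta>))"

lemma du: "(u has_real_derivative u1 t) (at t)" and du1: "(u1 has_real_derivative u2 t) (at t)"
  using u by (auto simp: twice_diff_def)

lemma tau: "c * h > 0" using c h by simp

lemma k1_pos: "k1 > 0" using g0_pos by (simp add: k1_def)

lemma l1_eq: "k1 = 1 + c * l1 - l1\<^sup>2"
  using l1 by (simp add: chi_def k1_def mult.assoc)

lemma k1_exp: "k1 * exp (l1 * (c * h)) = g0"
  by (simp add: k1_def exp_minus)

lemma AB_chi: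
  assumes "\<zeta> \<noteq> l1"
  shows "(A \<zeta> - B \<zeta>) * (\<zeta> - l1) = chi g0 h \<zeta> c"
proof -
  have "B \<zeta> * (\<zeta> - l1) = - k1 * (exp ((l1 - \<zeta>) * (c * h)) - 1)"
    using assms by (simp add: B_def field_simps)
  also have "exp ((l1 - \<zeta>) * (c * h)) = exp (l1 * (c * h)) * exp (- \<zeta> * (c * h))"
    by (simp add: algebra_simps flip: exp_add)
  also have "- k1 * (exp (l1 * (c * h)) * exp (- \<zeta> * (c * h)) - 1)
     = - (k1 * exp (l1 * (c * h))) * exp (- \<zeta> * (c * h)) + k1" by (simp add: algebra_simps)
  finally have "B \<zeta> * (\<zeta> - l1) = - g0 * exp (- \<zeta> * (c * h)) + k1"
    unfolding k1_exp .
  then have "B \<zeta> * (\<zeta> - l1) = - g0 * exp (- \<zeta> * (c * h)) + (1 + c * l1 - l1\<^sup>2)"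
    unfolding l1_eq .
  then show ?thesis
    by (simp add: A_def chi_def left_diff_distrib mult.assoc) (simp add: algebra_simps power2_eq_square)
qed

lemma B_pos:
  assumes "\<zeta> < l1"
  shows "B \<zeta> > 0"
  using assms k1_pos tau by (simp add: B_def)

lemma dw: "(w has_real_derivative - (l1 - c) * w t + k1 * (u t - exp (l1 * (c * h)) * u (t - c * h)) + N t) (at t)"
proof -
  have "(w has_real_derivative u2 t - l1 * u1 t) (at t)"
    unfolding w_def[abs_def] by (auto intro!: derivative_eq_intros du du1)
  moreover have "k1 * (u t - exp (l1 * (c * h)) * u (t - c * h))
      = (1 + c * l1 - l1\<^sup>2) * u t - (k1 * exp (l1 * (c * h))) * u (t - c * h)"
    by (simp add: l1_eq algebra_simps)
  then have "u2 t - l1 * u1 t = - (l1 - c) * w t + k1 * (u t - exp (l1 * (c * h)) * u (t - c * h)) + N t"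
    unfolding k1_exp eq[of t, symmetric] by (simp add: w_def algebra_simps power2_eq_square)
  ultimately show ?thesis by simp
qed

text \<open>The bracket is exp(l1 t) times the increment over one delay of p = exp(-l1 s)u, and p' =
  exp(-l1 s)w. So it integrates w against a positive kernel and inherits a one-sided bound, with
  gain \<open>B \<zeta>\<close>.\<close>

lemma delayed_term_bound:
  assumes "\<zeta> < l1" and w: "\<And>s. s \<le> t \<Longrightarrow> w s \<le> M * exp (\<zeta> * s)"
  shows "k1 * (u t - exp (l1 * (c * h)) * u (t - c * h)) \<le> B \<zeta> * M * exp (\<zeta> * t)"
proof -
  define p where "p s = exp (- l1 * s) * u s" for s
  define E where "E s = M / (\<zeta> - l1) * exp ((\<zeta> - l1) * s)" for s
  have p: "(p has_real_derivative exp (- l1 * s) * w s) (at s)" for s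
    unfolding p_def[abs_def] w_def by (auto intro!: derivative_eq_intros du simp: algebra_simps)
  have E: "(E has_real_derivative M * exp ((\<zeta> - l1) * s)) (at s)" for s
    unfolding E_def[abs_def] using assms(1) by (auto intro!: derivative_eq_intros)
  have "p t - E t \<le> p (t - c * h) - E (t - c * h)"
  proof (rule deriv_nonpos_ge[of "t - c * h" t "\<lambda>s. p s - E s" "\<lambda>s. exp (- l1 * s) * w s - M * exp ((\<zeta> - l1) * s)"])
    fix s assume s: "s \<le> t"
    have "exp (- l1 * s) * w s \<le> exp (- l1 * s) * (M * exp (\<zeta> * s))"
      by (rule mult_left_mono[OF w[OF s]]) simp
    also have "\<dots> = M * exp ((\<zeta> - l1) * s)" by (simp add: algebra_simps flip: exp_add)
    finally show "exp (- l1 * s) * w s - M * exp ((\<zeta> - l1) * s) \<le> 0" by simp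
  qed (use tau in \<open>auto intro!: derivative_eq_intros p E\<close>)
  then have "exp (l1 * t) * (p t - p (t - c * h)) \<le> exp (l1 * t) * (E t - E (t - c * h))"
    by (intro mult_left_mono) auto
  moreover have "exp (l1 * t) * (p t - p (t - c * h)) = u t - exp (l1 * (c * h)) * u (t - c * h)"
    by (simp add: p_def right_diff_distrib mult.assoc[symmetric] flip: exp_add)
  moreover have "exp (l1 * t) * (E t - E (t - c * h)) = M * exp (\<zeta> * t) * ((exp ((l1 - \<zeta>) * (c * h)) - 1) / (l1 - \<zeta>))"
  proof -
    have 1: "exp (l1 * t) * exp ((\<zeta> - l1) * t) = exp (\<zeta> * t)" by (simp add: algebra_simps flip: exp_add)
    have 2: "exp (l1 * t) * exp ((\<zeta> - l1) * (t - c * h)) = exp (\<zeta> * t) * exp ((l1 - \<zeta>) * (c * h))"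
      by (simp add: algebra_simps flip: exp_add)
    have "exp (l1 * t) * (E t - E (t - c * h)) = M / (\<zeta> - l1) * (exp (l1 * t) * exp ((\<zeta> - l1) * t) - exp (l1 * t) * exp ((\<zeta> - l1) * (t - c * h)))"
      by (simp only: E_def right_diff_distrib mult.left_commute)
    also have "\<dots> = M * exp (\<zeta> * t) * ((exp ((l1 - \<zeta>) * (c * h)) - 1) / (l1 - \<zeta>))"
      unfolding 1 2 using assms(1) by (simp add: divide_simps) (simp add: algebra_simps)
    finally show ?thesis .
  qed
  ultimately have "u t - exp (l1 * (c * h)) * u (t - c * h) \<le> M * exp (\<zeta> * t) * ((exp ((l1 - \<zeta>) * (c * h)) - 1) / (l1 - \<zeta>))"
    by simp
  then have "k1 * (u t - exp (l1 * (c * h)) * u (t - c * h)) \<le> k1 * (M * exp (\<zeta> * t) * ((exp ((l1 - \<zeta>) * (c * h)) - 1) / (l1 - \<zeta>)))"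
    using k1_pos by (intro mult_left_mono) auto
  also have "\<dots> = B \<zeta> * M * exp (\<zeta> * t)" by (simp add: B_def)
  finally show ?thesis .
qed

text \<open>The weighted function obeys r' \<le> -A r + (BM + F), whose equilibrium is b. Read
  forwards, this forgets the value at a; read backwards, a value close to b at t forces values not
  far below b shortly before.\<close>

lemma weighted_decay:
  assumes z: "\<zeta> < l1" and A: "A \<zeta> > 0" and w: "\<And>s. s \<le> t \<Longrightarrow> w s \<le> M * exp (\<zeta> * s)"
    and N: "\<And>s. s \<le> t \<Longrightarrow> N s \<le> F * exp (\<zeta> * s)" and at: "a \<le> t"
  defines "b \<equiv> (B \<zeta> * M + F) / A \<zeta>"
  shows "exp (- \<zeta> * t) * w t - b \<le> exp (- A \<zeta> * (t - a)) * (exp (- \<zeta> * a) * w a - b)"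
  unfolding b_def
proof (rule linear_decay[OF A at])
  fix s assume s: "a \<le> s" "s \<le> t"
  let ?w' = "- (l1 - c) * w s + k1 * (u s - exp (l1 * (c * h)) * u (s - c * h)) + N s"
  show "((\<lambda>s. exp (- \<zeta> * s) * w s) has_real_derivative exp (- \<zeta> * s) * (?w' - \<zeta> * w s)) (at s)"
    by (auto intro!: derivative_eq_intros dw simp: algebra_simps)
  have "?w' \<le> - (l1 - c) * w s + B \<zeta> * M * exp (\<zeta> * s) + F * exp (\<zeta> * s)"
    using delayed_term_bound[OF z, of s M] w N[OF s(2)] s by auto
  then have "exp (- \<zeta> * s) * (?w' - \<zeta> * w s) \<le> exp (- \<zeta> * s) * (- A \<zeta> * w s + (B \<zeta> * M + F) * exp (\<zeta> * s))"
    by (intro mult_left_mono) (auto simp: A_def algebra_simps)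
  also have "\<dots> = - A \<zeta> * (exp (- \<zeta> * s) * w s) + (B \<zeta> * M + F) * (exp (- \<zeta> * s) * exp (\<zeta> * s))"
    by (simp add: algebra_simps)
  also have "exp (- \<zeta> * s) * exp (\<zeta> * s) = 1" by (simp flip: exp_add)
  finally show "exp (- \<zeta> * s) * (?w' - \<zeta> * w s) \<le> - A \<zeta> * (exp (- \<zeta> * s) * w s) + (B \<zeta> * M + F)"
    by simp
qed

lemma weighted_sup:
  assumes "\<And>s. s \<le> t \<Longrightarrow> w s \<le> C * exp (\<zeta> * s)"
  obtains M where "\<And>s. s \<le> t \<Longrightarrow> w s \<le> M * exp (\<zeta> * s)"
    "\<And>\<eta>. \<eta> > 0 \<Longrightarrow> \<exists>s\<le>t. M - \<eta> < exp (- \<zeta> * s) * w s"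
proof -
  define r where "r s = exp (- \<zeta> * s) * w s" for s
  have e: "exp (- \<zeta> * s) * exp (\<zeta> * s) = 1" for s by (simp flip: exp_add)
  have "r s \<le> C" if "s \<le> t" for s
  proof -
    have "r s \<le> exp (- \<zeta> * s) * (C * exp (\<zeta> * s))"
      unfolding r_def by (rule mult_left_mono[OF assms[OF that]]) simp
    also have "\<dots> = C * (exp (- \<zeta> * s) * exp (\<zeta> * s))" by simp
    finally show ?thesis using e by simp
  qed
  then have bdd: "bdd_above (r ` {..t})" by (intro bdd_aboveI2[of _ _ C]) auto
  define M where "M = Sup (r ` {..t})"
  show ?thesis
  proof (rule that[of M])
    fix s assume "s \<le> t"
    then have "r s \<le> M" unfolding M_def by (intro cSUP_upper bdd) auto
    then have "r s * exp (\<zeta> * s) \<le> M * exp (\<zeta> * s)" by (rule mult_right_mono) simp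
    moreover have "r s * exp (\<zeta> * s) = w s" by (simp add: r_def exp_minus)
    ultimately show "w s \<le> M * exp (\<zeta> * s)" by (simp only:)
  next
    fix \<eta> :: real assume "\<eta> > 0"
    then have "M - \<eta> < Sup (r ` {..t})" by (simp add: M_def)
    then obtain x where "x \<in> r ` {..t}" "M - \<eta> < x" using less_cSupE[of "M - \<eta>" "r ` {..t}"] by auto
    then show "\<exists>s\<le>t. M - \<eta> < exp (- \<zeta> * s) * w s" by (auto simp: r_def)
  qed
qed

text \<open>Letting the initial time tend to -\<infinity> removes the transient, so the supremum M
  of exp(-\<zeta>s)w satisfies M \<le> (BM + F)/A. As B < A, this bounds M by F/(A - B); the
  constant \<open>C\<close> serves only to make M finite and leaves no trace.\<close>

lemma contraction_bound:
  assumes z: "\<zeta> < l1" and AB: "A \<zeta> > B \<zeta>" and w: "\<And>s. s \<le> t \<Longrightarrow> w s \<le> C * exp (\<zeta> * s)"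
    and N: "\<And>s. s \<le> t \<Longrightarrow> N s \<le> F * exp (\<zeta> * s)"
  shows "w t \<le> F / (A \<zeta> - B \<zeta>) * exp (\<zeta> * t)"
proof -
  have A: "A \<zeta> > 0" using AB B_pos[OF z] by simp
  obtain M where M: "\<And>s. s \<le> t \<Longrightarrow> w s \<le> M * exp (\<zeta> * s)"
    "\<And>\<eta>. \<eta> > 0 \<Longrightarrow> \<exists>s\<le>t. M - \<eta> < exp (- \<zeta> * s) * w s"
    by (rule weighted_sup[OF w]) (assumption | rule that)+
  define b where "b = (B \<zeta> * M + F) / A \<zeta>"
  have rb: "exp (- \<zeta> * s) * w s \<le> b" if s: "s \<le> t" for s
  proof (rule field_le_epsilon)
    fix e :: real assume e: "e > 0"
    have ev: "((\<lambda>a. exp (A \<zeta> * (a - s)) * (M - b)) \<longlongrightarrow> 0) at_bot"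
    proof -
      have "((\<lambda>a. exp (A \<zeta> * a) * (exp (- A \<zeta> * s) * (M - b))) \<longlongrightarrow> 0 * (exp (- A \<zeta> * s) * (M - b))) at_bot"
        by (intro tendsto_mult tendsto_exp_at_bot A tendsto_const)
      moreover have "exp (A \<zeta> * (a - s)) = exp (A \<zeta> * a) * exp (- A \<zeta> * s)" for a
        by (simp add: right_diff_distrib flip: exp_add)
      ultimately show ?thesis by (simp add: mult.assoc)
    qed
    then have "\<forall>\<^sub>F a in at_bot. exp (A \<zeta> * (a - s)) * (M - b) < e" using e by (rule order_tendstoD)
    then obtain a where a: "a \<le> s" "exp (A \<zeta> * (a - s)) * (M - b) < e"
      unfolding eventually_at_bot_linorder by (metis min.cobounded1 min.cobounded2)
    have "exp (- \<zeta> * a) * w a \<le> exp (- \<zeta> * a) * (M * exp (\<zeta> * a))"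
      using M(1)[of a] a s by (intro mult_left_mono) auto
    also have "\<dots> = M" by (simp add: exp_minus)
    finally have wa: "exp (- \<zeta> * a) * w a \<le> M" .
    have "exp (- \<zeta> * s) * w s - b \<le> exp (- A \<zeta> * (s - a)) * (exp (- \<zeta> * a) * w a - b)"
      unfolding b_def by (rule weighted_decay[OF z A _ _ a(1)]) (use M N s in auto)
    also have "\<dots> \<le> exp (- A \<zeta> * (s - a)) * (M - b)"
      using wa by (intro mult_left_mono) auto
    also have "exp (- A \<zeta> * (s - a)) = exp (A \<zeta> * (a - s))" by (simp add: algebra_simps)
    finally show "exp (- \<zeta> * s) * w s \<le> b + e" using a(2) by linarith
  qed
  have "M \<le> b"
  proof (rule field_le_epsilon)
    fix e :: real assume "e > 0"
    then obtain s where "s \<le> t" "M - e < exp (- \<zeta> * s) * w s" using M(2) by blast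
    then show "M \<le> b + e" using rb[of s] by simp
  qed
  then have "M * A \<zeta> \<le> B \<zeta> * M + F" using A by (simp add: b_def pos_le_divide_eq)
  then have "M * (A \<zeta> - B \<zeta>) \<le> F" by (simp add: algebra_simps)
  then have "M \<le> F / (A \<zeta> - B \<zeta>)" using AB by (simp add: pos_le_divide_eq)
  then have "M * exp (\<zeta> * t) \<le> F / (A \<zeta> - B \<zeta>) * exp (\<zeta> * t)" by (rule mult_right_mono) simp
  then show ?thesis by (rule order_trans[OF M(1)[OF order_refl]])
qed

text \<open>Where $w e^{-\zeta t}$ nearly attains its supremum it is nearly constant over the preceding
  delay interval; then $w \ge 0$ there and the balance functional dominates $w$.\<close>
lemma marginal_bound:
  assumes z: "\<zeta> < l1" and A: "A \<zeta> > 0" and BA: "B \<zeta> \<ge> A \<zeta>"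
    and small: "(B \<zeta> / A \<zeta> - 1) * exp (A \<zeta> * (c * h)) \<le> 1 / 2"
    and w: "\<And>s. s \<le> t \<Longrightarrow> w s \<le> C * exp (\<zeta> * s)"
    and N: "\<And>s. s \<le> t \<Longrightarrow> N s \<le> F * exp (\<zeta> * s)" and F: "F \<ge> 0"
    and J: "\<And>s. s \<le> t \<Longrightarrow> (\<And>x. s - c * h \<le> x \<Longrightarrow> x \<le> s \<Longrightarrow> w x \<ge> 0) \<Longrightarrow> w s \<le> Jb * exp (\<zeta> * s)"
    and Jb: "Jb \<ge> 0"
  defines "E \<equiv> exp (A \<zeta> * (c * h))"
  shows "w t \<le> (2 * E * F / A \<zeta> + Jb) * exp (\<zeta> * t)"
proof -
  obtain M where M: "\<And>s. s \<le> t \<Longrightarrow> w s \<le> M * exp (\<zeta> * s)"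
    "\<And>\<eta>. \<eta> > 0 \<Longrightarrow> \<exists>s\<le>t. M - \<eta> < exp (- \<zeta> * s) * w s"
    by (rule weighted_sup[OF w]) (assumption | rule that)+
  have E: "E \<ge> 1" using A tau by (simp add: E_def)
  have EF: "2 * E * F / A \<zeta> \<ge> 0" using E F A by simp
  have "M \<le> 2 * E * F / A \<zeta> + Jb"
  proof (cases "M \<le> 0")
    case True
    then show ?thesis using EF Jb by simp
  next
    case False
    show ?thesis
    proof (rule field_le_epsilon)
      fix e :: real assume e: "e > 0"
      define \<eta> where "\<eta> = e / (2 * E)"
      have eta: "\<eta> > 0" "2 * E * \<eta> = e" "\<eta> \<le> e" using e E by (auto simp: \<eta>_def field_simps)
      obtain s where s: "s \<le> t" "M - \<eta> < exp (- \<zeta> * s) * w s" using M(2)[OF eta(1)] by blast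
      define b where "b = (B \<zeta> * M + F) / A \<zeta>"
      have bM: "b = M + (B \<zeta> / A \<zeta> - 1) * M + F / A \<zeta>" using A by (simp add: b_def field_simps)
      have "(B \<zeta> / A \<zeta> - 1) * M \<ge> 0" using BA A False by simp
      then have b: "b \<ge> M" using F A bM by simp
      \<comment> \<open>The expression tested is a lower bound for exp(-\<zeta>x)w(x) on the delay
        interval before s. If it is negative, then M \<le> b < E(b - M + \<eta>), where b - M
        contains M with the factor B/A - 1; by \<open>small\<close> that part is at most M/2 and is
        absorbed, whence the factor 2 in the result.\<close>
      show "M \<le> 2 * E * F / A \<zeta> + Jb + e"
      proof (cases "b - E * (b - M + \<eta>) \<ge> 0")
        case True
        have "w x \<ge> 0" if x: "s - c * h \<le> x" "x \<le> s" for x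
        proof -
          have "exp (- \<zeta> * s) * w s - b \<le> exp (- A \<zeta> * (s - x)) * (exp (- \<zeta> * x) * w x - b)"
            unfolding b_def by (rule weighted_decay[OF z A _ _ x(2)]) (use M N s in auto)
          then have "exp (A \<zeta> * (s - x)) * (exp (- \<zeta> * s) * w s - b)
             \<le> exp (A \<zeta> * (s - x)) * (exp (- A \<zeta> * (s - x)) * (exp (- \<zeta> * x) * w x - b))"
            by (rule mult_left_mono) simp
          also have "\<dots> = exp (- \<zeta> * x) * w x - b"
            by (simp add: mult.assoc[symmetric] flip: exp_add)
          finally have 1: "b + exp (A \<zeta> * (s - x)) * (exp (- \<zeta> * s) * w s - b) \<le> exp (- \<zeta> * x) * w x" by simp
          have "exp (A \<zeta> * (s - x)) \<le> E" using x A by (simp add: E_def)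
          then have "E * (M - \<eta> - b) \<le> exp (A \<zeta> * (s - x)) * (M - \<eta> - b)"
            using b eta by (intro mult_right_mono_neg) auto
          also have "\<dots> \<le> exp (A \<zeta> * (s - x)) * (exp (- \<zeta> * s) * w s - b)"
            using s(2) by (intro mult_left_mono) auto
          finally have "0 \<le> exp (- \<zeta> * x) * w x" using 1 True by (simp add: algebra_simps)
          then show ?thesis by (simp add: zero_le_mult_iff)
        qed
        then have "w s \<le> Jb * exp (\<zeta> * s)" using J[OF s(1)] by blast
        then have "exp (- \<zeta> * s) * w s \<le> exp (- \<zeta> * s) * (Jb * exp (\<zeta> * s))" by (intro mult_left_mono) auto
        also have "\<dots> = Jb" by (simp add: exp_minus)
        finally show ?thesis using s(2) eta EF by linarith
      next
        case False
        have "E * (b - M + \<eta>) = E * ((B \<zeta> / A \<zeta> - 1) * M + F / A \<zeta> + \<eta>)" using bM by simp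
        also have "\<dots> = ((B \<zeta> / A \<zeta> - 1) * E) * M + E * F / A \<zeta> + E * \<eta>" by (simp add: algebra_simps)
        also have "((B \<zeta> / A \<zeta> - 1) * E) * M \<le> 1 / 2 * M"
          using small \<open>\<not> M \<le> 0\<close> unfolding E_def by (intro mult_right_mono) auto
        finally have "M < M / 2 + E * F / A \<zeta> + E * \<eta>" using False b by linarith
        moreover have "2 * E * F / A \<zeta> = E * F / A \<zeta> + E * F / A \<zeta>" by (simp add: field_simps)
        ultimately show ?thesis using eta(2) Jb by linarith
      qed
    qed
  qed
  then have "M * exp (\<zeta> * t) \<le> (2 * E * F / A \<zeta> + Jb) * exp (\<zeta> * t)" by (rule mult_right_mono) simp
  then show ?thesis by (rule order_trans[OF M(1)[OF order_refl]])
qed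

text \<open>If w \<ge> 0 over the last delay interval, the rest of the functional is an integral of
  w with a nonnegative weight. The identity \<open>A l2 = B l2\<close>, that is chi(l2) = 0, matches
  the boundary coefficients.\<close>

lemma balance_ge:
  assumes l2: "chi g0 h l2 c = 0" "l2 < l1"
    and Y: "\<And>t. (Y has_real_derivative exp (- l2 * t) * u t) (at t)"
    and w: "\<And>x. s - c * h \<le> x \<Longrightarrow> x \<le> s \<Longrightarrow> w x \<ge> 0"
  shows "w s \<le> exp (l2 * s) * balance c l2 u u1 Y s"
proof -
  define \<omega> where "\<omega> = l1 - l2"
  have om: "\<omega> > 0" using l2 by (simp add: \<omega>_def)
  define y where "y x = exp (- l2 * x) * u x" for x
  \<comment> \<open>Integration by parts: the coefficient of y vanishes at s - ch, and its
    derivative together with that of \<open>Y\<close> cancels y, so that only w is left in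
    H'.\<close>
  define H where "H x = (exp (\<omega> * (c * h)) - exp (\<omega> * (s - x))) / \<omega> * y x - exp (\<omega> * (c * h)) * Y x" for x
  have dy: "(y has_real_derivative exp (- l2 * x) * w x + \<omega> * y x) (at x)" for x
    unfolding y_def[abs_def] w_def \<omega>_def by (auto intro!: derivative_eq_intros du simp: algebra_simps)
  have dY: "(Y has_real_derivative y x) (at x)" for x using Y by (simp add: y_def)
  have "H (s - c * h) \<le> H s"
  proof (rule deriv_nonneg_le[of "s - c * h" s H "\<lambda>x. (exp (\<omega> * (c * h)) - exp (\<omega> * (s - x))) / \<omega> * (exp (- l2 * x) * w x)"])
    fix x assume x: "s - c * h \<le> x" "x \<le> s"
    have "exp (\<omega> * (s - x)) \<le> exp (\<omega> * (c * h))" using om x by simp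
    then show "0 \<le> (exp (\<omega> * (c * h)) - exp (\<omega> * (s - x))) / \<omega> * (exp (- l2 * x) * w x)"
      using om w[OF x] by simp
    show "(H has_real_derivative (exp (\<omega> * (c * h)) - exp (\<omega> * (s - x))) / \<omega> * (exp (- l2 * x) * w x)) (at x)"
      unfolding H_def[abs_def] using om
      by (auto intro!: derivative_eq_intros dy dY simp: field_simps)
  qed (use tau in simp)
  then have H: "0 \<le> (exp (\<omega> * (c * h)) - 1) / \<omega> * y s - exp (\<omega> * (c * h)) * (Y s - Y (s - c * h))"
    by (simp add: H_def algebra_simps)
  have AB: "A l2 = B l2" using AB_chi[of l2] l2 by simp
  have k: "k1 * exp (\<omega> * (c * h)) = g0 * exp (- l2 * (c * h))"
    by (simp add: k1_def \<omega>_def mult.assoc algebra_simps flip: exp_add)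
  have "0 \<le> k1 * ((exp (\<omega> * (c * h)) - 1) / \<omega> * y s - exp (\<omega> * (c * h)) * (Y s - Y (s - c * h)))"
    using k1_pos H by (intro mult_nonneg_nonneg) auto
  also have "\<dots> = k1 * ((exp (\<omega> * (c * h)) - 1) / \<omega>) * y s - (k1 * exp (\<omega> * (c * h))) * (Y s - Y (s - c * h))"
    by (simp only: right_diff_distrib mult.assoc)
  also have "k1 * ((exp (\<omega> * (c * h)) - 1) / \<omega>) = A l2" unfolding AB B_def \<omega>_def ..
  finally have "0 \<le> A l2 * y s - g0 * exp (- l2 * (c * h)) * (Y s - Y (s - c * h))" unfolding k .
  moreover have "balance c l2 u u1 Y s = exp (- l2 * s) * w s + (A l2 * y s - g0 * exp (- l2 * (c * h)) * (Y s - Y (s - c * h)))"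
    unfolding balance_def A_def y_def w_def by (simp add: algebra_simps)
  ultimately have "exp (- l2 * s) * w s \<le> balance c l2 u u1 Y s" by simp
  then have "exp (l2 * s) * (exp (- l2 * s) * w s) \<le> exp (l2 * s) * balance c l2 u u1 Y s"
    by (rule mult_left_mono) simp
  moreover have "exp (l2 * s) * (exp (- l2 * s) * w s) = w s" by (simp add: exp_minus)
  ultimately show ?thesis by (simp only:)
qed

text \<open>At l2 the gain B/A is 1, so smallness holds nearby by continuity; to the left chi > 0,
  and the negative factor \<zeta> - l1 gives A < B. The weight has to stay strictly below l2, where
  w is under control a priori.\<close>

lemma marginal_weight:
  assumes l2: "chi g0 h l2 c = 0" "0 < l2" "l2 < l1"
  obtains \<zeta> where "0 < \<zeta>" "\<zeta> < l2" "A \<zeta> > 0" "B \<zeta> \<ge> A \<zeta>"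
    "(B \<zeta> / A \<zeta> - 1) * exp (A \<zeta> * (c * h)) \<le> 1 / 2"
proof -
  have AB: "A l2 = B l2" using AB_chi[of l2] l2 by simp
  have Ap: "A l2 > 0" using AB B_pos l2 by simp
  have cA: "isCont A l2" unfolding A_def[abs_def] by (intro continuous_intros)
  have cB: "isCont B l2" unfolding B_def[abs_def] using l2 by (intro continuous_intros) auto
  have "isCont (\<lambda>z. (B z / A z - 1) * exp (A z * (c * h))) l2"
    using cA cB Ap by (intro continuous_intros) auto
  then have "\<forall>\<^sub>F z in at l2. (B z / A z - 1) * exp (A z * (c * h)) < 1 / 2"
    unfolding isCont_def by (rule order_tendstoD) (use AB Ap in simp)
  moreover have "\<forall>\<^sub>F z in at l2. A z > 0" using cA Ap unfolding isCont_def by (rule order_tendstoD)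
  ultimately have "\<forall>\<^sub>F z in at l2. (B z / A z - 1) * exp (A z * (c * h)) < 1 / 2 \<and> A z > 0"
    by (rule eventually_conj)
  then have "\<forall>\<^sub>F z in at_left l2. (B z / A z - 1) * exp (A z * (c * h)) < 1 / 2 \<and> A z > 0"
    unfolding eventually_at_split by (rule conjunct1)
  moreover have "\<forall>\<^sub>F z in at_left l2. z \<in> {0<..<l2}" using l2 by (intro eventually_at_leftI[of 0]) auto
  ultimately have "\<forall>\<^sub>F z in at_left l2. ((B z / A z - 1) * exp (A z * (c * h)) < 1 / 2 \<and> A z > 0) \<and> z \<in> {0<..<l2}"
    by (rule eventually_conj)
  then obtain z where z: "(B z / A z - 1) * exp (A z * (c * h)) < 1 / 2" "A z > 0" "0 < z" "z < l2"
    using eventually_happens'[OF trivial_limit_at_left_real[of l2]] by auto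
  have "chi g0 h z c > 0"
    using chi_pos_left[OF g0_nonneg l2(1) _ z(4)] chi1_signs[OF g0_nonneg l2(1) l1 l2(3)] by simp
  then have "(A z - B z) * (z - l1) > 0" using AB_chi[of z] z l2 by simp
  then have "A z < B z" using z l2 by (simp add: zero_less_mult_iff)
  then show ?thesis using that[of z] z by simp
qed

end

lemma (in delayed_char) balance_neg:
  "balance c z (\<lambda>t. - u t) (\<lambda>t. - u1 t) (\<lambda>t. - Y t) t = - balance c z u u1 Y t"
  by (simp add: balance_def algebra_simps)

context linear_solution
begin

text \<open>With \<open>N\<close> treated as a given forcing the equation is linear, so each
  one-sided estimate for w applied to -u yields the opposite one.\<close>

lemma neg_solution: "linear_solution g0 h c l1 (\<lambda>t. - u t) (\<lambda>t. - u1 t) (\<lambda>t. - u2 t) (\<lambda>t. - N t)"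
proof
  show "twice_diff (\<lambda>t. - u t) (\<lambda>t. - u1 t) (\<lambda>t. - u2 t)"
    using u by (auto simp: twice_diff_def intro!: derivative_eq_intros)
  show "- u2 t - c * - u1 t - - u t + g0 * - u (t - c * h) = - N t" for t
    using eq[of t] by (simp add: algebra_simps)
qed (use c l1 in auto)

lemma marginal_upper:
  assumes l2: "chi g0 h l2 c = 0" "0 < l2" "l2 < l1" and e: "\<epsilon> > 0"
    and Y: "\<And>t. (Y has_real_derivative exp (- l2 * t) * u t) (at t)"
    and N: "exp_order N (l2 + \<epsilon>)" and J: "exp_order (balance c l2 u u1 Y) \<epsilon>"
    and w: "\<And>\<zeta>. \<zeta> < l2 \<Longrightarrow> exp_order w \<zeta>"
  obtains C T where "\<And>t. t \<le> T \<Longrightarrow> w t \<le> C * exp ((l2 + \<epsilon>) * t)"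
proof -
  obtain \<zeta> where z: "0 < \<zeta>" "\<zeta> < l2" "A \<zeta> > 0" "B \<zeta> \<ge> A \<zeta>"
    "(B \<zeta> / A \<zeta> - 1) * exp (A \<zeta> * (c * h)) \<le> 1 / 2"
    by (rule marginal_weight[OF l2]) (rule that)
  obtain Cw Tw where Cw: "\<And>t. t \<le> Tw \<Longrightarrow> \<bar>w t\<bar> \<le> Cw * exp (\<zeta> * t)"
    by (rule exp_orderE[OF w[OF z(2)]]) (rule that)
  obtain F TF where F: "F \<ge> 0" "\<And>t. t \<le> TF \<Longrightarrow> \<bar>N t\<bar> \<le> F * exp ((l2 + \<epsilon>) * t)"
    by (rule exp_orderE[OF N]) (rule that)
  obtain J TJ where J: "J \<ge> 0" "TJ \<le> 0" "\<And>t. t \<le> TJ \<Longrightarrow> \<bar>balance c l2 u u1 Y t\<bar> \<le> J * exp (\<epsilon> * t)"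
    by (rule exp_orderE[OF J]) (rule that)
  define T where "T = min Tw (min TF TJ)"
  show ?thesis
  proof (rule that)
    fix t assume t: "t \<le> T"
    \<comment> \<open>For s \<le> t, exp((l2 + \<epsilon>)s) is at most D exp(\<zeta>s), with
      equality at s = t. The bound of \<open>marginal_bound\<close> is linear in its two data, so
      scaling them by D converts an estimate at the weak weight \<zeta> into one at the rate l2 +
      \<epsilon>.\<close>
    define D where "D = exp ((l2 + \<epsilon> - \<zeta>) * t)"
    have D: "exp ((l2 + \<epsilon>) * s) \<le> D * exp (\<zeta> * s)" if "s \<le> t" for s
    proof -
      have "(l2 + \<epsilon> - \<zeta>) * s \<le> (l2 + \<epsilon> - \<zeta>) * t" using that z e by (intro mult_left_mono) auto
      then show ?thesis by (simp add: D_def algebra_simps flip: exp_add)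
    qed
    have "w t \<le> (2 * exp (A \<zeta> * (c * h)) * (F * D) / A \<zeta> + J * D) * exp (\<zeta> * t)"
    proof (rule marginal_bound[OF _ z(3-5)])
      show "\<zeta> < l1" using z l2 by simp
      fix s assume s: "s \<le> t"
      show "w s \<le> Cw * exp (\<zeta> * s)" using Cw[of s] s t by (simp add: T_def abs_le_iff)
      have "N s \<le> F * exp ((l2 + \<epsilon>) * s)" using F(2)[of s] s t by (simp add: T_def abs_le_iff)
      also have "\<dots> \<le> F * (D * exp (\<zeta> * s))" by (rule mult_left_mono[OF D[OF s] F(1)])
      finally show "N s \<le> F * D * exp (\<zeta> * s)" by simp
      assume "\<And>x. s - c * h \<le> x \<Longrightarrow> x \<le> s \<Longrightarrow> 0 \<le> w x"
      then have "w s \<le> exp (l2 * s) * balance c l2 u u1 Y s" by (rule balance_ge[OF l2(1,3) Y])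
      also have "\<dots> \<le> exp (l2 * s) * (J * exp (\<epsilon> * s))"
        using J(3)[of s] s t by (intro mult_left_mono) (auto simp: T_def abs_le_iff)
      also have "\<dots> = J * exp ((l2 + \<epsilon>) * s)" by (simp add: distrib_right exp_add)
      also have "\<dots> \<le> J * (D * exp (\<zeta> * s))" by (rule mult_left_mono[OF D[OF s] J(1)])
      finally show "w s \<le> J * D * exp (\<zeta> * s)" by simp
    qed (use F J in \<open>auto simp: D_def\<close>)
    also have "\<dots> = (2 * exp (A \<zeta> * (c * h)) * F / A \<zeta> + J) * (D * exp (\<zeta> * t))"
      by (simp add: field_simps)
    also have "D * exp (\<zeta> * t) = exp ((l2 + \<epsilon>) * t)" by (simp add: D_def algebra_simps flip: exp_add)
    finally show "w t \<le> (2 * exp (A \<zeta> * (c * h)) * F / A \<zeta> + J) * exp ((l2 + \<epsilon>) * t)" .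
  qed
qed

lemma marginal_order:
  assumes l2: "chi g0 h l2 c = 0" "0 < l2" "l2 < l1" and e: "\<epsilon> > 0"
    and Y: "\<And>t. (Y has_real_derivative exp (- l2 * t) * u t) (at t)"
    and N: "exp_order N (l2 + \<epsilon>)" and J: "exp_order (balance c l2 u u1 Y) \<epsilon>"
    and w: "\<And>\<zeta>. \<zeta> < l2 \<Longrightarrow> exp_order w \<zeta>"
  shows "exp_order w (l2 + \<epsilon>)"
proof -
  interpret M: linear_solution g0 h c l1 "\<lambda>t. - u t" "\<lambda>t. - u1 t" "\<lambda>t. - u2 t" "\<lambda>t. - N t"
    by (rule neg_solution)
  have Mw: "M.w = (\<lambda>t. - w t)" by (rule ext) (simp add: M.w_def w_def)
  obtain C T where 1: "\<And>t. t \<le> T \<Longrightarrow> w t \<le> C * exp ((l2 + \<epsilon>) * t)"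
    by (rule marginal_upper[OF assms]) (assumption | rule that)+
  have Y': "((\<lambda>t. - Y t) has_real_derivative exp (- l2 * t) * - u t) (at t)" for t
    using DERIV_minus[OF Y[of t]] by simp
  have "exp_order (\<lambda>t. - N t) (l2 + \<epsilon>)"
    "exp_order (balance c l2 (\<lambda>t. - u t) (\<lambda>t. - u1 t) (\<lambda>t. - Y t)) \<epsilon>"
    "\<And>\<zeta>. \<zeta> < l2 \<Longrightarrow> exp_order M.w \<zeta>"
    unfolding balance_neg[abs_def] Mw using N J w by (auto simp: exp_order_def)
  then obtain C' T' where 2: "\<And>t. t \<le> T' \<Longrightarrow> M.w t \<le> C' * exp ((l2 + \<epsilon>) * t)"
    by (rule M.marginal_upper[OF l2 e Y']) (assumption | rule that)+
  show ?thesis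
  proof (rule exp_orderI)
    fix t assume "t \<le> min T T'"
    then have "w t \<le> C * exp ((l2 + \<epsilon>) * t)" "- w t \<le> C' * exp ((l2 + \<epsilon>) * t)"
      using 1 2 by (auto simp: Mw)
    moreover have "C * exp ((l2 + \<epsilon>) * t) \<le> max C C' * exp ((l2 + \<epsilon>) * t)"
      "C' * exp ((l2 + \<epsilon>) * t) \<le> max C C' * exp ((l2 + \<epsilon>) * t)" by simp_all
    ultimately show "\<bar>w t\<bar> \<le> max C C' * exp ((l2 + \<epsilon>) * t)" by linarith
  qed
qed

text \<open>The contraction is run at the weight \<nu>, where A > B, while the better decay of
  \<open>N\<close> enters as a factor exp(\<eta>t) frozen at the time considered. Hence \<nu> +
  \<eta> may exceed l1, although the contraction itself is confined to (l2, l1).\<close>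

lemma contraction_upper:
  assumes l2: "chi g0 h l2 c = 0" and nu: "l2 < \<nu>" "\<nu> < l1" and e: "\<eta> \<ge> 0"
    and N: "exp_order N (\<nu> + \<eta>)" and w: "exp_order w \<nu>"
  obtains C T where "\<And>t. t \<le> T \<Longrightarrow> w t \<le> C * exp ((\<nu> + \<eta>) * t)"
proof -
  obtain Cw Tw where Cw: "\<And>t. t \<le> Tw \<Longrightarrow> \<bar>w t\<bar> \<le> Cw * exp (\<nu> * t)"
    by (rule exp_orderE[OF w]) (rule that)
  obtain F TF where F: "F \<ge> 0" "\<And>t. t \<le> TF \<Longrightarrow> \<bar>N t\<bar> \<le> F * exp ((\<nu> + \<eta>) * t)"
    by (rule exp_orderE[OF N]) (rule that)
  have "chi g0 h \<nu> c < 0" by (rule chi_neg_between[OF g0_nonneg l2 l1 nu])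
  then have "(A \<nu> - B \<nu>) * (\<nu> - l1) < 0" using AB_chi[of \<nu>] nu by simp
  then have AB: "A \<nu> > B \<nu>" using nu by (simp add: mult_less_0_iff)
  show ?thesis
  proof (rule that)
    fix t assume t: "t \<le> min Tw TF"
    have "w t \<le> F * exp (\<eta> * t) / (A \<nu> - B \<nu>) * exp (\<nu> * t)"
    proof (rule contraction_bound[OF nu(2) AB])
      fix s assume s: "s \<le> t"
      show "w s \<le> Cw * exp (\<nu> * s)" using Cw[of s] s t by (simp add: abs_le_iff)
      have "\<eta> * s \<le> \<eta> * t" using s e by (intro mult_left_mono) auto
      then have 1: "exp ((\<nu> + \<eta>) * s) \<le> exp (\<eta> * t) * exp (\<nu> * s)"
        by (simp add: algebra_simps flip: exp_add)
      have "N s \<le> F * exp ((\<nu> + \<eta>) * s)" using F(2)[of s] s t by (simp add: abs_le_iff)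
      also have "\<dots> \<le> F * (exp (\<eta> * t) * exp (\<nu> * s))" by (rule mult_left_mono[OF 1 F(1)])
      finally show "N s \<le> F * exp (\<eta> * t) * exp (\<nu> * s)" by simp
    qed
    also have "\<dots> = F / (A \<nu> - B \<nu>) * exp ((\<nu> + \<eta>) * t)" by (simp add: distrib_right exp_add)
    finally show "w t \<le> F / (A \<nu> - B \<nu>) * exp ((\<nu> + \<eta>) * t)" .
  qed
qed

lemma contraction_order:
  assumes l2: "chi g0 h l2 c = 0" and nu: "l2 < \<nu>" "\<nu> < l1" and e: "\<eta> \<ge> 0"
    and N: "exp_order N (\<nu> + \<eta>)" and w: "exp_order w \<nu>"
  shows "exp_order w (\<nu> + \<eta>)"
proof -
  interpret M: linear_solution g0 h c l1 "\<lambda>t. - u t" "\<lambda>t. - u1 t" "\<lambda>t. - u2 t" "\<lambda>t. - N t"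
    by (rule neg_solution)
  have Mw: "M.w = (\<lambda>t. - w t)" by (rule ext) (simp add: M.w_def w_def)
  obtain C T where 1: "\<And>t. t \<le> T \<Longrightarrow> w t \<le> C * exp ((\<nu> + \<eta>) * t)"
    by (rule contraction_upper[OF assms]) (assumption | rule that)+
  have "exp_order (\<lambda>t. - N t) (\<nu> + \<eta>)" "exp_order M.w \<nu>"
    unfolding Mw using N w by (auto simp: exp_order_def)
  then obtain C' T' where 2: "\<And>t. t \<le> T' \<Longrightarrow> M.w t \<le> C' * exp ((\<nu> + \<eta>) * t)"
    by (rule M.contraction_upper[OF l2 nu e]) (assumption | rule that)+
  show ?thesis
  proof (rule exp_orderI)
    fix t assume "t \<le> min T T'"
    then have "w t \<le> C * exp ((\<nu> + \<eta>) * t)" "- w t \<le> C' * exp ((\<nu> + \<eta>) * t)"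
      using 1 2 by (auto simp: Mw)
    moreover have "C * exp ((\<nu> + \<eta>) * t) \<le> max C C' * exp ((\<nu> + \<eta>) * t)"
      "C' * exp ((\<nu> + \<eta>) * t) \<le> max C C' * exp ((\<nu> + \<eta>) * t)" by simp_all
    ultimately show "\<bar>w t\<bar> \<le> max C C' * exp ((\<nu> + \<eta>) * t)" by linarith
  qed
qed

end

section \<open>The two possible exponents of a front\<close>

locale front_roots = front_profile +
  fixes l2 l1 :: real
  assumes l2_pos: "0 < l2" and l2_l1: "l2 < l1"
    and chi_l2: "chi g0 h l2 c = 0" and chi_l1: "chi g0 h l1 c = 0"
begin

sublocale lin: linear_solution g0 h c l1 \<phi> \<phi>1 \<phi>2 N
  by unfold_locales (rule c chi_l1 phi linear_eq)+

lemma chi1_l2: "chi1 g0 h l2 c < 0" and chi1_l1: "chi1 g0 h l1 c > 0"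
  using chi1_signs[OF g0_nonneg chi_l2 chi_l1 l2_l1] by auto

lemma decays_below: "z < l2 \<Longrightarrow> decays z"
proof -
  assume z: "z < l2"
  have "decays (max z 0)"
    by (rule decays_upto[of 0])
       (use z l2_pos decays_0 chi_pos_left[OF g0_nonneg chi_l2] chi1_l2 in auto)
  then show ?thesis by (rule decays_le) simp
qed

lemma not_decays_above: "z > l1 \<Longrightarrow> \<not> decays z"
  by (rule not_decays) (use l2_pos l2_l1 chi_pos_right[OF g0_nonneg chi_l1] chi1_l1 in auto)

lemma order_phi1: "exp_order \<phi> \<nu> \<Longrightarrow> exp_order \<phi>1 \<nu>"
proof -
  assume "exp_order \<phi> \<nu>"
  then obtain C T where CT: "\<And>t. t \<le> T \<Longrightarrow> \<bar>\<phi> t\<bar> \<le> C * exp (\<nu> * t)"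
    by (rule exp_orderE) (rule that)
  show ?thesis
  proof (rule exp_orderI)
    fix t assume "t \<le> T"
    then have "\<beta> * \<phi> t \<le> \<beta> * (C * exp (\<nu> * t))" 
      using CT[of t] beta_pos by (intro mult_left_mono) auto
    then show "\<bar>\<phi>1 t\<bar> \<le> (\<beta> * C) * exp (\<nu> * t)" 
      using deriv_bounds(2)[of t] phi1_nonneg[of t] by (simp add: mult.assoc)
  qed
qed

lemma order_w: "exp_order \<phi> \<nu> \<Longrightarrow> exp_order lin.w \<nu>"
proof -
  assume a: "exp_order \<phi> \<nu>"
  have "exp_order (\<lambda>t. \<phi>1 t + - l1 * \<phi> t) \<nu>"
    by (rule exp_order_add[OF order_phi1[OF a] exp_order_cmult[OF a]])
  then show ?thesis by (simp add: lin.w_def[abs_def])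
qed

lemma decays_imp_order:
  assumes "decays z"
  shows "exp_order \<phi> z"
proof -
  have "\<forall>\<^sub>F t in at_bot. exp (- z * t) * \<phi> t < 1"
    using assms unfolding decays_def by (rule order_tendstoD) simp
  then obtain T where T: "\<And>t. t \<le> T \<Longrightarrow> exp (- z * t) * \<phi> t < 1" by (auto simp: eventually_at_bot_linorder)
  show ?thesis
  proof (rule exp_orderI)
    fix t assume "t \<le> T"
    then have 1: "exp (- z * t) * \<phi> t \<le> 1" using T[of t] by simp
    have "\<phi> t = exp (z * t) * (exp (- z * t) * \<phi> t)" by (simp add: exp_minus)
    also have "\<dots> \<le> exp (z * t) * 1" by (rule mult_left_mono[OF 1]) simp
    finally show "\<bar>\<phi> t\<bar> \<le> 1 * exp (z * t)" using pos[of t] by simp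
  qed
qed

lemma order_imp_decays:
  assumes "exp_order \<phi> \<nu>" "z < \<nu>"
  shows "decays z"
proof -
  obtain C T where CT: "\<And>t. t \<le> T \<Longrightarrow> \<bar>\<phi> t\<bar> \<le> C * exp (\<nu> * t)"
    by (rule exp_orderE[OF assms(1)]) (rule that)
  show ?thesis
    unfolding decays_def
  proof (rule tendsto_sandwich[where f = "\<lambda>_. 0" and h = "\<lambda>t. C * exp ((\<nu> - z) * t)"])
    show "\<forall>\<^sub>F t in at_bot. 0 \<le> exp (- z * t) * \<phi> t" using pos by (simp add: less_imp_le)
    show "\<forall>\<^sub>F t in at_bot. exp (- z * t) * \<phi> t \<le> C * exp ((\<nu> - z) * t)"
      using eventually_le_at_bot[of T]
    proof eventually_elim
      case (elim t)
      have "exp (- z * t) * \<phi> t \<le> exp (- z * t) * (C * exp (\<nu> * t))"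
        using CT[OF elim] by (intro mult_left_mono) auto
      also have "\<dots> = C * exp ((\<nu> - z) * t)" by (simp add: algebra_simps flip: exp_add)
      finally show ?case .
    qed
    show "((\<lambda>t. C * exp ((\<nu> - z) * t)) \<longlongrightarrow> 0) at_bot"
      using tendsto_mult[OF tendsto_const tendsto_exp_at_bot, of "\<nu> - z" C] assms(2) by simp
  qed simp
qed

lemma order_N:
  assumes "exp_order \<phi> \<nu>"
  shows "exp_order N ((1 + \<theta>) * \<nu>)"
proof -
  obtain C T where CT: "\<And>t. t \<le> T \<Longrightarrow> \<bar>\<phi> t\<bar> \<le> C * exp (\<nu> * t)"
    by (rule exp_orderE[OF assms(1)]) (rule that)
  obtain T' where T': "\<And>t. t \<le> T' \<Longrightarrow> \<phi> t < \<delta>" using phi_small[OF delta] by blast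
  have "0 < C * exp (\<nu> * T)" using CT[of T] pos[of T] by linarith
  then have C: "C > 0" by (simp add: zero_less_mult_iff)
  show ?thesis
  proof (rule exp_orderI)
    fix t assume t: "t \<le> min T T'"
    have "\<phi> (t - c * h) \<le> \<phi> t" using tau by (intro phi_mono) simp
    also have "\<dots> \<le> C * exp (\<nu> * t)" using CT[of t] t by simp
    finally have 1: "\<phi> (t - c * h) \<le> C * exp (\<nu> * t)" .
    have "\<bar>N t\<bar> \<le> Kg * \<phi> (t - c * h) powr (1 + \<theta>)"
      using T'[of t] t by (intro N_powr_bound) simp
    also have "\<dots> \<le> Kg * (C * exp (\<nu> * t)) powr (1 + \<theta>)"
      using Kg theta pos[of "t - c * h"] 1 by (intro mult_left_mono powr_mono2) auto
    also have "\<dots> = (Kg * C powr (1 + \<theta>)) * exp ((1 + \<theta>) * \<nu> * t)"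
      using C by (simp add: powr_mult powr_def[of "exp _"] mult.assoc)
    finally show "\<bar>N t\<bar> \<le> (Kg * C powr (1 + \<theta>)) * exp ((1 + \<theta>) * \<nu> * t)" .
  qed
qed

text \<open>At z = l2 the chi term of the balance law drops out, so I converges, and its limit
  determines the coefficient. Positivity of \<phi> excludes a < 0 but not a = 0, the case of faster
  decay.\<close>

lemma slow_asymptotics:
  obtains a \<rho> where "0 \<le> a" "0 < \<rho>" "\<rho> < l1 - l2" "exp_order (\<lambda>t. \<phi> t - a * exp (l2 * t)) (l2 + \<rho>)"
proof -
  \<comment> \<open>Below \<theta> * l2, so that decay of \<phi> at some exponent under l2 already
    gives N the order l2 + \<rho>; below l1 - l2, so that w can be integrated back to u.\<close>
  define \<rho> where "\<rho> = min (\<theta> * l2) (l1 - l2) / 2"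
  have e: "0 < \<rho>" "\<rho> < \<theta> * l2" "\<rho> < l1 - l2"
    using theta l2_pos l2_l1 by (auto simp: \<rho>_def min_def field_simps)
  have "(l2 + \<rho>) / (1 + \<theta>) < l2" using e theta by (simp add: field_simps)
  then have "exp_order N ((1 + \<theta>) * ((l2 + \<rho>) / (1 + \<theta>)))"
    by (intro order_N decays_imp_order decays_below)
  then have oN: "exp_order N (l2 + \<rho>)" using theta by simp
  obtain Y where Y: "\<And>t. (Y has_real_derivative exp (- l2 * t) * \<phi> t) (at t)"
    by (rule antiderivative_weighted[of l2]) auto
  have dI: "(balance c l2 \<phi> \<phi>1 Y has_real_derivative exp (- l2 * t) * N t) (at t)" for t
    using balance_front_deriv[OF less_imp_le[OF l2_pos] Y, of t] chi_l2 by simp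
  have "exp_order (\<lambda>t. exp (- l2 * t) * N t) \<rho>"
  proof -
    obtain C T where CT: "\<And>t. t \<le> T \<Longrightarrow> \<bar>N t\<bar> \<le> C * exp ((l2 + \<rho>) * t)"
      by (rule exp_orderE[OF oN]) (rule that)
    show ?thesis
    proof (rule exp_orderI)
      fix t assume "t \<le> T"
      then have "\<bar>exp (- l2 * t) * N t\<bar> \<le> exp (- l2 * t) * (C * exp ((l2 + \<rho>) * t))"
        using CT[of t] by (simp add: abs_mult)
      also have "\<dots> = C * exp (\<rho> * t)" by (simp add: algebra_simps flip: exp_add)
      finally show "\<bar>exp (- l2 * t) * N t\<bar> \<le> C * exp (\<rho> * t)" .
    qed
  qed
  then obtain L where L: "exp_order (\<lambda>t. balance c l2 \<phi> \<phi>1 Y t - L) \<rho>"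
    by (rule exp_order_convergent[OF dI _ e(1)]) (assumption | rule that)+
  \<comment> \<open>The functional of exp(l2 t) is the constant chi1(l2), so subtracting this
    multiple makes the functional of the remainder tend to 0 at the rate \<rho>.\<close>
  define a where "a = L / chi1 g0 h l2 c"
  define u where "u t = \<phi> t - a * exp (l2 * t)" for t
  define u1 where "u1 t = \<phi>1 t - a * l2 * exp (l2 * t)" for t
  define u2 where "u2 t = \<phi>2 t - a * l2 * l2 * exp (l2 * t)" for t
  define Yu where "Yu t = Y t - a * t" for t
  interpret U: linear_solution g0 h c l1 u u1 u2 N
  proof
    show "twice_diff u u1 u2"
      unfolding twice_diff_def u_def[abs_def] u1_def[abs_def] u2_def
      by (auto intro!: derivative_eq_intros d1 d2 simp: algebra_simps)
    fix t
    have "exp (l2 * (t - c * h)) = exp (l2 * t) * exp (- l2 * c * h)"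
      by (simp add: algebra_simps flip: exp_add)
    then have "u2 t - c * u1 t - u t + g0 * u (t - c * h)
      = (\<phi>2 t - c * \<phi>1 t - \<phi> t + g0 * \<phi> (t - c * h)) - a * exp (l2 * t) * chi g0 h l2 c"
      by (simp add: u_def u1_def u2_def chi_def algebra_simps power2_eq_square)
    then show "u2 t - c * u1 t - u t + g0 * u (t - c * h) = N t"
      using linear_eq[of t] chi_l2 by simp
  qed (rule c chi_l1)+
  have e1: "exp (- l2 * t) * exp (l2 * t) = 1" for t by (simp flip: exp_add)
  have dYu: "(Yu has_real_derivative exp (- l2 * t) * u t) (at t)" for t
  proof -
    have "exp (- l2 * t) * u t = exp (- l2 * t) * \<phi> t - a * (exp (- l2 * t) * exp (l2 * t))"
      by (simp add: u_def right_diff_distrib)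
    then show ?thesis unfolding Yu_def[abs_def] e1 by (auto intro!: derivative_eq_intros Y)
  qed
  have "balance c l2 u u1 Yu t = balance c l2 \<phi> \<phi>1 Y t - L" for t
  proof -
    have "balance c l2 u u1 Yu t = balance c l2 \<phi> \<phi>1 Y t - a * ((exp (- l2 * t) * exp (l2 * t)) * (2 * l2 - c) - g0 * exp (- l2 * (c * h)) * (c * h))"
      by (simp add: balance_def u_def u1_def Yu_def algebra_simps)
    also have "(exp (- l2 * t) * exp (l2 * t)) * (2 * l2 - c) - g0 * exp (- l2 * (c * h)) * (c * h) = chi1 g0 h l2 c"
      unfolding e1 by (simp add: chi1_def algebra_simps)
    also have "a * chi1 g0 h l2 c = L" using chi1_l2 by (simp add: a_def)
    finally show ?thesis .
  qed
  then have J: "exp_order (balance c l2 u u1 Yu) \<rho>" using L by (simp add: exp_order_def)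
  have uw: "U.w t = lin.w t + (a * (l1 - l2)) * exp (l2 * t)" for t
    by (simp add: U.w_def lin.w_def u_def u1_def algebra_simps)
  have ow: "exp_order U.w z" if "z < l2" for z
  proof -
    have "exp_order (\<lambda>t. lin.w t + (a * (l1 - l2)) * exp (l2 * t)) z"
      using that by (intro exp_order_add exp_order_cmult order_w decays_imp_order decays_below
        exp_order_le[OF exp_order_exp]) auto
    then show ?thesis by (simp add: uw[abs_def, symmetric])
  qed
  have "exp_order U.w (l2 + \<rho>)"
    by (rule U.marginal_order[OF chi_l2 l2_pos l2_l1 e(1) dYu oN J ow])
  then have ou: "exp_order u (l2 + \<rho>)"
    using e by (intro exp_order_integrate[OF U.du, of l1]) (auto simp: U.w_def[abs_def])
  have "a \<ge> 0"
  proof (rule ccontr)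
    assume "\<not> ?thesis"
    then have a: "a < 0" by simp
    obtain C T where CT: "C \<ge> 0" "T \<le> 0" "\<And>t. t \<le> T \<Longrightarrow> \<bar>u t\<bar> \<le> C * exp ((l2 + \<rho>) * t)"
      by (rule exp_orderE[OF ou]) (rule that)
    have "\<forall>\<^sub>F t in at_bot. C * exp (\<rho> * t) < - a"
      using tendsto_mult[OF tendsto_const tendsto_exp_at_bot[OF e(1)], of C] a
      by (intro order_tendstoD) auto
    then obtain t where t: "t \<le> T" "C * exp (\<rho> * t) < - a"
      unfolding eventually_at_bot_linorder by (metis min.cobounded1 min.cobounded2)
    have "- a * exp (l2 * t) < u t" using pos[of t] by (simp add: u_def)
    also have "\<dots> \<le> C * exp ((l2 + \<rho>) * t)" using CT(3)[OF t(1)] by simp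
    also have "\<dots> = C * exp (\<rho> * t) * exp (l2 * t)" by (simp add: distrib_right exp_add)
    also have "\<dots> \<le> - a * exp (l2 * t)" using t(2) by (intro mult_right_mono) auto
    finally show False by simp
  qed
  then show ?thesis using that e ou by (simp add: u_def[abs_def])
qed

text \<open>The superlinear remainder multiplies the exponent of w by 1 + \<theta>, past l1 if need
  be, whereas \<open>exp_order_integrate\<close> lets \<phi> follow only below l1.\<close>

lemma order_bootstrap:
  assumes "exp_order \<phi> \<nu>" "l2 < \<nu>" "\<nu> < l1"
  shows "exp_order lin.w ((1 + \<theta>) * \<nu>)"
proof -
  have "exp_order lin.w (\<nu> + \<theta> * \<nu>)"
    using order_N[OF assms(1)] theta assms l2_pos
    by (intro lin.contraction_order[OF chi_l2 assms(2,3)] order_w) (auto simp: algebra_simps)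
  then show ?thesis by (simp add: algebra_simps)
qed

lemma fast_asymptotics:
  assumes "exp_order \<phi> \<mu>" "l2 < \<mu>" "\<mu> < l1"
  obtains a \<sigma> where "a > 0" "\<sigma> > 0" "exp_order (\<lambda>t. \<phi> t - a * exp (l1 * t)) (l1 + \<sigma>)"
proof -
  \<comment> \<open>Any exponent in (l1/(1 + \<theta>), l1) that is at least \<mu> serves: \<phi>
    still reaches it by integration, and one more bootstrap carries w beyond l1.\<close>
  define b where "b = max \<mu> ((l1 + l1 / (1 + \<theta>)) / 2)"
  have l1: "l1 > 0" using l2_pos l2_l1 by simp
  have "l1 / (1 + \<theta>) < l1" using l1 theta by (simp add: field_simps)
  then have b: "\<mu> \<le> b" "b < l1" using assms by (auto simp: b_def max_def)
  have "(1 + \<theta>) * ((l1 + l1 / (1 + \<theta>)) / 2) = l1 + \<theta> * l1 / 2" using theta by (simp add: field_simps)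
  moreover have "(1 + \<theta>) * ((l1 + l1 / (1 + \<theta>)) / 2) \<le> (1 + \<theta>) * b"
    using theta by (intro mult_left_mono) (auto simp: b_def)
  moreover have "\<theta> * l1 / 2 > 0" using theta l1 by simp
  ultimately have b1: "(1 + \<theta>) * b > l1" by linarith
  have mu: "\<theta> * \<mu> > 0" using theta assms l2_pos by simp
  from b(1) mu assms(1) have ob: "exp_order \<phi> b"
  proof (induction rule: min_step_induct)
    case (step z)
    have z: "l2 < z" "z < l1" using step b assms by auto
    have "z + \<theta> * \<mu> \<le> (1 + \<theta>) * z" using step theta by (simp add: algebra_simps mult_left_mono)
    then have le: "min b (z + \<theta> * \<mu>) \<le> (1 + \<theta>) * z" by linarith
    have "exp_order lin.w (min b (z + \<theta> * \<mu>))"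
      by (rule exp_order_le[OF order_bootstrap[OF step(3) z] le])
    then have "exp_order (\<lambda>t. \<phi>1 t - l1 * \<phi> t) (min b (z + \<theta> * \<mu>))"
      by (simp only: lin.w_def[abs_def])
    then show ?case by (rule exp_order_integrate[OF d1]) (use b in linarith)
  qed
  define \<sigma> where "\<sigma> = (1 + \<theta>) * b - l1"
  have s: "\<sigma> > 0" using b1 by (simp add: \<sigma>_def)
  have ow: "exp_order lin.w (l1 + \<sigma>)" using order_bootstrap[OF ob] b assms by (simp add: \<sigma>_def)
  define p where "p t = exp (- l1 * t) * \<phi> t" for t
  have dp: "(p has_real_derivative exp (- l1 * t) * lin.w t) (at t)" for t
    unfolding p_def[abs_def] lin.w_def by (auto intro!: derivative_eq_intros d1 simp: algebra_simps)
  have "exp_order (\<lambda>t. exp (- l1 * t) * lin.w t) \<sigma>"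
  proof -
    obtain C T where CT: "\<And>t. t \<le> T \<Longrightarrow> \<bar>lin.w t\<bar> \<le> C * exp ((l1 + \<sigma>) * t)"
      by (rule exp_orderE[OF ow]) (rule that)
    show ?thesis
    proof (rule exp_orderI)
      fix t assume "t \<le> T"
      then have "\<bar>exp (- l1 * t) * lin.w t\<bar> \<le> exp (- l1 * t) * (C * exp ((l1 + \<sigma>) * t))"
        using CT[of t] by (simp add: abs_mult)
      also have "\<dots> = C * exp (\<sigma> * t)" by (simp add: algebra_simps flip: exp_add)
      finally show "\<bar>exp (- l1 * t) * lin.w t\<bar> \<le> C * exp (\<sigma> * t)" .
    qed
  qed
  then obtain a where a: "exp_order (\<lambda>t. p t - a) \<sigma>"
    by (rule exp_order_convergent[OF dp _ s]) (assumption | rule that)+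
  have oa: "exp_order (\<lambda>t. \<phi> t - a * exp (l1 * t)) (l1 + \<sigma>)"
  proof -
    obtain C T where CT: "\<And>t. t \<le> T \<Longrightarrow> \<bar>p t - a\<bar> \<le> C * exp (\<sigma> * t)"
      by (rule exp_orderE[OF a]) (rule that)
    show ?thesis
    proof (rule exp_orderI)
      fix t assume t: "t \<le> T"
      have "\<phi> t - a * exp (l1 * t) = exp (l1 * t) * (p t - a)"
        by (simp add: p_def exp_minus algebra_simps)
      then have "\<bar>\<phi> t - a * exp (l1 * t)\<bar> = exp (l1 * t) * \<bar>p t - a\<bar>" by (simp add: abs_mult)
      also have "\<dots> \<le> exp (l1 * t) * (C * exp (\<sigma> * t))" using CT[OF t] by (intro mult_left_mono) auto
      also have "\<dots> = C * exp ((l1 + \<sigma>) * t)" by (simp add: distrib_right exp_add)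
      finally show "\<bar>\<phi> t - a * exp (l1 * t)\<bar> \<le> C * exp ((l1 + \<sigma>) * t)" .
    qed
  qed
  have "a \<ge> 0"
  proof (rule ccontr)
    assume "\<not> ?thesis"
    then have na: "a < 0" by simp
    obtain C T where CT: "\<And>t. t \<le> T \<Longrightarrow> \<bar>p t - a\<bar> \<le> C * exp (\<sigma> * t)"
      by (rule exp_orderE[OF a]) (rule that)
    have "\<forall>\<^sub>F t in at_bot. C * exp (\<sigma> * t) < - a"
      using tendsto_mult[OF tendsto_const tendsto_exp_at_bot[OF s], of C] na
      by (intro order_tendstoD) auto
    then obtain t where t: "t \<le> T" "C * exp (\<sigma> * t) < - a"
      unfolding eventually_at_bot_linorder by (metis min.cobounded1 min.cobounded2)
    have "p t > 0" using pos[of t] by (simp add: p_def)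
    then show False using CT[OF t(1)] t(2) by linarith
  qed
  moreover have "a \<noteq> 0"
  proof
    assume "a = 0"
    then have "decays (l1 + \<sigma> / 2)" using oa s by (intro order_imp_decays[of "l1 + \<sigma>"]) auto
    then show False using not_decays_above s by simp
  qed
  ultimately show ?thesis using that[of a \<sigma>] oa s by simp
qed

end

section \<open>Fronts of different speeds\<close>

context front_profile
begin

lemma less_kappa: "\<phi> t < \<kappa>"
  using strict[of t "t + 1"] le_kappa[of "t + 1"] by simp

lemma lipschitz:
  assumes "s \<le> t"
  shows "\<phi> t - \<phi> s \<le> \<beta> * \<kappa> * (t - s)"
proof -
  have "\<phi> t - \<beta> * \<kappa> * t \<le> \<phi> s - \<beta> * \<kappa> * s"
  proof (rule deriv_nonpos_ge[OF assms, where f' = "\<lambda>x. \<phi>1 x - \<beta> * \<kappa>"])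
    fix x
    have "\<phi>1 x \<le> \<beta> * \<kappa>"
      using deriv_bounds(2)[of x] mult_left_mono[OF le_kappa[of x], of \<beta>] beta_pos by linarith
    then show "\<phi>1 x - \<beta> * \<kappa> \<le> 0" by simp
  qed (auto intro!: derivative_eq_intros d1)
  then show ?thesis by (simp add: algebra_simps)
qed

lemma ge_near_top:
  assumes "r < \<kappa>"
  obtains T where "\<And>t. t \<ge> T \<Longrightarrow> \<phi> t \<ge> r"
proof -
  have "\<forall>\<^sub>F t in at_top. \<phi> t > r" using lim_top assms by (rule order_tendstoD)
  then obtain T where "\<And>t. t \<ge> T \<Longrightarrow> \<phi> t > r" by (auto simp: eventually_at_top_linorder)
  then show ?thesis by (intro that[of T]) (auto simp: less_imp_le)
qed

end

section \<open>Sliding a front below a slower one\<close>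

locale two_fronts = F: front_profile g \<kappa> g0 h Kg \<theta> \<delta> q \<epsilon> c \<phi> \<phi>1 \<phi>2 +
  S: front_profile g \<kappa> g0 h Kg \<theta> \<delta> q \<epsilon> c' \<psi> \<psi>1 \<psi>2
  for g \<kappa> g0 h Kg \<theta> \<delta> q \<epsilon> c \<phi> \<phi>1 \<phi>2 c' \<psi> \<psi>1 \<psi>2 +
  assumes speeds: "c' < c"
begin

text \<open>A profile of smaller speed is a strict supersolution at the larger speed, since both
  $(c'-c)\psi'$ and the change of the delay have a sign.\<close>
lemma strict_supersolution: "\<psi>2 t - c * \<psi>1 t - \<psi> t + g (\<psi> (t - c * h)) < 0"
proof -
  have "c' * h < c * h" using speeds F.h by simp
  then have "\<psi> (t - c * h) < \<psi> (t - c' * h)" by (intro S.strict) simp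
  then have "g (\<psi> (t - c * h)) < g (\<psi> (t - c' * h))"
    using S.pos[of "t - c * h"] by (intro F.g_strict) auto
  moreover have "c' * \<psi>1 t \<le> c * \<psi>1 t" using speeds S.phi1_nonneg[of t] by (intro mult_right_mono) auto
  ultimately show ?thesis using S.eq[of t] by linarith
qed

text \<open>At a minimum of the difference the first derivatives agree and the second are ordered,
  so subtracting the equation from the strict differential inequality leaves only present and
  delayed values.\<close>

lemma minimum_inequality:
  assumes mn: "\<And>t. \<psi> (t0 + a) - \<phi> t0 \<le> \<psi> (t + a) - \<phi> t"
  shows "\<phi> t0 - \<psi> (t0 + a) < g (\<phi> (t0 - c * h)) - g (\<psi> (t0 + a - c * h))"
proof -
  have d: "((\<lambda>t. \<psi> (t + a) - \<phi> t) has_real_derivative \<psi>1 (t + a) - \<phi>1 t) (at t)" for t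
    by (auto intro!: derivative_eq_intros DERIV_shift[THEN iffD1] S.d1 F.d1)
  have d2: "((\<lambda>t. \<psi>1 (t + a) - \<phi>1 t) has_real_derivative \<psi>2 (t0 + a) - \<phi>2 t0) (at t0)"
    by (auto intro!: derivative_eq_intros DERIV_shift[THEN iffD1] S.d2 F.d2)
  have m: "\<psi>1 (t0 + a) - \<phi>1 t0 = 0" "\<psi>2 (t0 + a) - \<phi>2 t0 \<ge> 0"
    using local_min_second_deriv[of "\<lambda>t. \<psi> (t + a) - \<phi> t" "\<lambda>t. \<psi>1 (t + a) - \<phi>1 t" t0, OF _ d2] d mn
    by auto
  have "\<psi>1 (t0 + a) = \<phi>1 t0" using m(1) by simp
  then have "c * \<psi>1 (t0 + a) = c * \<phi>1 t0" by simp
  then show ?thesis using strict_supersolution[of "t0 + a"] F.eq[of t0] m(2) by linarith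
qed

text \<open>A failure produces a negative global minimum of the difference.
  \<open>minimum_inequality\<close> transfers it to the delayed point, where both values lie in the
  contraction range of g, so the difference there would be more negative than the minimum by a
  factor 1/q.\<close>

lemma comparison_at_top:
  assumes le: "\<And>t. t \<le> T \<Longrightarrow> \<phi> t \<le> \<psi> (t + a)"
    and near: "\<kappa> - \<epsilon> \<le> \<phi> (T - c * h)" "\<kappa> - \<epsilon> \<le> \<psi> (T - c * h + a)"
  shows "\<phi> t \<le> \<psi> (t + a)"
proof (rule ccontr)
  define w where "w t = \<psi> (t + a) - \<phi> t" for t
  assume "\<not> ?thesis"
  then have neg: "w t < 0" by (simp add: w_def)
  have tT: "t > T" using le[of t] neg by (cases "t \<le> T") (auto simp: w_def)
  have "filterlim (\<lambda>t. t + a) at_top at_top"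
    by real_asymp
  then have "((\<lambda>t. \<psi> (t + a)) \<longlongrightarrow> \<kappa>) at_top"
    by (rule filterlim_compose[OF S.lim_top])
  then have "(w \<longlongrightarrow> \<kappa> - \<kappa>) at_top"
    unfolding w_def[abs_def] by (intro tendsto_diff F.lim_top)
  then have "\<forall>\<^sub>F s in at_top. w s > w t" using neg by (intro order_tendstoD) auto
  then obtain R where R: "\<And>s. s \<ge> R \<Longrightarrow> w s > w t" by (auto simp: eventually_at_top_linorder)
  have ne: "{T..max R t} \<noteq> {}" using tT by simp
  have "continuous_on {T..max R t} w"
    unfolding w_def[abs_def]
    by (intro continuous_intros continuous_on_compose2[OF S.cont_on[of UNIV]] F.cont_on) auto
  then obtain t0 where t0: "t0 \<in> {T..max R t}" "\<And>s. s \<in> {T..max R t} \<Longrightarrow> w t0 \<le> w s"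
    using continuous_attains_inf[OF compact_Icc ne] by blast
  have w0: "w t0 \<le> w t" using t0(2)[of t] tT by simp
  have glob: "w t0 \<le> w s" for s
  proof -
    consider "s \<le> T" | "s \<in> {T..max R t}" | "s > max R t" by fastforce
    then show ?thesis
    proof cases
      case 1
      then show ?thesis using le[OF 1] w0 neg by (simp add: w_def)
    next
      case 2
      then show ?thesis by (rule t0(2))
    next
      case 3
      then show ?thesis using R[of s] w0 by simp
    qed
  qed
  define x where "x = t0 - c * h"
  have xT: "T - c * h \<le> x" using t0 by (simp add: x_def)
  have 1: "- w t0 < g (\<phi> x) - g (\<psi> (x + a))"
    using minimum_inequality[of t0 a] glob by (simp add: w_def x_def algebra_simps)
  have "\<phi> x > \<psi> (x + a)"
  proof (rule ccontr)
    assume "\<not> ?thesis"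
    then have "g (\<phi> x) \<le> g (\<psi> (x + a))" using F.pos[of x] by (intro F.g_mono) auto
    then show False using 1 w0 neg by simp
  qed
  moreover have "\<kappa> - \<epsilon> \<le> \<psi> (x + a)"
    using S.phi_mono[of "T - c * h + a" "x + a"] near xT by simp
  ultimately have "g (\<phi> x) - g (\<psi> (x + a)) \<le> q * (\<phi> x - \<psi> (x + a))"
    using F.le_kappa[of x] by (intro F.g_near_kappa) auto
  also have "\<dots> = q * - w x" by (simp add: w_def)
  also have "\<dots> \<le> q * - w t0" using glob[of x] F.q by (intro mult_left_mono) auto
  also have "\<dots> \<le> 1 * - w t0" using F.q w0 neg by (intro mult_right_mono) auto
  finally show False using 1 by simp
qed

text \<open>At the smallest admissible translate \<open>minimum_inequality\<close> forbids contact.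
  A further small translation is then possible: the left end is covered by the hypothesis for the
  shift a - 1, the compact middle by a positive gap, the right end by
  \<open>comparison_at_top\<close>.\<close>

lemma sliding_contradiction:
  assumes ratio: "\<And>a. \<exists>T. \<forall>t\<le>T. \<phi> t \<le> \<psi> (t + a)"
  shows False
proof -
  define Adm where "Adm = {a. \<forall>t. \<phi> t \<le> \<psi> (t + a)}"
  define L where "L = root_pos c' * \<kappa>"
  have L: "L > 0" using S.beta_pos F.kappa by (simp add: L_def)
  have lip: "\<psi> t - \<psi> s \<le> L * (t - s)" if "s \<le> t" for s t
    using S.lipschitz[OF that] by (simp add: L_def)
  obtain Tf where Tf: "\<And>t. t \<ge> Tf \<Longrightarrow> \<phi> t \<ge> \<kappa> - \<epsilon>" using F.ge_near_top[of "\<kappa> - \<epsilon>"] F.eps by auto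
  obtain Ts where Ts: "\<And>t. t \<ge> Ts \<Longrightarrow> \<psi> t \<ge> \<kappa> - \<epsilon>" using S.ge_near_top[of "\<kappa> - \<epsilon>"] F.eps by auto
  have nonempty: "Adm \<noteq> {}"
  proof -
    obtain T where T: "\<And>t. t \<le> T \<Longrightarrow> \<phi> t \<le> \<psi> (t + 0)" using ratio by blast
    define T1 where "T1 = max T (Tf + c * h)"
    obtain T2 where T2: "\<And>t. t \<ge> T2 \<Longrightarrow> \<psi> t \<ge> \<phi> T1" using S.ge_near_top[OF F.less_kappa[of T1]] by blast
    \<comment> \<open>Lifts \<psi> above \<phi>(T1) from T on, and above \<kappa> - \<epsilon> at T1
      - ch.\<close>
    define a where "a = max 0 (max (T2 - T) (Ts - (T1 - c * h)))"
    have "\<phi> t \<le> \<psi> (t + a)" for t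
    proof (rule comparison_at_top[of T1])
      fix t assume t: "t \<le> T1"
      show "\<phi> t \<le> \<psi> (t + a)"
      proof (cases "t \<le> T")
        case True
        then show ?thesis using T[of t] S.phi_mono[of t "t + a"] by (simp add: a_def)
      next
        case False
        have "\<phi> t \<le> \<phi> T1" using t by (rule F.phi_mono)
        also have "\<dots> \<le> \<psi> (t + a)" using False by (intro T2) (simp add: a_def)
        finally show ?thesis .
      qed
    next
      show "\<kappa> - \<epsilon> \<le> \<phi> (T1 - c * h)" by (rule Tf) (simp add: T1_def)
      show "\<kappa> - \<epsilon> \<le> \<psi> (T1 - c * h + a)" by (rule Ts) (simp add: a_def)
    qed
    then show ?thesis by (auto simp: Adm_def)
  qed
  obtain T0 where T0: "\<And>t. t \<le> T0 \<Longrightarrow> \<psi> t < \<phi> 0" using S.phi_small[OF F.pos[of 0]] by blast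
  have bdd: "bdd_below Adm"
  proof (rule bdd_belowI)
    fix a assume "a \<in> Adm"
    then have "\<phi> 0 \<le> \<psi> (0 + a)" unfolding Adm_def by blast
    then show "T0 \<le> a" using T0[of a] by (cases "T0 \<le> a") auto
  qed
  define a where "a = Inf Adm"
  have adm: "\<phi> t \<le> \<psi> (t + a)" for t
  proof (rule field_le_epsilon)
    fix e :: real assume e: "e > 0"
    have "Inf Adm < a + e / L" using e L by (simp add: a_def)
    then obtain b where b: "b \<in> Adm" "b < a + e / L" using cInf_lessD[OF nonempty] by blast
    have "a \<le> b" unfolding a_def by (rule cInf_lower[OF b(1) bdd])
    have "\<phi> t \<le> \<psi> (t + b)" using b by (simp add: Adm_def)
    also have "\<dots> \<le> \<psi> (t + a) + L * (b - a)" using lip[of "t + a" "t + b"] \<open>a \<le> b\<close> by simp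
    also have "L * (b - a) \<le> L * (e / L)" using b L by (intro mult_left_mono) auto
    finally show "\<phi> t \<le> \<psi> (t + a) + e" using L by simp
  qed
  have strict: "\<phi> t < \<psi> (t + a)" for t
  proof (rule ccontr)
    assume "\<not> ?thesis"
    then have z: "\<phi> t = \<psi> (t + a)" using adm[of t] by simp
    have "\<phi> t - \<psi> (t + a) < g (\<phi> (t - c * h)) - g (\<psi> (t + a - c * h))"
      using adm z by (intro minimum_inequality) auto
    moreover have "g (\<phi> (t - c * h)) \<le> g (\<psi> (t + a - c * h))"
      using adm[of "t - c * h"] F.pos[of "t - c * h"] by (intro F.g_mono) (auto simp: algebra_simps)
    ultimately show False using z by simp
  qed
  obtain T where T: "\<And>t. t \<le> T \<Longrightarrow> \<phi> t \<le> \<psi> (t + (a - 1))" using ratio by blast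
  define T1 where "T1 = max T (max (Tf + c * h) (Ts + c * h - a + 1))"
  define w where "w t = \<psi> (t + a) - \<phi> t" for t
  have "continuous_on {T..T1} w"
    unfolding w_def[abs_def]
    by (intro continuous_intros continuous_on_compose2[OF S.cont_on[of UNIV]] F.cont_on) auto
  then obtain t0 where t0: "t0 \<in> {T..T1}" "\<And>s. s \<in> {T..T1} \<Longrightarrow> w t0 \<le> w s"
    using continuous_attains_inf[of "{T..T1}" w] by (auto simp: T1_def)
  \<comment> \<open>At most 1, so that the shift a - 1 settles the left end; at most the gap divided
    by the Lipschitz constant of \<psi>, so that the order persists in the middle.\<close>
  define d where "d = min 1 (w t0 / L)"
  have d: "0 < d" "d \<le> 1" "L * d \<le> w t0"
  proof -
    show "0 < d" using strict[of t0] L by (simp add: d_def w_def)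
    have "L * d \<le> L * (w t0 / L)" using L by (intro mult_left_mono) (auto simp: d_def)
    then show "L * d \<le> w t0" using L by simp
  qed (simp add: d_def)
  have "\<phi> t \<le> \<psi> (t + (a - d))" for t
  proof (rule comparison_at_top[of T1])
    fix t assume t: "t \<le> T1"
    show "\<phi> t \<le> \<psi> (t + (a - d))"
    proof (cases "t \<le> T")
      case True
      have "\<phi> t \<le> \<psi> (t + (a - 1))" by (rule T[OF True])
      also have "\<dots> \<le> \<psi> (t + (a - d))" using d by (intro S.phi_mono) simp
      finally show ?thesis .
    next
      case False
      then have "w t0 \<le> w t" using t by (intro t0(2)) simp
      moreover have "\<psi> (t + a) - \<psi> (t + (a - d)) \<le> L * d" using lip[of "t + (a - d)" "t + a"] d by simp
      ultimately show ?thesis using d by (simp add: w_def)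
    qed
  next
    show "\<kappa> - \<epsilon> \<le> \<phi> (T1 - c * h)" by (rule Tf) (simp add: T1_def)
    show "\<kappa> - \<epsilon> \<le> \<psi> (T1 - c * h + (a - d))" using d by (intro Ts) (simp add: T1_def)
  qed
  then have "a - d \<in> Adm" by (simp add: Adm_def)
  then have "a \<le> a - d" unfolding a_def by (rule cInf_lower[OF _ bdd])
  then show False using d by simp
qed

end

text \<open>If a = 0, then \<phi> = O(exp(l1 t)). At the smaller speed chi is already positive at
  l1, hence from some z < l1 on, and the slower front is bounded below by a multiple of exp(zt). So
  \<phi> lies near -\<infinity> below every translate of it, against
  \<open>sliding_contradiction\<close>.\<close>

lemma (in front_roots) slow_if_slower_front:
  assumes S: "front_profile g \<kappa> g0 h Kg \<theta> \<delta> q \<epsilon> c' \<psi> \<psi>1 \<psi>2" and c': "c' < c"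
  obtains a \<sigma> where "a > 0" "\<sigma> > 0" "exp_order (\<lambda>t. \<phi> t - a * exp (l2 * t)) (l2 + \<sigma>)"
proof -
  obtain a \<rho> where a: "0 \<le> a" "0 < \<rho>" "\<rho> < l1 - l2" "exp_order (\<lambda>t. \<phi> t - a * exp (l2 * t)) (l2 + \<rho>)"
    by (rule slow_asymptotics)
  interpret S: front_profile g \<kappa> g0 h Kg \<theta> \<delta> q \<epsilon> c' \<psi> \<psi>1 \<psi>2 by (rule S)
  interpret two_fronts g \<kappa> g0 h Kg \<theta> \<delta> q \<epsilon> c \<phi> \<phi>1 \<phi>2 c' \<psi> \<psi>1 \<psi>2
    by unfold_locales (rule c')
  have "a \<noteq> 0"
  proof
    assume "a = 0"
    then have "exp_order \<phi> (l2 + \<rho>)" using a by simp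
    moreover have "l2 < l2 + \<rho>" "l2 + \<rho> < l1" using a by auto
    ultimately obtain b \<sigma> where b: "b > 0" "\<sigma> > 0" "exp_order (\<lambda>t. \<phi> t - b * exp (l1 * t)) (l1 + \<sigma>)"
      by (rule fast_asymptotics) (rule that)
    have "exp_order (\<lambda>t. (\<phi> t - b * exp (l1 * t)) + b * exp (l1 * t)) l1"
      by (intro exp_order_add exp_order_cmult exp_order_exp exp_order_le[OF b(3)]) (use b in auto)
    then have "exp_order \<phi> l1" by simp
    then obtain C T where C: "C \<ge> 0" "T \<le> 0" "\<And>t. t \<le> T \<Longrightarrow> \<bar>\<phi> t\<bar> \<le> C * exp (l1 * t)"
      by (rule exp_orderE) (rule that)
    have l1p: "l1 > 0" using l2_pos l2_l1 by simp
    have chi1: "chi g0 h l1 c' > 0"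
      using chi_antimono_speed[OF l1p c' g0_nonneg, of h] h chi_l1 by simp
    have "((\<lambda>z. chi g0 h z c') \<longlongrightarrow> chi g0 h l1 c') (at l1)"
      using chi_cont by (simp add: isCont_def)
    then have "\<forall>\<^sub>F z in at l1. chi g0 h z c' > 0" using chi1 by (rule order_tendstoD)
    then obtain d where d: "d > 0" "\<And>z. z \<noteq> l1 \<Longrightarrow> dist z l1 < d \<Longrightarrow> chi g0 h z c' > 0"
      unfolding eventually_at by auto
    define z where "z = max (l1 - d / 2) (l1 / 2)"
    have z: "0 \<le> z" "z < l1" "l1 - d / 2 \<le> z" using l1p d by (auto simp: z_def)
    have chiz: "chi g0 h w c' > 0" if "z \<le> w" for w
    proof (cases "w \<le> l1")
      case True
      then show ?thesis using d(2)[of w] chi1 that z d(1) by (cases "w = l1") (auto simp: dist_real_def)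
    next
      case False
      then have "chi g0 h w c > 0" using chi_pos_right[OF g0_nonneg chi_l1] chi1_l1 by simp
      then show ?thesis using chi_antimono_speed[of w c' c g0 h] c' h g0_nonneg False l1p by simp
    qed
    obtain k where k: "k > 0" "\<And>t. t \<le> 0 \<Longrightarrow> k * exp (z * t) \<le> \<psi> t"
      using S.weak_lower_bound[OF z(1) chiz] by blast
    have "\<exists>T. \<forall>t\<le>T. \<phi> t \<le> \<psi> (t + s)" for s
    proof -
      have "\<forall>\<^sub>F t in at_bot. C * exp ((l1 - z) * t) < k * exp (z * s)"
        using tendsto_mult[OF tendsto_const tendsto_exp_at_bot[of "l1 - z"], of C] z k
        by (intro order_tendstoD) auto
      then obtain T' where T': "\<And>t. t \<le> T' \<Longrightarrow> C * exp ((l1 - z) * t) < k * exp (z * s)"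
        by (auto simp: eventually_at_bot_linorder)
      have "\<phi> t \<le> \<psi> (t + s)" if "t \<le> min T (min T' (- s))" for t
      proof -
        have "\<phi> t \<le> C * exp (l1 * t)" using C(3)[of t] that by simp
        also have "\<dots> = C * exp ((l1 - z) * t) * exp (z * t)"
          by (simp add: left_diff_distrib mult.assoc flip: exp_add)
        also have "\<dots> \<le> k * exp (z * s) * exp (z * t)"
          using T'[of t] that by (intro mult_right_mono) auto
        also have "\<dots> = k * exp (z * (t + s))" by (simp add: distrib_left exp_add)
        also have "\<dots> \<le> \<psi> (t + s)" using that by (intro k(2)) simp
        finally show ?thesis .
      qed
      then show ?thesis by blast
    qed
    then show False by (rule sliding_contradiction)
  qed
  then show ?thesis using that[of a \<rho>] a by simp
qed

section \<open>Fronts below supersolutions\<close>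

lemma filterlim_shift_at_bot: "filterlim (\<lambda>t::real. t - d) at_bot at_bot"
  by real_asymp

lemma filterlim_shift_at_top: "filterlim (\<lambda>t::real. t - d) at_top at_top"
  by real_asymp

lemma lipschitz_mono_continuous:
  fixes f :: "real \<Rightarrow> real"
  assumes "mono f" "\<And>s t. s \<le> t \<Longrightarrow> f t - f s \<le> L * (t - s)"
  shows "continuous_on UNIV f"
proof -
  have L: "L \<ge> 0" using assms(2)[of 0 1] monoD[OF assms(1), of 0 1] by simp
  have "L-lipschitz_on UNIV f"
  proof (rule lipschitz_onI)
    fix x y :: real
    show "dist (f x) (f y) \<le> L * dist x y"
      using assms(2)[of x y] assms(2)[of y x] monoD[OF assms(1), of x y] monoD[OF assms(1), of y x]
      by (cases "x \<le> y") (auto simp: dist_real_def)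
  qed (rule L)
  then show ?thesis by (rule lipschitz_on_continuous_on)
qed

lemma mono_tendsto_at_bot:
  fixes u :: "real \<Rightarrow> real"
  assumes "mono u" "\<And>t. l0 \<le> u t"
  shows "(u \<longlongrightarrow> Inf (range u)) at_bot"
proof -
  have bdd: "bdd_below (range u)" by (rule bdd_belowI2[of _ l0]) (use assms in auto)
  show ?thesis
  proof (rule order_tendstoI)
    fix y assume "y < Inf (range u)"
    then have "y < u t" for t using cInf_lower[OF _ bdd, of "u t"] by fastforce
    then show "\<forall>\<^sub>F t in at_bot. y < u t" by simp
  next
    fix y assume "Inf (range u) < y"
    then obtain s where s: "u s < y" using cInf_lessD[of "range u" y] by auto
    show "\<forall>\<^sub>F t in at_bot. u t < y"
      using eventually_le_at_bot[of s]
      by eventually_elim (use s monoD[OF assms(1)] in \<open>blast intro: le_less_trans\<close>)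
  qed
qed

lemma mono_tendsto_at_top:
  fixes u :: "real \<Rightarrow> real"
  assumes "mono u" "\<And>t. u t \<le> l0"
  shows "(u \<longlongrightarrow> Sup (range u)) at_top"
proof -
  have bdd: "bdd_above (range u)" by (rule bdd_aboveI2[of _ _ l0]) (use assms in auto)
  show ?thesis
  proof (rule order_tendstoI)
    fix y assume "Sup (range u) < y"
    then have "u t < y" for t using cSup_upper[OF _ bdd, of "u t"] by fastforce
    then show "\<forall>\<^sub>F t in at_top. u t < y" by simp
  next
    fix y assume "y < Sup (range u)"
    then obtain s where s: "y < u s" using less_cSupE[of y "range u"] by auto
    show "\<forall>\<^sub>F t in at_top. y < u t"
      using eventually_ge_at_top[of s]
      by eventually_elim (use s monoD[OF assms(1)] in \<open>blast intro: less_le_trans\<close>)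
  qed
qed

section \<open>The solution operator and its fixed points\<close>

context monostable
begin

text \<open>The differential inequality is only required of $C^2$ functions touching $\Phi$ from above,
  so that minima of supersolutions qualify.\<close>
definition supersolution :: "real \<Rightarrow> (real \<Rightarrow> real) \<Rightarrow> bool" where
  "supersolution c \<Phi> \<longleftrightarrow> (\<forall>t. \<exists>P P' p2. P t = \<Phi> t \<and> (\<forall>\<^sub>F s in nhds t. \<Phi> s \<le> P s) \<and>
     (\<forall>\<^sub>F s in nhds t. (P has_real_derivative P' s) (at s)) \<and> (P' has_real_derivative p2) (at t) \<and>
     p2 - c * P' t - \<Phi> t + g (\<Phi> (t - c * h)) \<le> 0)"

text \<open>The graph of the operator T. The bounds 0 and \<kappa> single out one solution, by
  \<open>response_mono\<close> applied in both directions. Fronts of speed c are increasing positive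
  fixed points with the prescribed limits.\<close>

definition response :: "real \<Rightarrow> (real \<Rightarrow> real) \<Rightarrow> (real \<Rightarrow> real) \<Rightarrow> (real \<Rightarrow> real) \<Rightarrow> (real \<Rightarrow> real) \<Rightarrow> bool" where
  "response c f u u1 u2 \<longleftrightarrow> twice_diff u u1 u2 \<and>
     (\<forall>t. u2 t - c * u1 t - u t = - g (f (t - c * h))) \<and> (\<forall>t. 0 \<le> u t \<and> u t \<le> \<kappa>)"

lemma g_le_kappa: "0 \<le> x \<Longrightarrow> x \<le> \<kappa> \<Longrightarrow> g x \<le> \<kappa>"
  using g_mono[of x \<kappa>] g_kappa by simp

lemma response_exists:
  assumes f: "continuous_on UNIV f" and "\<And>t. 0 \<le> f t" "\<And>t. f t \<le> \<kappa>"
  shows "\<exists>u u1 u2. response c f u u1 u2"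
proof -
  have "continuous_on UNIV (\<lambda>t. g (f (t - c * h)))"
    using assms by (intro continuous_on_compose2[OF g_cont] continuous_on_compose2[OF f] continuous_intros) auto
  from bounded_solution_exists[OF this, of \<kappa> c] assms show ?thesis
    unfolding response_def using g_nonneg g_le_kappa by auto
qed

lemma response_mono:
  assumes u: "response c f u u1 u2" and v: "response c f' v v1 v2"
    and le: "\<And>t. f t \<le> f' t" and f: "\<And>t. 0 \<le> f t"
  shows "u t \<le> v t"
proof -
  have "0 \<le> v t - u t"
  proof (rule bounded_supersolution_nonneg[where w = "\<lambda>t. v t - u t" and K = \<kappa>])
    show "twice_diff (\<lambda>t. v t - u t) (\<lambda>t. v1 t - u1 t) (\<lambda>t. v2 t - u2 t)"
      using u v by (auto simp: response_def twice_diff_def intro!: derivative_intros)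
    fix t
    have "0 \<le> u t" "u t \<le> \<kappa>" "0 \<le> v t" "v t \<le> \<kappa>" using u v by (auto simp: response_def)
    then show "\<bar>v t - u t\<bar> \<le> \<kappa>" by linarith
    have "g (f (t - c * h)) \<le> g (f' (t - c * h))" by (rule g_mono[OF f le])
    moreover have "u2 t - c * u1 t - u t = - g (f (t - c * h))" "v2 t - c * v1 t - v t = - g (f' (t - c * h))"
      using u v by (auto simp: response_def)
    ultimately show "(v2 t - u2 t) - c * (v1 t - u1 t) - (v t - u t) \<le> 0"
      by (simp add: algebra_simps)
  qed
  then show ?thesis by simp
qed

lemma response_shift:
  assumes "response c f u u1 u2"
  shows "response c (\<lambda>t. f (t + s)) (\<lambda>t. u (t + s)) (\<lambda>t. u1 (t + s)) (\<lambda>t. u2 (t + s))"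
proof -
  have "u2 (t + s) - c * u1 (t + s) - u (t + s) = - g (f (t - c * h + s))" for t
  proof -
    have "u2 (t + s) - c * u1 (t + s) - u (t + s) = - g (f (t + s - c * h))"
      using assms unfolding response_def by blast
    also have "t + s - c * h = t - c * h + s" by simp
    finally show ?thesis .
  qed
  then show ?thesis
    using assms unfolding response_def twice_diff_def
    by (auto intro!: DERIV_shift[THEN iffD1])
qed

text \<open>T preserves order and commutes with translations.\<close>

lemma response_increasing:
  assumes u: "response c f u u1 u2" and f: "mono f" "\<And>t. 0 \<le> f t"
  shows "mono u"
proof (rule monoI)
  fix s t :: real assume st: "s \<le> t"
  have "u s \<le> u (s + (t - s))"
    using st by (intro response_mono[OF u response_shift[OF u]] f monoD[OF f(1)]) auto
  then show "u s \<le> u t" by simp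
qed

lemma response_deriv_bounds:
  assumes u: "response c f u u1 u2" and f: "\<And>t. 0 \<le> f t"
  shows "root_neg c * u t \<le> u1 t" "u1 t \<le> root_pos c * u t"
proof -
  have "twice_diff u u1 u2" "\<And>t. u t \<ge> 0" "\<And>t. u2 t - c * u1 t - u t \<le> 0"
    using u g_nonneg[OF f] by (auto simp: response_def)
  then show "root_neg c * u t \<le> u1 t" "u1 t \<le> root_pos c * u t"
    by (rule supersolution_deriv_bounds)+
qed

lemma response_lipschitz:
  assumes u: "response c f u u1 u2" and f: "\<And>t. 0 \<le> f t" and st: "s \<le> t"
  shows "u t - u s \<le> root_pos c * \<kappa> * (t - s)"
proof -
  have "u t - root_pos c * \<kappa> * t \<le> u s - root_pos c * \<kappa> * s"
  proof (rule deriv_nonpos_ge[OF st, where f' = "\<lambda>x. u1 x - root_pos c * \<kappa>"])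
    fix x
    have "u1 x \<le> root_pos c * u x" by (rule response_deriv_bounds[OF u f])
    also have "\<dots> \<le> root_pos c * \<kappa>"
      using u root_pos_pos[of c] by (intro mult_left_mono) (auto simp: response_def)
    finally show "u1 x - root_pos c * \<kappa> \<le> 0" by simp
    show "((\<lambda>x. u x - root_pos c * \<kappa> * x) has_real_derivative u1 x - root_pos c * \<kappa>) (at x)"
      using u by (auto simp: response_def twice_diff_def intro!: derivative_eq_intros)
  qed
  then show ?thesis by (simp add: algebra_simps)
qed

lemma response_limit:
  assumes u: "response c f u u1 u2" and f: "\<And>t. 0 \<le> f t"
    and lim: "(u \<longlongrightarrow> l) F" "((\<lambda>t. f (t - c * h)) \<longlongrightarrow> m) F" and F: "F = at_top \<or> F = at_bot" and m: "0 \<le> m"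
  shows "l = g m"
proof -
  let ?b = "(root_pos c - root_neg c) * \<kappa>"
  have t: "twice_diff u u1 u2" and e: "\<And>t. u2 t - c * u1 t - u t = - g (f (t - c * h))"
    and uk: "\<And>t. 0 \<le> u t" "\<And>t. u t \<le> \<kappa>"
    using u by (auto simp: response_def)
  have "\<bar>u1 t\<bar> \<le> ?b" for t
  proof -
    have "root_pos c * u t \<le> root_pos c * \<kappa>" "root_neg c * \<kappa> \<le> root_neg c * u t"
      "root_pos c * \<kappa> \<ge> 0" "root_neg c * \<kappa> \<le> 0"
      using uk[of t] root_pos_pos[of c] root_neg_neg[of c] kappa
      by (auto intro: mult_left_mono mult_left_mono_neg simp: mult_nonpos_nonneg)
    then show ?thesis using response_deriv_bounds[OF u f, of t] by (simp add: algebra_simps abs_le_iff)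
  qed
  moreover have "((\<lambda>t. g (f (t - c * h))) \<longlongrightarrow> g m) F"
    using m f by (intro continuous_on_tendsto_compose[OF g_cont lim(2)]) auto
  moreover have "\<bar>u t\<bar> \<le> \<kappa>" for t using uk[of t] by simp
  ultimately show ?thesis
    using solution_limit[OF t e, of \<kappa> ?b] lim(1) F by blast
qed

text \<open>The behaviour at both ends makes a negative infimum of \<Phi> - u be attained; there the
  touching function minus u has a local minimum. The delayed terms are ordered since f \<le> \<Phi>,
  so the two differential relations leave \<Phi> - u \<ge> 0 at that point.\<close>

lemma response_le_supersolution:
  assumes sup: "supersolution c \<Phi>" "continuous_on UNIV \<Phi>" and Phi0: "\<And>t. 0 \<le> \<Phi> t"
    and top: "\<And>t. t \<ge> R \<Longrightarrow> \<Phi> t = \<kappa>" and bot: "(\<Phi> \<longlongrightarrow> 0) at_bot"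
    and u: "response c f u u1 u2" and f: "mono f" "\<And>t. 0 \<le> f t" "\<And>t. f t \<le> \<Phi> t"
  shows "u t \<le> \<Phi> t"
proof (rule ccontr)
  assume "\<not> ?thesis"
  then have neg: "\<Phi> t - u t < 0" by simp
  have uk: "0 \<le> u t" "u t \<le> \<kappa>" for t using u by (auto simp: response_def)
  have du: "(u has_real_derivative u1 t) (at t)" "(u1 has_real_derivative u2 t) (at t)" for t
    using u by (auto simp: response_def twice_diff_def)
  have "(f \<longlongrightarrow> 0) at_bot" by (rule tendsto_sandwich[OF _ _ tendsto_const bot]) (use f in auto)
  then have "((\<lambda>t. f (t - c * h)) \<longlongrightarrow> 0) at_bot" by (rule filterlim_compose[OF _ filterlim_shift_at_bot])
  moreover have "(u \<longlongrightarrow> Inf (range u)) at_bot"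
    using uk by (intro mono_tendsto_at_bot[of _ 0] response_increasing[OF u f(1,2)]) auto
  ultimately have "Inf (range u) = g 0" by (intro response_limit[OF u f(2)]) auto
  then have "(u \<longlongrightarrow> 0) at_bot" using \<open>(u \<longlongrightarrow> Inf (range u)) at_bot\<close> g_zero by simp
  then have "\<forall>\<^sub>F s in at_bot. u s < u t - \<Phi> t" using neg by (intro order_tendstoD) auto
  then obtain S where S: "\<And>s. s \<le> S \<Longrightarrow> u s < u t - \<Phi> t" by (auto simp: eventually_at_bot_linorder)
  define w where "w s = \<Phi> s - u s" for s
  have cont: "continuous_on {min S t..max R t} w"
    unfolding w_def[abs_def] using du(1)
    by (intro continuous_intros continuous_on_subset[OF sup(2)] continuous_at_imp_continuous_on)
       (auto intro: DERIV_isCont)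
  have ne: "{min S t..max R t} \<noteq> {}" by auto
  obtain t0 where t0: "t0 \<in> {min S t..max R t}" "\<And>s. s \<in> {min S t..max R t} \<Longrightarrow> w t0 \<le> w s"
    using continuous_attains_inf[OF compact_Icc ne cont] by blast
  have w0: "w t0 \<le> w t" using t0(2)[of t] by simp
  have glob: "w t0 \<le> w s" for s
  proof -
    consider "s \<le> S" | "s \<in> {min S t..max R t}" | "s \<ge> R" by fastforce
    then show ?thesis
    proof cases
      case 1
      then show ?thesis using S[of s] Phi0[of s] w0 by (simp add: w_def)
    next
      case 2
      then show ?thesis by (rule t0(2))
    next
      case 3
      then show ?thesis using top[of s] uk[of s] w0 neg by (simp add: w_def)
    qed
  qed
  obtain P P' p2 where P: "P t0 = \<Phi> t0" "\<forall>\<^sub>F s in nhds t0. \<Phi> s \<le> P s"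
    "\<forall>\<^sub>F s in nhds t0. (P has_real_derivative P' s) (at s)" "(P' has_real_derivative p2) (at t0)"
    "p2 - c * P' t0 - \<Phi> t0 + g (\<Phi> (t0 - c * h)) \<le> 0"
    using sup(1) unfolding supersolution_def by blast
  have e1: "\<forall>\<^sub>F s in nhds t0. ((\<lambda>s. P s - u s) has_real_derivative P' s - u1 s) (at s)"
    using P(3) by eventually_elim (auto intro!: derivative_intros du)
  have e2: "\<forall>\<^sub>F s in nhds t0. P t0 - u t0 \<le> P s - u s"
    using P(2)
  proof eventually_elim
    case (elim s)
    then show ?case using glob[of s] P(1) by (simp add: w_def)
  qed
  have "((\<lambda>s. P' s - u1 s) has_real_derivative p2 - u2 t0) (at t0)"
    by (intro derivative_intros P(4) du)
  note m = local_min_second_deriv[OF e1 this e2]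
  have "g (f (t0 - c * h)) \<le> g (\<Phi> (t0 - c * h))" by (rule g_mono[OF f(2,3)])
  moreover have "u2 t0 - c * u1 t0 - u t0 = - g (f (t0 - c * h))" using u by (auto simp: response_def)
  moreover have "P' t0 = u1 t0" using m(1) by simp
  then have "c * P' t0 = c * u1 t0" by simp
  moreover have "w t0 < 0" using w0 neg by (simp add: w_def)
  ultimately show False using m(2) P(5) unfolding w_def by linarith
qed

text \<open>The front is the largest $f \le \Phi$ with $f \le Tf$, where $T$ maps $f$ to its response.
  Responses are uniformly Lipschitz, so the supremum of such $f$ is again continuous.\<close>
lemma front_exists_between:
  assumes c: "c > 0"
    and sup: "supersolution c \<Phi>" "continuous_on UNIV \<Phi>" and Phi0: "\<And>t. 0 \<le> \<Phi> t" "\<And>t. \<Phi> t \<le> \<kappa>"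
    and top: "\<And>t. t \<ge> R \<Longrightarrow> \<Phi> t = \<kappa>" and bot: "(\<Phi> \<longlongrightarrow> 0) at_bot"
    and f0: "mono f0" "continuous_on UNIV f0" "\<And>t. 0 < f0 t" "\<And>t. f0 t \<le> \<Phi> t"
    and sub: "\<And>u u1 u2 t. response c f0 u u1 u2 \<Longrightarrow> mono u \<Longrightarrow> f0 t \<le> u t"
  shows "\<exists>\<psi> \<psi>1 \<psi>2. front_profile g \<kappa> g0 h Kg \<theta> \<delta> q \<epsilon> c \<psi> \<psi>1 \<psi>2"
proof -
  define L where "L = root_pos c * \<kappa>"
  define D where "D = {f. mono f \<and> (\<forall>s t. s \<le> t \<longrightarrow> f t - f s \<le> L * (t - s)) \<and> (\<forall>t. 0 \<le> f t \<and> f t \<le> \<Phi> t)}"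
  have Dcont: "continuous_on UNIV f" if "f \<in> D" for f
    using that by (intro lipschitz_mono_continuous[of f L]) (auto simp: D_def)
  have Dk: "0 \<le> f t" "f t \<le> \<kappa>" "f t \<le> \<Phi> t" if "f \<in> D" for f t
    using that Phi0(2)[of t] by (auto simp: D_def intro: order_trans)
  have resp_D: "u \<in> D" if u: "response c f u u1 u2" and f: "mono f" "\<And>t. 0 \<le> f t" "\<And>t. f t \<le> \<Phi> t" for f u u1 u2
    unfolding D_def L_def
    using response_increasing[OF u f(1,2)] response_lipschitz[OF u f(2)]
      response_le_supersolution[OF sup Phi0(1) top bot u f] u
    by (auto simp: response_def)
  \<comment> \<open>The functions with f \<le> Tf; as in the Knaster-Tarski theorem their supremum
    is a fixed point.\<close>
  define S where "S = {f \<in> D. \<forall>u u1 u2 t. response c f u u1 u2 \<longrightarrow> f t \<le> u t}"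
  \<comment> \<open>\<open>f0\<close> need not obey the Lipschitz bound of \<open>D\<close>, but its
    response does, and f0 \<le> T f0 gives T f0 \<le> T(T f0).\<close>
  have "0 \<le> f0 t" "f0 t \<le> \<kappa>" for t using f0(3)[of t] f0(4)[of t] Phi0(2)[of t] by linarith+
  then obtain f1 p1 p2 where f1: "response c f0 f1 p1 p2" using response_exists[OF f0(2)] by blast
  have f1D: "f1 \<in> D" using f0 by (intro resp_D[OF f1]) (auto simp: less_imp_le)
  have "mono f1" using f1D by (simp add: D_def)
  then have f01: "f0 t \<le> f1 t" for t by (rule sub[OF f1])
  have f1S: "f1 \<in> S"
    unfolding S_def using f1D response_mono[OF f1 _ f01] f0(3) by (auto simp: less_imp_le)
  define \<psi> where "\<psi> t = (SUP f\<in>S. f t)" for t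
  have bdd: "bdd_above ((\<lambda>f. f t) ` S)" for t
    by (rule bdd_aboveI2[of _ _ \<kappa>]) (use Dk in \<open>auto simp: S_def\<close>)
  have up: "f t \<le> \<psi> t" if "f \<in> S" for f t
    unfolding \<psi>_def by (rule cSUP_upper[OF that bdd])
  have least: "\<psi> t \<le> b" if "\<And>f. f \<in> S \<Longrightarrow> f t \<le> b" for t b
    unfolding \<psi>_def by (rule cSUP_least) (use f1S that in auto)
  have psiD: "\<psi> \<in> D"
    unfolding D_def
  proof (intro CollectI conjI allI impI)
    show "mono \<psi>"
    proof (rule monoI, rule least)
      fix s t :: real and f assume "s \<le> t" "f \<in> S"
      then show "f s \<le> \<psi> t" using up[of f t] by (auto simp: S_def D_def dest: monoD intro: order_trans)
    qed
    fix t
    show "0 \<le> \<psi> t" using up[OF f1S, of t] Dk(1)[OF f1D, of t] by simp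
    show "\<psi> t \<le> \<Phi> t" by (rule least) (use Dk in \<open>auto simp: S_def\<close>)
  next
    fix s t :: real assume st: "s \<le> t"
    have "\<psi> t \<le> \<psi> s + L * (t - s)"
    proof (rule least)
      fix f assume f: "f \<in> S"
      then have "f t - f s \<le> L * (t - s)" using st by (auto simp: S_def D_def)
      then show "f t \<le> \<psi> s + L * (t - s)" using up[OF f, of s] by simp
    qed
    then show "\<psi> t - \<psi> s \<le> L * (t - s)" by simp
  qed
  obtain u u1 u2 where u: "response c \<psi> u u1 u2"
    using response_exists[OF Dcont[OF psiD]] Dk[OF psiD] by blast
  have psim: "mono \<psi>" using psiD by (simp add: D_def)
  have uD: "u \<in> D" by (rule resp_D[OF u psim]) (use Dk[OF psiD] in auto)
  have le1: "\<psi> t \<le> u t" for t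
  proof (rule least)
    fix f assume f: "f \<in> S"
    then have fD: "f \<in> D" by (simp add: S_def)
    obtain v v1 v2 where v: "response c f v v1 v2"
      using response_exists[OF Dcont[OF fD]] Dk[OF fD] by blast
    have "f t \<le> v t" using f v unfolding S_def by blast
    also have "v t \<le> u t" by (rule response_mono[OF v u up[OF f] Dk(1)[OF fD]])
    finally show "f t \<le> u t" .
  qed
  \<comment> \<open>From \<psi> \<le> T\<psi> follows T\<psi> \<le> T(T\<psi>), so T\<psi> is one of
    the functions over which the supremum is taken.\<close>
  have "u \<in> S"
    unfolding S_def using uD response_mono[OF u _ le1 Dk(1)[OF psiD]] by blast
  then have "u t \<le> \<psi> t" for t by (rule up)
  then have "u = \<psi>" using le1 by (intro ext antisym) auto
  then have r: "response c \<psi> \<psi> u1 u2" using u by simp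
  have pos: "\<psi> t > 0" for t using f0(3)[of t] f01[of t] up[OF f1S, of t] by linarith
  have lt: "(\<psi> \<longlongrightarrow> Sup (range \<psi>)) at_top"
    by (rule mono_tendsto_at_top[OF psim Dk(2)[OF psiD]])
  have bddr: "bdd_above (range \<psi>)" by (rule bdd_aboveI2[of _ _ \<kappa>]) (use Dk[OF psiD] in auto)
  have s0: "Sup (range \<psi>) > 0" using cSup_upper[OF _ bddr, of "\<psi> 0"] pos[of 0] by simp
  have "Sup (range \<psi>) = g (Sup (range \<psi>))"
    by (rule response_limit[OF r Dk(1)[OF psiD] lt filterlim_compose[OF lt filterlim_shift_at_top]])
       (use s0 in auto)
  then have "Sup (range \<psi>) = \<kappa>" using g_fixed[of "Sup (range \<psi>)"] s0 by auto
  then have "(\<psi> \<longlongrightarrow> \<kappa>) at_top" using lt by simp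
  moreover have "(\<psi> \<longlongrightarrow> 0) at_bot"
    by (rule tendsto_sandwich[OF _ _ tendsto_const bot]) (use Dk[OF psiD] in auto)
  ultimately have "front_profile g \<kappa> g0 h Kg \<theta> \<delta> q \<epsilon> c \<psi> u1 u2"
    using r c pos psim by unfold_locales (auto simp: response_def)
  then show ?thesis by blast
qed

end

section \<open>Perturbing a front with slow decay\<close>

text \<open>The cut-off cube is twice differentiable across its corner, which the cut-off square is
  not; so a ramp made of it can be added to a profile without breaking the second-order
  inequality.\<close>

lemma cube_plus_deriv:
  "((\<lambda>t::real. (max 0 (t - a)) ^ 3) has_real_derivative 3 * (max 0 (t - a))\<^sup>2) (at t)"
  "((\<lambda>t::real. 3 * (max 0 (t - a))\<^sup>2) has_real_derivative 6 * max 0 (t - a)) (at t)"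
proof -
  have aux: "((\<lambda>t::real. f (max 0 (t - a))) has_real_derivative f' (max 0 (t - a))) (at t)"
    if f: "\<And>x. (f has_real_derivative f' x) (at x)" and z: "f' 0 = 0" for f f' :: "real \<Rightarrow> real"
  proof (cases t a rule: linorder_cases)
    case less
    have "((\<lambda>t. f 0) has_real_derivative 0) (at t)" by simp
    moreover have "\<forall>\<^sub>F s in nhds t. f (max 0 (s - a)) = f 0"
      using eventually_nhds_in_open[of "{..<a}" t] less by (auto elim!: eventually_mono)
    ultimately show ?thesis using less z by (subst DERIV_cong_ev[OF refl _ refl]) auto
  next
    case greater
    have "((\<lambda>t. f (t - a)) has_real_derivative f' (t - a)) (at t)"
      using DERIV_shift[of f "f' (t - a)" t "- a"] f[of "t - a"] by simp
    moreover have "\<forall>\<^sub>F s in nhds t. f (max 0 (s - a)) = f (s - a)"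
      using eventually_nhds_in_open[of "{a<..}" t] greater by (auto elim!: eventually_mono)
    ultimately show ?thesis using greater by (subst DERIV_cong_ev[OF refl _ refl]) auto
  next
    case equal
    have l: "((\<lambda>t. f (max 0 (t - a))) has_real_derivative 0) (at a within {..a})"
      by (rule has_field_derivative_transform_within[of "\<lambda>_. f 0" _ _ _ 1]) auto
    have r0: "((\<lambda>t. f (t - a)) has_real_derivative 0) (at a within {a..})"
      using DERIV_shift[of f "f' 0" a "- a"] f[of 0] z by (auto intro: DERIV_subset)
    have r: "((\<lambda>t. f (max 0 (t - a))) has_real_derivative 0) (at a within {a..})"
      by (rule has_field_derivative_transform_within[OF r0, of 1]) auto
    have "((\<lambda>t. f (max 0 (t - a))) has_real_derivative 0) (at a within {..a} \<union> {a..})"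
      using l r unfolding has_field_derivative_iff Lim_within_Un by (rule conjI)
    moreover have "{..a} \<union> {a..} = (UNIV :: real set)" by auto
    ultimately have "((\<lambda>t. f (max 0 (t - a))) has_real_derivative 0) (at a)" by simp
    then show ?thesis using equal z by simp
  qed
  show "((\<lambda>t::real. (max 0 (t - a)) ^ 3) has_real_derivative 3 * (max 0 (t - a))\<^sup>2) (at t)"
    by (rule aux[of "\<lambda>x. x ^ 3" "\<lambda>x. 3 * x\<^sup>2"]) (auto intro!: derivative_eq_intros)
  show "((\<lambda>t::real. 3 * (max 0 (t - a))\<^sup>2) has_real_derivative 6 * max 0 (t - a)) (at t)"
    by (rule aux[of "\<lambda>x. 3 * x\<^sup>2" "\<lambda>x. 6 * x"]) (auto intro!: derivative_eq_intros)
qed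

text \<open>A supersolution at a speed $c'$ slightly below $c$. On the right it is the front with a
  shifted argument (the increment of the shift decays so fast that it beats the error due to
  the change of speed) plus a small growing term that takes it above $\kappa$; on the left it is
  $e^{\mu t} + \eta e^{lt}$ with $\chi(\mu) < 0$, $\chi(l) = 0$.\<close>
locale perturbed_front = front_profile +
  fixes c' l \<mu> amp \<eta> n \<rho>0 T0 L d k :: real and left shift rate right :: "real \<Rightarrow> real"
  assumes k_def: "k = 3 * root_pos c + 1"
    and left_def: "\<And>t. left t = amp * (exp (\<mu> * (t + n)) + \<eta> * exp (l * (t + n)))"
    and shift_def: "\<And>t. shift t = t - \<rho>0 / k * exp (- k * (t + n))"
    and rate_def: "\<And>t. rate t = \<rho>0 * exp (- k * (t + n))"
    and right_def: "\<And>t. right t = \<phi> (shift t) + d * (max 0 (t - T0)) ^ 3"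
    and c': "0 < c'" "c' < c"
    and l: "0 < l" "l < \<mu>" "chi g0 h l c' = 0"
    and amp: "0 < amp" and eta: "0 < \<eta>"
    and left_small: "left (- n + 1) \<le> \<delta>" "left (- n + 1) \<le> \<kappa>"
    and left_nonlinear: "\<And>t. t < - n + 1 \<Longrightarrow>
      Kg * left (t - c' * h) powr (1 + \<theta>) \<le> - chi g0 h \<mu> c' * (amp * exp (\<mu> * (t + n)))"
    and cross: "\<And>t. - n - 1 - c * h \<le> t \<Longrightarrow> t \<le> - n - 1 \<Longrightarrow> left t \<le> right t"
      "right (- n + 1) \<le> left (- n + 1)"
    and rho0: "0 < \<rho>0" "rate (- n - 1 - c * h) \<le> 1"
    and T0: "- n + 1 \<le> T0" "\<kappa> - \<epsilon> \<le> \<phi> (shift T0 - c * h)"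
    and L: "0 < L" "12 \<le> (1 - q) * L\<^sup>2" and d: "0 < d"
    and ramp: "\<And>t. T0 \<le> t \<Longrightarrow> t \<le> T0 + L \<Longrightarrow> 12 * d * L \<le> \<phi>1 (shift t) * rate t"
    and close: "c - c' \<le> rate (T0 + L) * c'" "2 * (c - c') \<le> rate (T0 + L)"
      "root_pos c * \<kappa> * ((c - c') * (1 + h)) \<le> 6 * d * L"
begin

lemma k: "k > 0" using beta_pos by (simp add: k_def)

lemma tau': "0 < c' * h" "c' * h < c * h" using c' h by auto

lemma rate_pos: "rate t > 0" using rho0 by (simp add: rate_def)

lemma rate_antimono: "s \<le> t \<Longrightarrow> rate t \<le> rate s"
  using rho0 k by (simp add: rate_def)

lemma rate_deriv: "(rate has_real_derivative - k * rate t) (at t)"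
  unfolding rate_def[abs_def] by (auto intro!: derivative_eq_intros)

lemma shift_deriv: "(shift has_real_derivative 1 + rate t) (at t)"
proof -
  have "(shift has_real_derivative 1 - \<rho>0 / k * (exp (- k * (t + n)) * - k)) (at t)"
    unfolding shift_def[abs_def] by (auto intro!: derivative_eq_intros)
  moreover have "1 - \<rho>0 / k * (exp (- k * (t + n)) * - k) = 1 + rate t" using k by (simp add: rate_def)
  ultimately show ?thesis by simp
qed

text \<open>The rate decreases in time, so over [t - x, t] the shifted argument advances at least at
  the speed 1 + rate t. This surplus offsets the shortening of the delay from ch to c'h.\<close>

lemma shift_diff:
  assumes "0 \<le> x"
  shows "x + rate t * x \<le> shift t - shift (t - x)"
proof -
  have e: "exp (- k * (t - x + n)) = exp (- k * (t + n)) * exp (k * x)"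
    by (simp add: algebra_simps flip: exp_add)
  have "k * x \<le> exp (k * x) - 1" using exp_ge_add_one_self[of "k * x"] by linarith
  then have "\<rho>0 / k * exp (- k * (t + n)) * (k * x) \<le> \<rho>0 / k * exp (- k * (t + n)) * (exp (k * x) - 1)"
    using rho0 k by (intro mult_left_mono) auto
  moreover have "\<rho>0 / k * exp (- k * (t + n)) * (k * x) = rate t * x" using k by (simp add: rate_def)
  moreover have "shift t - shift (t - x) = x + \<rho>0 / k * exp (- k * (t + n)) * (exp (k * x) - 1)"
    unfolding shift_def e right_diff_distrib by (simp add: mult.assoc)
  ultimately show ?thesis by simp
qed

lemma shift_mono: "s \<le> t \<Longrightarrow> shift s \<le> shift t"
proof -
  assume st: "s \<le> t"
  then have "0 \<le> rate t * (t - s)" using rate_pos[of t] by simp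
  then have "0 \<le> shift t - shift (t - (t - s))" using shift_diff[of "t - s" t] st by linarith
  then show "shift s \<le> shift t" by simp
qed

lemma left_mono: "s \<le> t \<Longrightarrow> left s \<le> left t"
  using amp eta l unfolding left_def by (intro mult_left_mono add_mono) (auto intro!: mult_left_mono)

lemma left_pos: "0 < left t"
  using amp eta by (simp add: left_def add_pos_pos)

lemma cube_mono: "s \<le> t \<Longrightarrow> (max 0 (s - T0)) ^ 3 \<le> (max 0 (t - T0)) ^ 3"
  by (intro power_mono) auto

lemma right_mono: "s \<le> t \<Longrightarrow> right s \<le> right t"
  using d cube_mono[of s t] unfolding right_def
  by (intro add_mono phi_mono shift_mono mult_left_mono) auto

definition right1 where "right1 t = \<phi>1 (shift t) * (1 + rate t) + d * (3 * (max 0 (t - T0))\<^sup>2)"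
definition right2 where
  "right2 t = \<phi>2 (shift t) * (1 + rate t) * (1 + rate t) + \<phi>1 (shift t) * (- k * rate t) + d * (6 * max 0 (t - T0))"

lemma right_deriv: "(right has_real_derivative right1 t) (at t)"
  unfolding right_def[abs_def] right1_def
  by (intro derivative_intros DERIV_chain2[OF d1 shift_deriv] DERIV_cmult cube_plus_deriv)

lemma right1_deriv: "(right1 has_real_derivative right2 t) (at t)"
proof -
  have 1: "((\<lambda>t. \<phi>1 (shift t)) has_real_derivative \<phi>2 (shift t) * (1 + rate t)) (at t)"
    by (rule DERIV_chain2[OF d2 shift_deriv])
  have 2: "((\<lambda>t. \<phi>1 (shift t) * (1 + rate t)) has_real_derivative
     \<phi>2 (shift t) * (1 + rate t) * (1 + rate t) + \<phi>1 (shift t) * (- k * rate t)) (at t)"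
    by (auto intro!: derivative_eq_intros 1 rate_deriv simp: algebra_simps)
  show ?thesis
    unfolding right1_def[abs_def] right2_def by (intro DERIV_add 2 DERIV_cmult cube_plus_deriv)
qed

text \<open>Stretching the argument costs \<phi>''(2r + r^2) with r = rate t \<le> 1, at most 3r
  \<open>root_pos c\<close> times \<phi>'. The second derivative of the shift contributes
  -kr\<phi>', and \<open>k\<close> is chosen to leave a surplus -r\<phi>' that can pay for the
  change of speed.\<close>

lemma right_operator:
  assumes t: "- n - 1 - c * h \<le> t"
  defines "x \<equiv> max 0 (t - T0)"
  shows "right2 t - c' * right1 t - right t
    \<le> - g (\<phi> (shift t - c * h)) + \<phi>1 (shift t) * (c - c' - rate t) + d * (6 * x - x ^ 3)"
proof -
  define r where "r = rate t"
  define f f1 f2 where "f = \<phi> (shift t)" "f1 = \<phi>1 (shift t)" "f2 = \<phi>2 (shift t)"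
  have r: "0 < r" "r \<le> 1" using rate_pos rate_antimono[OF t] rho0 by (auto simp: r_def)
  have f1: "f1 > 0" by (simp add: f_f1_f2_def phi1_pos)
  have f2: "f2 \<le> root_pos c * f1" unfolding f_f1_f2_def by (rule second_deriv_bounds)
  have "r * r \<le> r * 1" using r by (intro mult_left_mono) auto
  then have rr: "2 * r + r * r \<le> 3 * r" "0 \<le> 2 * r + r * r" using r by auto
  have "f2 * (2 * r + r * r) \<le> (root_pos c * f1) * (2 * r + r * r)" by (rule mult_right_mono[OF f2 rr(2)])
  also have "\<dots> \<le> (root_pos c * f1) * (3 * r)" using rr beta_pos f1 by (intro mult_left_mono) auto
  finally have 1: "f2 * (2 * r + r * r) + f1 * (- k * r) \<le> - f1 * r" by (simp add: k_def algebra_simps)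
  have 2: "0 \<le> c' * (f1 * r)" "0 \<le> d * (c' * (3 * x\<^sup>2))" using c' f1 r d by auto
  have 3: "f2 - c * f1 - f = - g (\<phi> (shift t - c * h))" unfolding f_f1_f2_def by (rule eq)
  have "right2 t - c' * right1 t - right t =
     (f2 - c * f1 - f) + (f2 * (2 * r + r * r) + f1 * (- k * r)) + f1 * (c - c') - c' * (f1 * r)
     + d * (6 * x - x ^ 3) - d * (c' * (3 * x\<^sup>2))"
    unfolding right2_def right1_def right_def f_f1_f2_def[symmetric] r_def[symmetric] x_def[symmetric]
    by (simp add: algebra_simps)
  also have "\<dots> \<le> - g (\<phi> (shift t - c * h)) + (- f1 * r) + f1 * (c - c') + d * (6 * x - x ^ 3)"
    using 1 2 3 by linarith
  finally show ?thesis unfolding f_f1_f2_def r_def by (simp add: algebra_simps)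
qed

text \<open>\<open>X\<close> stands for the delayed value of the glued function, known only to lie
  below \<open>right\<close>. Up to T0 + L the surplus of the shift pays for the smaller speed, and
  from T0 on also for the second derivative of the ramp. Beyond, the fraction 1 - q of the ramp that
  the contraction of g leaves over pays for everything.\<close>

lemma right_supersolution:
  assumes t: "- n - 1 \<le> t" and X: "0 \<le> X" "X \<le> \<kappa>" "X \<le> right (t - c' * h)"
  shows "right2 t - c' * right1 t - right t + g X \<le> 0"
proof -
  define x where "x = max 0 (t - T0)"
  define Y where "Y = \<phi> (shift t - c * h)"
  have "- n - 1 - c * h \<le> t" using t tau by simp
  from right_operator[OF this]
  have op: "right2 t - c' * right1 t - right t \<le> - g Y + \<phi>1 (shift t) * (c - c' - rate t) + d * (6 * x - x ^ 3)"
    by (simp add: x_def Y_def)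
  have f1: "\<phi>1 (shift t) > 0" by (rule phi1_pos)
  have Yk: "Y \<le> \<kappa>" "0 < Y" unfolding Y_def by (rule le_kappa pos)+
  have x0: "0 \<le> x" by (simp add: x_def)
  have right_le: "right (t - c' * h) \<le> \<phi> (shift (t - c' * h)) + d * x ^ 3"
    unfolding right_def x_def using d tau' by (intro add_left_mono mult_left_mono cube_mono) auto
  \<comment> \<open>Over c'h the shifted argument advances by at least c'h(1 + rate t) \<ge> ch, so
    the shorter delay does no harm.\<close>
  have early: "\<phi> (shift (t - c' * h)) \<le> Y" if "t \<le> T0 + L"
  proof -
    have "c - c' \<le> rate t * c'"
      using close(1) rate_antimono[OF that] c' by (meson mult_right_mono less_imp_le order_trans)
    then have "(c - c') * h \<le> rate t * c' * h" using h by (intro mult_right_mono) auto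
    then have "shift (t - c' * h) \<le> shift t - c * h"
      using shift_diff[of "c' * h" t] tau' by (simp add: algebra_simps)
    then show ?thesis unfolding Y_def by (rule phi_mono)
  qed
  have rate_large: "c - c' - rate t \<le> - (rate t / 2)" if "t \<le> T0 + L"
    using close(2) rate_antimono[OF that] by simp
  have near: "\<kappa> - \<epsilon> \<le> Y" if "T0 \<le> t"
    unfolding Y_def using shift_mono[OF that] by (intro order_trans[OF T0(2)] phi_mono) simp
  consider "t \<le> T0" | "T0 \<le> t" "t \<le> T0 + L" | "T0 + L \<le> t" by linarith
  then show ?thesis
  proof cases
    case 1
    then have x: "x = 0" by (simp add: x_def)
    have t1: "t \<le> T0 + L" using 1 L by simp
    have "X \<le> Y" using X(3) right_le early[OF t1] x by simp
    then have "g X \<le> g Y" by (rule g_mono[OF X(1)])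
    moreover have "\<phi>1 (shift t) * (c - c' - rate t) \<le> 0"
      using f1 rate_large[OF t1] rate_pos[of t] by (intro mult_nonneg_nonpos) auto
    ultimately show ?thesis using op x by simp
  next
    case 2
    have e: "0 \<le> d * x ^ 3" using d x0 by simp
    have "X \<le> Y + d * x ^ 3" using X(3) right_le early[OF 2(2)] by simp
    then have gX: "g X \<le> g Y + q * (d * x ^ 3)" by (rule g_diff_bound[OF X(1,2) near[OF 2(1)] Yk(1) _ e])
    have "\<phi>1 (shift t) * (c - c' - rate t) \<le> \<phi>1 (shift t) * (- (rate t / 2))"
      using f1 rate_large[OF 2(2)] by (intro mult_left_mono) auto
    moreover have "12 * d * L \<le> \<phi>1 (shift t) * rate t" by (rule ramp[OF 2])
    moreover have "d * x \<le> d * L" using d 2 L by (intro mult_left_mono) (auto simp: x_def)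
    moreover have "q * (d * x ^ 3) \<le> 1 * (d * x ^ 3)" using q e by (intro mult_right_mono) auto
    ultimately show ?thesis using op gX by (simp add: right_diff_distrib)
  next
    case 3
    have tT: "T0 \<le> t" using 3 L by simp
    have xL: "L \<le> x" using 3 by (simp add: x_def)
    define e where "e = root_pos c * \<kappa> * ((c - c') * h) + d * x ^ 3"
    have bk: "0 \<le> root_pos c * \<kappa>" using beta_pos kappa by simp
    have e0: "0 \<le> root_pos c * \<kappa> * ((c - c') * h)" by (rule mult_nonneg_nonneg[OF bk]) (use c' h in simp)
    have e: "0 \<le> e" using e0 d x0 by (simp add: e_def)
    have "shift (t - c' * h) \<le> shift t - c' * h"
      using shift_diff[of "c' * h" t] rate_pos[of t] tau' mult_pos_pos[of "rate t" "c' * h"] by linarith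
    then have "\<phi> (shift (t - c' * h)) \<le> \<phi> (shift t - c' * h)" by (rule phi_mono)
    also have "\<dots> \<le> Y + root_pos c * \<kappa> * ((c - c') * h)"
      using lipschitz[of "shift t - c * h" "shift t - c' * h"] tau' by (simp add: Y_def algebra_simps)
    finally have "X \<le> Y + e" using X(3) right_le by (simp add: e_def)
    then have gX: "g X \<le> g Y + q * e" by (rule g_diff_bound[OF X(1,2) near[OF tT] Yk(1) _ e])
    have qe: "q * e \<le> root_pos c * \<kappa> * ((c - c') * h) + q * (d * x ^ 3)"
    proof -
      have "q * (root_pos c * \<kappa> * ((c - c') * h)) \<le> 1 * (root_pos c * \<kappa> * ((c - c') * h))"
        using q e0 by (intro mult_right_mono) auto
      then show ?thesis by (simp add: e_def distrib_left)
    qed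
    have "\<phi>1 (shift t) \<le> root_pos c * \<kappa>"
      using deriv_bounds(2)[of "shift t"] mult_left_mono[OF le_kappa[of "shift t"], of "root_pos c"] beta_pos
      by linarith
    then have "\<phi>1 (shift t) * (c - c') \<le> root_pos c * \<kappa> * (c - c')" using c' by (intro mult_right_mono) auto
    moreover have "0 \<le> \<phi>1 (shift t) * rate t" using f1 rate_pos[of t] by simp
    ultimately have f: "\<phi>1 (shift t) * (c - c' - rate t) \<le> root_pos c * \<kappa> * (c - c')"
      by (simp add: right_diff_distrib)
    \<comment> \<open>The choice of L makes (1 - q)x^3 at least 12x, which beats the second
      derivative term 6x with 6L to spare for the errors in c - c'.\<close>
    have "12 * x \<le> (1 - q) * L\<^sup>2 * x" using L(2) x0 by (rule mult_right_mono)
    also have "\<dots> \<le> (1 - q) * x\<^sup>2 * x"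
      using q xL L by (intro mult_right_mono mult_left_mono power_mono) auto
    finally have "12 * x \<le> (1 - q) * x ^ 3" by (simp add: power2_eq_square power3_eq_cube mult.assoc)
    then have "6 * x - (1 - q) * x ^ 3 \<le> - 6 * L" using xL by linarith
    then have "d * (6 * x - (1 - q) * x ^ 3) \<le> d * (- 6 * L)" using d by (intro mult_left_mono) auto
    moreover have "root_pos c * \<kappa> * (c - c') + root_pos c * \<kappa> * ((c - c') * h) \<le> 6 * d * L"
      using close(3) by (simp add: distrib_left mult.assoc)
    moreover have "d * (6 * x - (1 - q) * x ^ 3) = d * (6 * x - x ^ 3) + q * (d * x ^ 3)"
      by (simp add: algebra_simps)
    moreover have "d * (- 6 * L) = - (6 * d * L)" by simp
    ultimately show ?thesis using op gX qe f by linarith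
  qed
qed

text \<open>The rate of the shift is unbounded towards -\<infinity>, so \<open>right\<close> enters
  only from -n - 1 on. The branches cross within distance 1 of -n, and \<open>cross\<close> covers a
  whole delay further left, so that delayed values stay below \<open>right\<close> too.\<close>

definition \<Phi> where
  "\<Phi> t = (if t \<le> - n - 1 then left t else if t \<le> - n + 1 then min (left t) (right t) else min (right t) \<kappa>)"

lemma Phi_le_kappa: "\<Phi> t \<le> \<kappa>"
  using left_mono[of t "- n + 1"] left_small by (auto simp: \<Phi>_def min_def)

lemma right_pos: "right t > 0"
  unfolding right_def using pos d by (intro add_pos_nonneg) auto

lemma Phi_pos: "0 < \<Phi> t"
  using left_pos right_pos kappa by (auto simp: \<Phi>_def)

lemma Phi_le_left: "t \<le> - n + 1 \<Longrightarrow> \<Phi> t \<le> left t"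
  by (auto simp: \<Phi>_def)

lemma Phi_le_right: "- n - 1 - c * h \<le> t \<Longrightarrow> \<Phi> t \<le> right t"
  using cross by (auto simp: \<Phi>_def)

lemma right_le_kappa: "right (- n + 1) \<le> \<kappa>"
  using le_kappa T0 by (simp add: right_def max_def)

lemma left_cont: "continuous_on A left" unfolding left_def[abs_def] by (intro continuous_intros)

lemma right_cont: "continuous_on A right"
  using right_deriv by (intro continuous_at_imp_continuous_on) (auto intro: DERIV_isCont)

lemma Phi_cont: "continuous_on UNIV \<Phi>"
  unfolding \<Phi>_def[abs_def]
proof (rule continuous_on_cases_le)
  show "continuous_on {t \<in> UNIV. - n - 1 \<le> t} (\<lambda>t. if t \<le> - n + 1 then min (left t) (right t) else min (right t) \<kappa>)"
    by (rule continuous_on_cases_le)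
       (use cross right_le_kappa in \<open>auto intro!: continuous_intros left_cont right_cont\<close>)
qed (use cross tau in \<open>auto intro!: continuous_intros left_cont\<close>)

lemma left_derivs:
  "(left has_real_derivative amp * (\<mu> * exp (\<mu> * (t + n)) + \<eta> * (l * exp (l * (t + n))))) (at t)"
  "((\<lambda>t. amp * (\<mu> * exp (\<mu> * (t + n)) + \<eta> * (l * exp (l * (t + n))))) has_real_derivative
     amp * (\<mu>\<^sup>2 * exp (\<mu> * (t + n)) + \<eta> * (l\<^sup>2 * exp (l * (t + n))))) (at t)"
  unfolding left_def[abs_def]
  by (auto intro!: derivative_eq_intros simp: power2_eq_square algebra_simps)

text \<open>exp(lt) solves the linearized equation at speed c' exactly, and the negative symbol at
  \<mu> absorbs the superlinear part of g.\<close>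

lemma left_supersolution:
  assumes t: "t < - n + 1" and X: "0 \<le> X" "X \<le> left (t - c' * h)"
  shows "amp * (\<mu>\<^sup>2 * exp (\<mu> * (t + n)) + \<eta> * (l\<^sup>2 * exp (l * (t + n))))
    - c' * (amp * (\<mu> * exp (\<mu> * (t + n)) + \<eta> * (l * exp (l * (t + n))))) - left t + g X \<le> 0"
proof -
  let ?x = "left (t - c' * h)"
  have "?x \<le> \<delta>" using left_mono[of "t - c' * h" "- n + 1"] t tau' left_small by simp
  then have "\<bar>g ?x - g0 * ?x\<bar> \<le> Kg * ?x powr (1 + \<theta>)" by (rule g_near_0[OF left_pos])
  moreover have "g X \<le> g ?x" by (rule g_mono[OF X])
  ultimately have gX: "g X \<le> g0 * ?x + - chi g0 h \<mu> c' * (amp * exp (\<mu> * (t + n)))"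
    using left_nonlinear[OF t] by (simp add: abs_le_iff)
  have e: "exp (z * (t - c' * h + n)) = exp (z * (t + n)) * exp (- z * c' * h)" for z
    by (simp add: algebra_simps flip: exp_add)
  have "amp * (\<mu>\<^sup>2 * exp (\<mu> * (t + n)) + \<eta> * (l\<^sup>2 * exp (l * (t + n))))
    - c' * (amp * (\<mu> * exp (\<mu> * (t + n)) + \<eta> * (l * exp (l * (t + n))))) - left t + g0 * ?x
    = chi g0 h \<mu> c' * (amp * exp (\<mu> * (t + n))) + chi g0 h l c' * (amp * \<eta> * exp (l * (t + n)))"
    unfolding left_def e chi_def by (simp add: algebra_simps)
  then show ?thesis using gX l by simp
qed

lemma Phi_supersolution: "supersolution c' \<Phi>"
  unfolding supersolution_def
proof
  fix t
  have Phi0: "0 \<le> \<Phi> s" for s using Phi_pos[of s] by simp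
  \<comment> \<open>The strict inequalities put t in an open set on which the active branch
    dominates \<Phi>; at -n + 1 itself \<open>cross\<close> makes \<open>right\<close>
    active.\<close>
  consider "\<Phi> t = left t" "t < - n + 1" | "\<Phi> t = right t" "- n - 1 < t" | "\<Phi> t = \<kappa>" "- n + 1 < t"
    using cross(2) by (fastforce simp: \<Phi>_def min_def split: if_splits)
  then show "\<exists>P P' p2. P t = \<Phi> t \<and> (\<forall>\<^sub>F s in nhds t. \<Phi> s \<le> P s) \<and>
     (\<forall>\<^sub>F s in nhds t. (P has_real_derivative P' s) (at s)) \<and> (P' has_real_derivative p2) (at t) \<and>
     p2 - c' * P' t - \<Phi> t + g (\<Phi> (t - c' * h)) \<le> 0"
  proof cases
    case 1
    have "\<forall>\<^sub>F s in nhds t. s \<in> {..< - n + 1}" using 1 by (intro eventually_nhds_in_open) auto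
    then have "\<forall>\<^sub>F s in nhds t. \<Phi> s \<le> left s" by eventually_elim (auto intro: Phi_le_left)
    moreover have "\<Phi> (t - c' * h) \<le> left (t - c' * h)" using 1 tau' by (intro Phi_le_left) simp
    note left_supersolution[OF 1(2) Phi0 this]
    ultimately show ?thesis
      unfolding 1(1)[symmetric] using left_derivs[of t] left_derivs(1) 1(1)
      by (rule_tac exI[of _ left], rule_tac exI[of _ "\<lambda>t. amp * (\<mu> * exp (\<mu> * (t + n)) + \<eta> * (l * exp (l * (t + n))))"],
        rule_tac exI[of _ "amp * (\<mu>\<^sup>2 * exp (\<mu> * (t + n)) + \<eta> * (l\<^sup>2 * exp (l * (t + n))))"]) simp
  next
    case 2
    have "\<forall>\<^sub>F s in nhds t. s \<in> {- n - 1 <..}" using 2 by (intro eventually_nhds_in_open) auto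
    then have "\<forall>\<^sub>F s in nhds t. \<Phi> s \<le> right s" by eventually_elim (use tau in \<open>auto intro!: Phi_le_right\<close>)
    moreover have "\<Phi> (t - c' * h) \<le> right (t - c' * h)" using 2 tau' by (intro Phi_le_right) simp
    note right_supersolution[OF less_imp_le[OF 2(2)] Phi0 Phi_le_kappa this]
    ultimately show ?thesis
      using right_deriv right1_deriv 2(1)
      by (rule_tac exI[of _ right], rule_tac exI[of _ right1], rule_tac exI[of _ "right2 t"]) simp
  next
    case 3
    have "g (\<Phi> (t - c' * h)) \<le> \<kappa>" by (rule g_le_kappa[OF Phi0 Phi_le_kappa])
    then show ?thesis using 3 Phi_le_kappa
      by (rule_tac exI[of _ "\<lambda>_. \<kappa>"], rule_tac exI[of _ "\<lambda>_. 0"], rule_tac exI[of _ 0]) simp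
  qed
qed

lemma Phi_top: "t \<ge> max (- n + 2) (T0 + 1 + \<kappa> / d) \<Longrightarrow> \<Phi> t = \<kappa>"
proof -
  assume t: "t \<ge> max (- n + 2) (T0 + 1 + \<kappa> / d)"
  define x where "x = t - T0"
  have "0 \<le> \<kappa> / d" using kappa d by simp
  then have x: "1 \<le> x" "\<kappa> / d \<le> x" using t unfolding x_def by linarith+
  have "\<kappa> \<le> d * x" using x d by (simp add: pos_divide_le_eq mult.commute)
  also have "\<dots> \<le> d * x ^ 3" using x d self_le_power[of x 3] by (intro mult_left_mono) auto
  also have "\<dots> \<le> right t" using pos[of "shift t"] x by (simp add: right_def x_def)
  finally show ?thesis using t by (simp add: \<Phi>_def min_def)
qed

lemma Phi_bot: "(\<Phi> \<longlongrightarrow> 0) at_bot"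
proof (rule tendsto_sandwich[where f = "\<lambda>_. 0" and h = left])
  show "\<forall>\<^sub>F t in at_bot. \<Phi> t \<le> left t"
    using eventually_le_at_bot[of "- n + 1"] by eventually_elim (rule Phi_le_left)
  have e: "exp (z * (t + n)) = exp (z * n) * exp (z * t)" for z t by (simp add: algebra_simps flip: exp_add)
  have "((\<lambda>t. amp * (exp (\<mu> * n) * exp (\<mu> * t) + \<eta> * (exp (l * n) * exp (l * t)))) \<longlongrightarrow>
    amp * (exp (\<mu> * n) * 0 + \<eta> * (exp (l * n) * 0))) at_bot"
    using l by (intro tendsto_intros tendsto_exp_at_bot) auto
  then show "(left \<longlongrightarrow> 0) at_bot" by (simp add: left_def[abs_def] e)
qed (use Phi_pos in \<open>auto simp: less_imp_le\<close>)

lemma Phi_ge_left: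
  assumes "s \<le> t" "s \<le> - n - 1"
  shows "left s \<le> \<Phi> t"
proof -
  have 1: "left s \<le> left t" by (rule left_mono[OF assms(1)])
  have 2: "left s \<le> \<kappa>" using left_mono[of s "- n + 1"] left_small assms by simp
  have 3: "left s \<le> right t" if "t > - n - 1"
  proof -
    have "left s \<le> left (- n - 1)" by (rule left_mono[OF assms(2)])
    also have "\<dots> \<le> right (- n - 1)" using tau by (intro cross) auto
    also have "\<dots> \<le> right t" using that by (intro right_mono) simp
    finally show ?thesis .
  qed
  show ?thesis using 1 2 3 by (auto simp: \<Phi>_def)
qed

end

section \<open>A lower solution and the front of smaller speed\<close>

context perturbed_front
begin

text \<open>Below \<Phi> sits v(t) = b(exp(lt) - B exp(\<mu>t)), a subsolution up to its maximum at
  \<open>tm\<close>. Continued by its maximal value it is nondecreasing and lies below its own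
  response, the input needed by \<open>front_exists_between\<close>.\<close>

lemma slower_front:
  assumes mu: "\<mu> \<le> (1 + \<theta>) * l" and chi_mu: "chi g0 h \<mu> c' < 0"
  shows "\<exists>\<psi> \<psi>1 \<psi>2. front_profile g \<kappa> g0 h Kg \<theta> \<delta> q \<epsilon> c' \<psi> \<psi>1 \<psi>2"
proof -
  \<comment> \<open>At most the coefficient of exp(lt) in \<open>left\<close>, so that b exp(lt)
    stays below it, and at most the range of the estimate for g.\<close>
  define b where "b = min (amp * \<eta> * exp (l * n)) \<delta>"
  have b: "0 < b" "b \<le> \<delta>" "b \<le> amp * \<eta> * exp (l * n)" using amp eta delta by (auto simp: b_def)
  \<comment> \<open>The first entry lets the negative symbol at \<mu> absorb the superlinear error;
    the second pushes the maximum of v to the left of -|n| - 1, where \<Phi> equals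
    \<open>left\<close> and t < 0.\<close>
  define B where "B = max (Kg * b powr \<theta> / (- chi g0 h \<mu> c')) (l / \<mu> * exp ((\<mu> - l) * (\<bar>n\<bar> + 1)))"
  have mu0: "\<mu> > 0" using l by simp
  have B1: "0 < l / \<mu> * exp ((\<mu> - l) * (\<bar>n\<bar> + 1))" using l mu0 by simp
  have B: "B > 0" using B1 unfolding B_def by linarith
  have BK: "Kg * b powr \<theta> \<le> B * - chi g0 h \<mu> c'"
  proof -
    have "Kg * b powr \<theta> / (- chi g0 h \<mu> c') \<le> B" unfolding B_def by (rule max.cobounded1)
    then show ?thesis by (subst (asm) pos_divide_le_eq) (use chi_mu in simp_all)
  qed
  define tm where "tm = ln (l / (B * \<mu>)) / (\<mu> - l)"
  have etm: "exp ((\<mu> - l) * tm) = l / (B * \<mu>)" using l mu0 B by (simp add: tm_def)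
  have tm: "tm \<le> - (\<bar>n\<bar> + 1)"
  proof -
    define Z where "Z = (\<mu> - l) * (\<bar>n\<bar> + 1)"
    have "l / \<mu> * exp Z \<le> B" unfolding B_def Z_def by (rule max.cobounded2)
    then have "l / (B * \<mu>) \<le> exp (- Z)"
      using B mu0 by (simp add: exp_minus field_simps)
    then have "(\<mu> - l) * tm \<le> - Z" unfolding etm[symmetric] by simp
    then have "(\<mu> - l) * tm \<le> (\<mu> - l) * - (\<bar>n\<bar> + 1)" unfolding Z_def by (simp only: mult_minus_right)
    then show ?thesis using l by (simp only: mult_le_cancel_left_pos diff_gt_0_iff_gt)
  qed
  have tm': "tm \<le> - n - 1" "tm < 0" using tm by linarith+
  define v where "v t = b * (exp (l * t) - B * exp (\<mu> * t))" for t
  define v1 where "v1 t = b * (l * exp (l * t) - B * (\<mu> * exp (\<mu> * t)))" for t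
  define v2 where "v2 t = b * (l\<^sup>2 * exp (l * t) - B * (\<mu>\<^sup>2 * exp (\<mu> * t)))" for t
  have dv: "(v has_real_derivative v1 t) (at t)" for t
    unfolding v_def[abs_def] v1_def by (auto intro!: derivative_eq_intros simp: algebra_simps)
  have dv1: "(v1 has_real_derivative v2 t) (at t)" for t
    unfolding v1_def[abs_def] v2_def by (auto intro!: derivative_eq_intros simp: algebra_simps power2_eq_square)
  have emu: "exp (\<mu> * t) = exp (l * t) * exp ((\<mu> - l) * t)" for t by (simp add: algebra_simps flip: exp_add)
  have v_alt: "v t = b * exp (l * t) * (1 - B * exp ((\<mu> - l) * t))" for t
    unfolding v_def emu by (simp add: algebra_simps)
  have v1_alt: "v1 t = b * exp (l * t) * (l - B * \<mu> * exp ((\<mu> - l) * t))" for t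
    unfolding v1_def emu by (simp add: algebra_simps)
  have small: "B * \<mu> * exp ((\<mu> - l) * t) \<le> l" if "t \<le> tm" for t
  proof -
    have "B * \<mu> * exp ((\<mu> - l) * t) \<le> B * \<mu> * exp ((\<mu> - l) * tm)"
      using that B mu0 l by (intro mult_left_mono) auto
    then show ?thesis unfolding etm using B mu0 by simp
  qed
  have large: "l \<le> B * \<mu> * exp ((\<mu> - l) * t)" if "tm \<le> t" for t
  proof -
    have "B * \<mu> * exp ((\<mu> - l) * tm) \<le> B * \<mu> * exp ((\<mu> - l) * t)"
      using that B mu0 l by (intro mult_left_mono) auto
    then show ?thesis unfolding etm using B mu0 by simp
  qed
  have v_pos: "v t > 0" if "t \<le> tm" for t
  proof -
    have "\<mu> * (B * exp ((\<mu> - l) * t)) \<le> l" using small[OF that] by (simp add: ac_simps)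
    also have "\<dots> < \<mu> * 1" using l by simp
    finally have "B * exp ((\<mu> - l) * t) < 1" using mu0 by (simp only: mult_less_cancel_left_pos)
    then show ?thesis unfolding v_alt using b by simp
  qed
  have v_le: "v t \<le> b * exp (l * t)" for t using b B by (simp add: v_def)
  have v_inc: "v s \<le> v t" if "s \<le> t" "t \<le> tm" for s t
  proof (rule deriv_nonneg_le[OF that(1) dv])
    fix x assume "x \<le> t"
    then show "0 \<le> v1 x" unfolding v1_alt using small[of x] that b by (intro mult_nonneg_nonneg) auto
  qed
  have v_dec: "v t \<le> v s" if "tm \<le> s" "s \<le> t" for s t
  proof (rule deriv_nonpos_ge[OF that(2) dv])
    fix x assume "s \<le> x"
    then show "v1 x \<le> 0" unfolding v1_alt using large[of x] that b by (intro mult_nonneg_nonpos) auto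
  qed
  have v_bot: "(v \<longlongrightarrow> 0) at_bot"
  proof -
    have "(v \<longlongrightarrow> b * (0 - B * 0)) at_bot"
      unfolding v_def[abs_def] using l mu0 by (intro tendsto_intros tendsto_exp_at_bot) auto
    then show ?thesis by simp
  qed
  have v_sub: "0 \<le> v2 t - c' * v1 t - v t + g (v (t - c' * h))" if t: "t \<le> tm" for t
  proof -
    define x where "x = v (t - c' * h)"
    have x0: "0 < x" unfolding x_def using t tau' by (intro v_pos) simp
    have "x \<le> b * exp (l * (t - c' * h))" unfolding x_def by (rule v_le)
    also have "\<dots> \<le> b * exp (l * t)" using b l tau' by (intro mult_left_mono) auto
    finally have x1: "x \<le> b * exp (l * t)" .
    have t0: "t \<le> 0" using t tm' by simp
    have "b * exp (l * t) \<le> b * 1" using b l t0 by (intro mult_left_mono) (auto simp: mult_nonneg_nonpos)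
    then have "x \<le> \<delta>" using x1 b by linarith
    then have gx: "g x \<ge> g0 * x - Kg * x powr (1 + \<theta>)" using g_near_0[OF x0] by (simp add: abs_le_iff)
    have "x powr (1 + \<theta>) \<le> (b * exp (l * t)) powr (1 + \<theta>)" using x0 x1 theta by (intro powr_mono2) auto
    also have "\<dots> = b powr (1 + \<theta>) * exp ((1 + \<theta>) * (l * t))"
      using b by (simp add: powr_mult powr_def[of "exp _"])
    also have "\<dots> \<le> b powr (1 + \<theta>) * exp (\<mu> * t)"
    proof -
      \<comment> \<open>For t \<le> 0 an error of order (1 + \<theta>)l is also of order
        \<mu>.\<close>
      have "(1 + \<theta>) * l * t \<le> \<mu> * t" using mu t0 by (rule mult_right_mono_neg)
      then show ?thesis by (intro mult_left_mono) (auto simp: mult.assoc)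
    qed
    finally have "Kg * x powr (1 + \<theta>) \<le> Kg * (b powr (1 + \<theta>) * exp (\<mu> * t))"
      using Kg by (intro mult_left_mono) auto
    also have "\<dots> = Kg * b powr \<theta> * (b * exp (\<mu> * t))" using b by (simp add: powr_add)
    also have "\<dots> \<le> B * - chi g0 h \<mu> c' * (b * exp (\<mu> * t))"
      using BK b by (intro mult_right_mono) auto
    finally have K: "Kg * x powr (1 + \<theta>) \<le> B * - chi g0 h \<mu> c' * (b * exp (\<mu> * t))" .
    have e: "exp (z * (t - c' * h)) = exp (z * t) * exp (- z * c' * h)" for z
      by (simp add: algebra_simps flip: exp_add)
    have "v2 t - c' * v1 t - v t + g0 * x = b * exp (l * t) * chi g0 h l c' - B * chi g0 h \<mu> c' * (b * exp (\<mu> * t))"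
      unfolding x_def v_def v1_def v2_def e chi_def by (simp add: algebra_simps)
    then show ?thesis using gx K l unfolding x_def[symmetric] by simp
  qed
  define f0 where "f0 t = v (min t tm)" for t
  have mono: "mono f0" unfolding f0_def[abs_def] by (intro monoI v_inc) auto
  have cont: "continuous_on UNIV f0"
    unfolding f0_def[abs_def] v_def by (intro continuous_intros)
  have pos: "0 < f0 t" for t unfolding f0_def by (intro v_pos) simp
  have le: "f0 t \<le> \<Phi> t" for t
  proof -
    let ?s = "min t tm"
    have "f0 t \<le> b * exp (l * ?s)" unfolding f0_def by (rule v_le)
    also have "\<dots> \<le> amp * \<eta> * exp (l * n) * exp (l * ?s)" by (rule mult_right_mono[OF b(3)]) simp
    also have "\<dots> = amp * (\<eta> * exp (l * (?s + n)))" by (simp add: distrib_left exp_add)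
    also have "\<dots> \<le> left ?s" unfolding left_def using amp by (intro mult_left_mono) auto
    also have "\<dots> \<le> \<Phi> t" using tm' by (intro Phi_ge_left) auto
    finally show ?thesis .
  qed
  have sub: "f0 t \<le> u t" if u: "response c' f0 u u1 u2" "mono u" for u u1 u2 t
  proof -
    have du: "(u has_real_derivative u1 t) (at t)" "(u1 has_real_derivative u2 t) (at t)" for t
      using u by (auto simp: response_def twice_diff_def)
    have u0: "0 \<le> u t" for t using u by (auto simp: response_def)
    define w where "w t = u t - v t" for t
    have "0 \<le> w s" if s: "s \<le> tm" for s
    proof (rule ccontr)
      assume "\<not> ?thesis"
      then have neg: "w s < 0" by simp
      have "\<forall>\<^sub>F t in at_bot. v t < - w s" using v_bot neg by (intro order_tendstoD) auto
      then obtain S where S: "\<And>t. t \<le> S \<Longrightarrow> v t < - w s" by (auto simp: eventually_at_bot_linorder)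
      have ne: "{min S s..tm} \<noteq> {}" using s by auto
      have "continuous_on {min S s..tm} w"
        unfolding w_def[abs_def] using du(1) dv
        by (intro continuous_intros continuous_at_imp_continuous_on) (auto intro: DERIV_isCont)
      then obtain t0 where t0: "t0 \<in> {min S s..tm}" "\<And>t. t \<in> {min S s..tm} \<Longrightarrow> w t0 \<le> w t"
        using continuous_attains_inf[OF compact_Icc ne] by blast
      have ws: "w t0 \<le> w s" using t0(2)[of s] s by simp
      \<comment> \<open>Beyond \<open>tm\<close> the response increases while v decreases, so the
        minimum over the whole line lies where f0 = v.\<close>
      have glob: "w t0 \<le> w t" for t
      proof -
        consider "t \<le> S" | "t \<in> {min S s..tm}" | "t > tm" by fastforce
        then show ?thesis
        proof cases
          case 1
          then show ?thesis using S[of t] u0[of t] ws by (simp add: w_def)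
        next
          case 2
          then show ?thesis by (rule t0(2))
        next
          case 3
          have "w tm \<le> w t" using monoD[OF u(2), of tm t] v_dec[of tm t] 3 by (simp add: w_def)
          moreover have "w t0 \<le> w tm" by (rule t0(2)) (use s in auto)
          ultimately show ?thesis by linarith
        qed
      qed
      have "\<forall>\<^sub>F t in nhds t0. (w has_real_derivative u1 t - v1 t) (at t)"
        unfolding w_def[abs_def] using du dv by (intro always_eventually allI derivative_intros) auto
      moreover have "((\<lambda>t. u1 t - v1 t) has_real_derivative u2 t0 - v2 t0) (at t0)"
        by (intro derivative_intros du dv1)
      moreover have "\<forall>\<^sub>F t in nhds t0. w t0 \<le> w t" using glob by simp
      ultimately have m: "u1 t0 - v1 t0 = 0" "u2 t0 - v2 t0 \<ge> 0"
        by (rule local_min_second_deriv)+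
      have "u1 t0 = v1 t0" using m(1) by simp
      then have "c' * u1 t0 = c' * v1 t0" by simp
      moreover have "f0 (t0 - c' * h) = v (t0 - c' * h)" using t0 tau' by (simp add: f0_def)
      then have "u2 t0 - c' * u1 t0 - u t0 = - g (v (t0 - c' * h))" using u unfolding response_def by metis
      moreover have "0 \<le> v2 t0 - c' * v1 t0 - v t0 + g (v (t0 - c' * h))" using t0 by (intro v_sub) simp
      moreover have "w t0 < 0" using ws neg by simp
      ultimately show False using m(2) unfolding w_def by linarith
    qed
    from this[of "min t tm"] have "f0 t \<le> u (min t tm)" by (simp add: w_def f0_def)
    also have "\<dots> \<le> u t" by (rule monoD[OF u(2)]) simp
    finally show ?thesis .
  qed
  show ?thesis
  proof (rule front_exists_between[OF c'(1) Phi_supersolution Phi_cont])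
    show "0 \<le> \<Phi> t" "\<Phi> t \<le> \<kappa>" for t using Phi_pos[of t] Phi_le_kappa by auto
    show "\<Phi> t = \<kappa>" if "max (- n + 2) (T0 + 1 + \<kappa> / d) \<le> t" for t using that by (rule Phi_top)
    show "(\<Phi> \<longlongrightarrow> 0) at_bot" by (rule Phi_bot)
    show "mono f0" "continuous_on UNIV f0" by (rule mono cont)+
    show "0 < f0 t" "f0 t \<le> \<Phi> t" for t by (rule pos le)+
    show "f0 t \<le> u t" if "response c' f0 u u1 u2" "mono u" for u u1 u2 t using that by (rule sub)
  qed
qed

end

text \<open>The order of choice matters: \<mu>, \<eta>, n, T0, L and d depend on the given front
  only; the smallness conditions on c - c' are strict at c' = c and persist slightly below; l comes
  last, as a zero of chi(., c') in [l2, \<mu>), and the estimates for \<open>left\<close> are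
  uniform in such l.\<close>

lemma (in front_roots) slower_front_exists:
  assumes a: "a > 0" "\<sigma> > 0" "exp_order (\<lambda>t. \<phi> t - a * exp (l2 * t)) (l2 + \<sigma>)"
  obtains c' \<psi> \<psi>1 \<psi>2 where "c' < c" "front_profile g \<kappa> g0 h Kg \<theta> \<delta> q \<epsilon> c' \<psi> \<psi>1 \<psi>2"
proof -
  have "l2 < (1 + \<theta>) * l2" using theta l2_pos by (simp add: algebra_simps)
  \<comment> \<open>\<mu> < l1 makes chi(\<mu>) negative, and \<mu> \<le> (1 + \<theta>) * l2 lets
    exp(\<mu>t) dominate the superlinear errors.\<close>
  then obtain \<mu> where mu: "l2 < \<mu>" "\<mu> < l1" "\<mu> \<le> (1 + \<theta>) * l2"
    using dense[of l2 "min l1 ((1 + \<theta>) * l2)"] l2_l1 by auto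
  have mu0: "\<mu> > 0" using mu l2_pos by simp
  have chi_mu: "chi g0 h \<mu> c < 0" by (rule chi_neg_between[OF g0_nonneg chi_l2 chi_l1 mu(1,2)])
  \<comment> \<open>with this weight $e^{\mu t} + \eta e^{lt}$ crosses $e^{\lambda_2 t}$ from below near $t = 0$\<close>
  define \<eta> where "\<eta> = (1 - exp (- (\<mu> - l2))) / 4"
  have e1: "exp (- (\<mu> - l2)) < 1" using mu by simp
  have e2: "exp (- (\<mu> - l2)) > 0" by (rule exp_gt_zero)
  have eta3: "exp (- (\<mu> - l2)) = 1 - 4 * \<eta>" by (simp add: \<eta>_def diff_divide_distrib)
  have eta: "0 < \<eta>" "\<eta> < 1" using e1 e2 unfolding eta3 by linarith+
  have eta_up: "1 + \<eta> \<le> exp (\<mu> - l2)"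
  proof -
    have "1 - (\<mu> - l2) \<le> exp (- (\<mu> - l2))" using exp_ge_add_one_self[of "- (\<mu> - l2)"] by linarith
    then have "\<eta> \<le> \<mu> - l2" unfolding eta3 using eta by linarith
    then show ?thesis using exp_ge_add_one_self[of "\<mu> - l2"] by linarith
  qed
  define k where "k = 3 * root_pos c + 1"
  have k: "k > 0" using beta_pos by (simp add: k_def)
  define R where "R = 1 + c * h"
  \<comment> \<open>Normalized at -n - R, the leftmost point where the shift is used: there the rate
    is at most 1, and the displacement, at most \<eta> over \<open>root_pos c\<close>, changes
    \<phi> by a factor of at most exp(\<eta>) by the Harnack inequality.\<close>
  define \<rho>0 where "\<rho>0 = exp (- k * R) * min 1 (k * \<eta> / root_pos c)"
  have rho0: "\<rho>0 > 0" using k eta beta_pos by (simp add: \<rho>0_def)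
  have eR: "exp (- k * R) * exp (k * R) = 1" by (simp flip: exp_add)
  have rhoR: "\<rho>0 * exp (k * R) = min 1 (k * \<eta> / root_pos c)"
  proof -
    have "\<rho>0 * exp (k * R) = min 1 (k * \<eta> / root_pos c) * (exp (- k * R) * exp (k * R))"
      by (simp only: \<rho>0_def ac_simps)
    then show ?thesis unfolding eR by simp
  qed
  obtain Ca Ta where Ca: "\<And>t. t \<le> Ta \<Longrightarrow> \<bar>\<phi> t - a * exp (l2 * t)\<bar> \<le> Ca * exp ((l2 + \<sigma>) * t)"
    by (rule exp_orderE[OF a(3)]) (rule that)
  have "\<forall>\<^sub>F t in at_bot. Ca * exp (\<sigma> * t) < \<eta> * a"
    using tendsto_mult[OF tendsto_const tendsto_exp_at_bot[OF a(2)], of Ca] eta a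
    by (intro order_tendstoD) auto
  then obtain Tb where Tb: "\<And>t. t \<le> Tb \<Longrightarrow> Ca * exp (\<sigma> * t) < \<eta> * a"
    by (auto simp: eventually_at_bot_linorder)
  have asym: "\<bar>\<phi> t - a * exp (l2 * t)\<bar> \<le> \<eta> * (a * exp (l2 * t))" if "t \<le> min Ta Tb" for t
  proof -
    have "\<bar>\<phi> t - a * exp (l2 * t)\<bar> \<le> Ca * exp ((l2 + \<sigma>) * t)" using Ca that by simp
    also have "\<dots> = Ca * exp (\<sigma> * t) * exp (l2 * t)" by (simp add: distrib_right exp_add)
    also have "\<dots> \<le> \<eta> * a * exp (l2 * t)" using Tb[of t] that by (intro mult_right_mono) auto
    finally show ?thesis by (simp add: mult.assoc)
  qed
  define M where "M = exp \<mu> + 1"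
  have M: "M > 1" by (simp add: M_def)
  \<comment> \<open>The size of \<open>amp powr \<theta>\<close> for which half of -chi(\<mu>, c)
    absorbs the nonlinearity; only that half is sure to remain at the speed c'.\<close>
  define X where "X = - chi g0 h \<mu> c / 2 / (Kg * M powr (1 + \<theta>) * exp ((1 + \<theta>) * \<mu>))"
  have "0 < Kg * M powr (1 + \<theta>) * exp ((1 + \<theta>) * \<mu>)" using Kg M by simp
  then have X: "X > 0" using chi_mu unfolding X_def by (intro divide_pos_pos) simp_all
  define s0 where "s0 = min (X powr (1 / \<theta>)) (min \<delta> \<kappa> / (M * exp \<mu>))"
  have s0: "s0 > 0" using X delta kappa M by (simp add: s0_def)
  \<comment> \<open>Moving the crossing to the left shrinks the amplitude a exp(-l2 n) of the
    profile there, and brings it into the range where the expansion of \<phi> has relative error at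
    most \<eta>.\<close>
  define n where "n = max (1 - min Ta Tb) (ln (a / s0) / l2)"
  define amp where "amp = a * exp (- l2 * n)"
  have amp: "amp > 0" using a by (simp add: amp_def)
  have amp_s0: "amp \<le> s0"
  proof -
    have "ln (a / s0) \<le> l2 * n" using l2_pos by (simp add: n_def max_def field_simps)
    then have "exp (ln (a / s0)) \<le> exp (l2 * n)" by (simp only: exp_le_cancel_iff)
    then have "a / s0 \<le> exp (l2 * n)" using a s0 by simp
    then show ?thesis using s0 by (simp add: amp_def exp_minus field_simps)
  qed
  have amp1: "amp * (M * exp \<mu>) \<le> min \<delta> \<kappa>"
  proof -
    have "amp \<le> min \<delta> \<kappa> / (M * exp \<mu>)" using amp_s0 by (simp add: s0_def)
    then show ?thesis using M by (simp add: pos_le_divide_eq)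
  qed
  have amp2: "Kg * amp powr \<theta> * M powr (1 + \<theta>) * exp ((1 + \<theta>) * \<mu>) \<le> - chi g0 h \<mu> c / 2"
  proof -
    have "amp powr \<theta> \<le> (X powr (1 / \<theta>)) powr \<theta>"
      using amp_s0 amp theta by (intro powr_mono2) (auto simp: s0_def)
    also have "\<dots> = X" using X theta by (simp add: powr_powr)
    finally have "amp powr \<theta> \<le> X" .
    then have "amp powr \<theta> * (Kg * M powr (1 + \<theta>) * exp ((1 + \<theta>) * \<mu>)) \<le> - chi g0 h \<mu> c / 2"
      unfolding X_def using Kg M by (subst (asm) pos_le_divide_eq) auto
    then show ?thesis by (simp add: ac_simps)
  qed
  define shift where "shift t = t - \<rho>0 / k * exp (- k * (t + n))" for t
  define rate where "rate t = \<rho>0 * exp (- k * (t + n))" for t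
  have shift_close: "t - shift t \<le> \<eta> / root_pos c" "shift t \<le> t" if "- n - R \<le> t" for t
  proof -
    have "\<rho>0 / k * exp (- k * (t + n)) \<le> \<rho>0 / k * exp (k * R)"
    proof (rule mult_left_mono)
      have "k * (- (t + n)) \<le> k * R" using that k by (intro mult_left_mono) auto
      then show "exp (- k * (t + n)) \<le> exp (k * R)"
        by (simp only: exp_le_cancel_iff mult_minus_left mult_minus_right)
    qed (use rho0 k in simp)
    also have "\<dots> = min 1 (k * \<eta> / root_pos c) / k" using rhoR by simp
    also have "\<dots> \<le> (k * \<eta> / root_pos c) / k" using k by (intro divide_right_mono) auto
    also have "\<dots> = \<eta> / root_pos c" using k by simp
    finally show "t - shift t \<le> \<eta> / root_pos c" by (simp add: shift_def)
    show "shift t \<le> t" using rho0 k by (simp add: shift_def)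
  qed
  obtain Tf where Tf: "\<And>t. t \<ge> Tf \<Longrightarrow> \<phi> t \<ge> \<kappa> - \<epsilon>" using ge_near_top[of "\<kappa> - \<epsilon>"] eps by auto
  define T0 where "T0 = max (- n + 1) (Tf + c * h + \<eta> / root_pos c)"
  have T0R: "- n - R \<le> T0" using tau by (simp add: T0_def R_def)
  have T0: "- n + 1 \<le> T0" "\<kappa> - \<epsilon> \<le> \<phi> (shift T0 - c * h)"
    using shift_close[OF T0R] by (auto simp: T0_def intro!: Tf)
  define L where "L = 12 / (1 - q)"
  have L: "L > 0" "12 \<le> (1 - q) * L\<^sup>2"
  proof -
    show "L > 0" using q by (simp add: L_def)
    have "1 - q \<noteq> 0" using q by simp
    then have "(1 - q) * L = 12"
      by (simp only: L_def times_divide_eq_right nonzero_mult_div_cancel_left not_False_eq_True)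
    then have "(1 - q) * L\<^sup>2 = 12 * L" by (simp only: power2_eq_square mult.assoc[symmetric])
    moreover have "1 \<le> L" using q by (simp add: L_def field_simps)
    ultimately show "12 \<le> (1 - q) * L\<^sup>2" by linarith
  qed
  have "continuous_on {T0..T0 + L} (\<lambda>t. \<phi>1 (shift t) * rate t)"
  proof -
    have 1: "continuous_on UNIV \<phi>1"
      by (intro continuous_at_imp_continuous_on ballI DERIV_isCont[OF d2])
    have 2: "continuous_on {T0..T0 + L} shift"
      unfolding shift_def[abs_def] by (intro continuous_intros)
    have 3: "continuous_on {T0..T0 + L} rate"
      unfolding rate_def[abs_def] by (intro continuous_intros)
    show ?thesis by (rule continuous_on_mult[OF continuous_on_compose2[OF 1 2 subset_UNIV] 3])
  qed
  moreover have "{T0..T0 + L} \<noteq> {}" using L by simp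
  ultimately have "\<exists>x\<in>{T0..T0 + L}. \<forall>t\<in>{T0..T0 + L}. \<phi>1 (shift x) * rate x \<le> \<phi>1 (shift t) * rate t"
    by (intro continuous_attains_inf compact_Icc)
  then obtain tmin where tmin: "\<And>t. t \<in> {T0..T0 + L} \<Longrightarrow> \<phi>1 (shift tmin) * rate tmin \<le> \<phi>1 (shift t) * rate t"
    by blast
  \<comment> \<open>The positive minimum of \<phi>'(shift t) * rate t over the compact interval
    [T0, T0 + L] limits the size of the ramp.\<close>
  define d where "d = \<phi>1 (shift tmin) * rate tmin / (12 * L)"
  have rate_pos: "rate t > 0" for t using rho0 by (simp add: rate_def)
  have d: "d > 0" using phi1_pos[of "shift tmin"] rate_pos[of tmin] L by (simp add: d_def)
  have ramp: "12 * d * L \<le> \<phi>1 (shift t) * rate t" if "T0 \<le> t" "t \<le> T0 + L" for t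
    using tmin[of t] that L by (simp add: d_def)
  define \<Lambda> where "\<Lambda> = root_pos c * \<kappa> * (1 + h)"
  have ev1: "\<forall>\<^sub>F z in at_left c. 0 < z"
    using eventually_at_leftI[of 0 c "\<lambda>z. 0 < z"] c by auto
  have ev2: "\<forall>\<^sub>F z in at_left c. z < c" by (simp add: eventually_at_filter)
  have ev3: "\<forall>\<^sub>F z in at_left c. chi g0 h \<mu> z < chi g0 h \<mu> c / 2"
  proof (rule order_tendstoD(2))
    show "((\<lambda>z. chi g0 h \<mu> z) \<longlongrightarrow> chi g0 h \<mu> c) (at_left c)"
      by (rule tendsto_mono[OF at_le chi_cont_speed[unfolded isCont_def]]) simp
  qed (use chi_mu in simp)
  have ev4: "\<forall>\<^sub>F z in at_left c. c - z < rate (T0 + L) * z"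
  proof -
    have "((\<lambda>z. (c - z) - rate (T0 + L) * z) \<longlongrightarrow> (c - c) - rate (T0 + L) * c) (at_left c)"
      by (intro tendsto_intros)
    then have "\<forall>\<^sub>F z in at_left c. (c - z) - rate (T0 + L) * z < 0"
      using rate_pos c by (intro order_tendstoD) auto
    then show ?thesis by eventually_elim simp
  qed
  have ev5: "\<forall>\<^sub>F z in at_left c. 2 * (c - z) < rate (T0 + L)"
  proof (rule order_tendstoD(2))
    show "((\<lambda>z. 2 * (c - z)) \<longlongrightarrow> 2 * (c - c)) (at_left c)" by (intro tendsto_intros)
  qed (use rate_pos in simp)
  have ev6: "\<forall>\<^sub>F z in at_left c. \<Lambda> * (c - z) < 6 * d * L"
  proof (rule order_tendstoD(2))
    show "((\<lambda>z. \<Lambda> * (c - z)) \<longlongrightarrow> \<Lambda> * (c - c)) (at_left c)" by (intro tendsto_intros)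
  qed (use d L in simp)
  have "\<forall>\<^sub>F z in at_left c. 0 < z \<and> z < c \<and> chi g0 h \<mu> z < chi g0 h \<mu> c / 2 \<and>
    c - z < rate (T0 + L) * z \<and> 2 * (c - z) < rate (T0 + L) \<and> \<Lambda> * (c - z) < 6 * d * L"
    using ev1 ev2 ev3 ev4 ev5 ev6 by eventually_elim simp
  then obtain c' where c': "0 < c'" "c' < c" "chi g0 h \<mu> c' < chi g0 h \<mu> c / 2"
    "c - c' < rate (T0 + L) * c'" "2 * (c - c') < rate (T0 + L)" "\<Lambda> * (c - c') < 6 * d * L"
    using eventually_happens'[OF trivial_limit_at_left_real[of c]] by auto
  have chi_mu': "chi g0 h \<mu> c' < 0" using c'(3) chi_mu by simp
  \<comment> \<open>Lowering the speed raises chi, so the smaller root moves to the right of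
    l2.\<close>
  have "chi g0 h l2 c' > 0"
    using chi_antimono_speed[OF l2_pos c'(2) g0_nonneg, of h] h chi_l2 by simp
  then obtain l where l: "l2 \<le> l" "l \<le> \<mu>" "chi g0 h l c' = 0"
    using IVT2[of "\<lambda>z. chi g0 h z c'" \<mu> 0 l2] chi_mu' mu chi_cont by (auto simp: less_imp_le)
  have l': "0 < l" "l < \<mu>" using l l2_pos chi_mu' by (auto simp: order.strict_iff_order)
  define left where "left t = amp * (exp (\<mu> * (t + n)) + \<eta> * exp (l * (t + n)))" for t
  define right where "right t = \<phi> (shift t) + d * (max 0 (t - T0)) ^ 3" for t
  have left_bound: "left t \<le> amp * M * exp (l * (t + n))" if "t \<le> - n + 1" for t
  proof -
    have "(\<mu> - l) * (t + n) \<le> (\<mu> - l) * 1" using that l' by (intro mult_left_mono) auto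
    then have "\<mu> * (t + n) \<le> \<mu> + l * (t + n)" using l' by (simp add: algebra_simps)
    then have "exp (\<mu> * (t + n)) \<le> exp \<mu> * exp (l * (t + n))" by (simp flip: exp_add)
    moreover have "\<eta> * exp (l * (t + n)) \<le> 1 * exp (l * (t + n))" using eta by (intro mult_right_mono) auto
    ultimately have "exp (\<mu> * (t + n)) + \<eta> * exp (l * (t + n)) \<le> M * exp (l * (t + n))"
      unfolding M_def distrib_right by linarith
    then have "amp * (exp (\<mu> * (t + n)) + \<eta> * exp (l * (t + n))) \<le> amp * (M * exp (l * (t + n)))"
      using amp by (intro mult_left_mono) auto
    then show ?thesis unfolding left_def by (simp only: mult.assoc)
  qed
  have aexp: "a * exp (l2 * t) = amp * exp (l2 * (t + n))" for t
    by (simp add: amp_def mult.assoc flip: exp_add) (simp add: algebra_simps)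
  have asym': "\<bar>\<phi> t - amp * exp (l2 * (t + n))\<bar> \<le> \<eta> * (amp * exp (l2 * (t + n)))" if "t \<le> - n + 1" for t
  proof -
    have "1 - min Ta Tb \<le> n" by (simp add: n_def)
    then have "t \<le> min Ta Tb" using that by linarith
    then show ?thesis using asym unfolding aexp by blast
  qed
  note c'_less = c'(2)
  have "(1 + \<theta>) * l2 \<le> (1 + \<theta>) * l" using theta l by (intro mult_left_mono) auto
  then have mul: "\<mu> \<le> (1 + \<theta>) * l" using mu by simp
  interpret perturbed_front g \<kappa> g0 h Kg \<theta> \<delta> q \<epsilon> c \<phi> \<phi>1 \<phi>2 c' l \<mu> amp \<eta> n \<rho>0 T0 L d k left shift rate right
  proof unfold_locales
    have "left (- n + 1) \<le> amp * M * exp (l * (- n + 1 + n))" by (rule left_bound) simp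
    also have "\<dots> \<le> amp * M * exp \<mu>" using amp M l' by (intro mult_left_mono) auto
    finally have "left (- n + 1) \<le> min \<delta> \<kappa>" using amp1 by (simp add: mult.assoc)
    then show "left (- n + 1) \<le> \<delta>" "left (- n + 1) \<le> \<kappa>" by auto
  next
    fix t assume t: "t < - n + 1"
    define r where "r = t + n"
    have r: "r \<le> 1" using t by (simp add: r_def)
    have x0: "0 < left (t - c' * h)" using amp eta by (simp add: left_def add_pos_pos)
    have "t - c' * h \<le> t" using c' h by simp
    then have "left (t - c' * h) \<le> left t"
      unfolding left_def using amp eta l' mu0 by (intro mult_left_mono add_mono) (auto intro!: mult_left_mono)
    also have "\<dots> \<le> amp * M * exp (l * r)" using left_bound[of t] t by (simp add: r_def)
    finally have "left (t - c' * h) powr (1 + \<theta>) \<le> (amp * M * exp (l * r)) powr (1 + \<theta>)"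
      using x0 theta by (intro powr_mono2) auto
    also have "\<dots> = amp powr (1 + \<theta>) * M powr (1 + \<theta>) * exp ((1 + \<theta>) * (l * r))"
      using amp M by (simp add: powr_mult powr_def[of "exp _"])
    also have "\<dots> \<le> amp powr (1 + \<theta>) * M powr (1 + \<theta>) * (exp ((1 + \<theta>) * \<mu>) * exp (\<mu> * r))"
    proof (rule mult_left_mono)
      have "(1 + \<theta>) * l2 \<le> (1 + \<theta>) * l" using theta l by (intro mult_left_mono) auto
      then have "0 \<le> (1 + \<theta>) * l - \<mu>" using mu by simp
      then have "((1 + \<theta>) * l - \<mu>) * r \<le> ((1 + \<theta>) * l - \<mu>) * 1" by (rule mult_left_mono[OF r])
      moreover have "(1 + \<theta>) * l \<le> (1 + \<theta>) * \<mu>" using theta l by (intro mult_left_mono) auto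
      ultimately have "(1 + \<theta>) * (l * r) \<le> (1 + \<theta>) * \<mu> + \<mu> * r" using mu0 by (simp add: algebra_simps)
      then show "exp ((1 + \<theta>) * (l * r)) \<le> exp ((1 + \<theta>) * \<mu>) * exp (\<mu> * r)" by (simp flip: exp_add)
    qed simp
    finally have "Kg * left (t - c' * h) powr (1 + \<theta>)
      \<le> Kg * (amp powr (1 + \<theta>) * M powr (1 + \<theta>) * (exp ((1 + \<theta>) * \<mu>) * exp (\<mu> * r)))"
      using Kg by (intro mult_left_mono) auto
    also have "\<dots> = (Kg * amp powr \<theta> * M powr (1 + \<theta>) * exp ((1 + \<theta>) * \<mu>)) * (amp * exp (\<mu> * r))"
      using amp by (simp add: powr_add[of amp])
    also have "\<dots> \<le> - chi g0 h \<mu> c' * (amp * exp (\<mu> * r))"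
      using amp2 c'(3) amp by (intro mult_right_mono) auto
    finally show "Kg * left (t - c' * h) powr (1 + \<theta>) \<le> - chi g0 h \<mu> c' * (amp * exp (\<mu> * (t + n)))"
      by (simp add: r_def)
  next
    fix t assume t: "- n - 1 - c * h \<le> t" "t \<le> - n - 1"
    define r where "r = t + n"
    have r: "r \<le> -1" using t by (simp add: r_def)
    have tR: "- n - R \<le> t" using t by (simp add: R_def)
    have "(\<mu> - l2) * r \<le> (\<mu> - l2) * -1" using r mu by (intro mult_left_mono) auto
    then have "\<mu> * r \<le> - (\<mu> - l2) + l2 * r" by (simp add: algebra_simps)
    then have "exp (\<mu> * r) \<le> (1 - 4 * \<eta>) * exp (l2 * r)" unfolding eta3[symmetric] by (simp flip: exp_add)
    moreover have "exp (l * r) \<le> exp (l2 * r)" using l r by (simp add: mult_right_mono_neg)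
    then have "\<eta> * exp (l * r) \<le> \<eta> * exp (l2 * r)" using eta by (intro mult_left_mono) auto
    moreover have "(1 - 4 * \<eta>) * exp (l2 * r) = exp (l2 * r) - 4 * (\<eta> * exp (l2 * r))"
      "(1 - 2 * \<eta>) * exp (l2 * r) = exp (l2 * r) - 2 * (\<eta> * exp (l2 * r))"
      "0 < \<eta> * exp (l2 * r)" using eta by (simp_all add: left_diff_distrib)
    ultimately have "exp (\<mu> * r) + \<eta> * exp (l * r) \<le> (1 - 2 * \<eta>) * exp (l2 * r)"
      by linarith
    then have "left t \<le> amp * ((1 - 2 * \<eta>) * exp (l2 * r))"
      unfolding left_def r_def using amp by (intro mult_left_mono) auto
    also have "\<dots> = (1 - 2 * \<eta>) * (amp * exp (l2 * r))" by simp
    \<comment> \<open>One factor 1 - \<eta> pays for the relative error of the expansion, the other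
      for the displaced argument, as 1 - \<eta> \<le> exp(-\<eta>).\<close>
    also have "\<dots> \<le> (1 - \<eta>) * ((1 - \<eta>) * (amp * exp (l2 * r)))"
    proof -
      have "1 - 2 * \<eta> \<le> (1 - \<eta>) * (1 - \<eta>)" by (simp add: algebra_simps)
      then have "(1 - 2 * \<eta>) * (amp * exp (l2 * r)) \<le> (1 - \<eta>) * (1 - \<eta>) * (amp * exp (l2 * r))"
        using amp by (intro mult_right_mono) auto
      then show ?thesis by (simp only: mult.assoc)
    qed
    also have "\<dots> \<le> (1 - \<eta>) * \<phi> t"
    proof (rule mult_left_mono)
      show "(1 - \<eta>) * (amp * exp (l2 * r)) \<le> \<phi> t"
        using asym'[of t] t tau by (simp add: r_def abs_le_iff left_diff_distrib)
    qed (use eta in simp)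
    also have "\<dots> \<le> exp (- \<eta>) * \<phi> t"
      using exp_ge_add_one_self[of "- \<eta>"] pos[of t] by (intro mult_right_mono) linarith+
    also have "\<dots> \<le> exp (- \<eta>) * (exp \<eta> * \<phi> (shift t))"
    proof (rule mult_left_mono)
      have "\<phi> t \<le> exp (root_pos c * (t - shift t)) * \<phi> (shift t)"
        by (rule harnack) (rule shift_close(2)[OF tR])
      also have "\<dots> \<le> exp \<eta> * \<phi> (shift t)"
      proof (rule mult_right_mono)
        have "root_pos c * (t - shift t) \<le> root_pos c * (\<eta> / root_pos c)"
          using shift_close(1)[OF tR] beta_pos by (intro mult_left_mono) auto
        then show "exp (root_pos c * (t - shift t)) \<le> exp \<eta>" using beta_pos by simp
      qed (use pos[of "shift t"] in simp)
      finally show "\<phi> t \<le> exp \<eta> * \<phi> (shift t)" .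
    qed simp
    also have "\<dots> = \<phi> (shift t)" by (simp add: exp_minus)
    also have "\<dots> \<le> right t" using d by (simp add: right_def)
    finally show "left t \<le> right t" .
  next
    have tR: "- n - R \<le> - n + 1" using tau by (simp add: R_def)
    have "right (- n + 1) = \<phi> (shift (- n + 1))" using T0 by (simp add: right_def)
    also have "\<dots> \<le> \<phi> (- n + 1)" by (rule phi_mono[OF shift_close(2)[OF tR]])
    also have "\<dots> \<le> (1 + \<eta>) * (amp * exp l2)"
      using asym'[of "- n + 1"] by (simp add: abs_le_iff distrib_right)
    also have "\<dots> \<le> exp (\<mu> - l2) * (amp * exp l2)" using eta_up amp by (intro mult_right_mono) auto
    also have "\<dots> = amp * exp \<mu>" by (simp add: exp_diff)
    also have "\<dots> \<le> left (- n + 1)" using amp eta by (simp add: left_def)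
    finally show "right (- n + 1) \<le> left (- n + 1)" .
  next
    have "- k * (- n - 1 - c * h + n) = k * R" by (simp add: R_def algebra_simps)
    then have "rate (- n - 1 - c * h) = \<rho>0 * exp (k * R)" unfolding rate_def by simp
    then show "rate (- n - 1 - c * h) \<le> 1" using rhoR by simp
  next
    show "root_pos c * \<kappa> * ((c - c') * (1 + h)) \<le> 6 * d * L"
      using c'(6) by (simp add: \<Lambda>_def mult.assoc mult.commute mult.left_commute)
  qed (use c' l l' amp eta rho0 T0 L d ramp in \<open>auto simp: k_def left_def shift_def rate_def right_def\<close>)
  show ?thesis using slower_front[OF mul chi_mu'] c'_less that by blast
qed

section \<open>The asymptotics of all fronts\<close>

text \<open>Continuity of g' at \<kappa> keeps it below \<open>q\<close>, a number strictly between
  g'(\<kappa>) and 1, on an interval around \<kappa>; there g(x) - qx is nonincreasing, which is the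
  contraction property.\<close>

lemma monostable_of_hypH:
  assumes h: "h > 0" and H: "hypH g \<kappa> g0 gk"
  obtains Kg \<theta> \<delta> q \<epsilon> where "monostable g \<kappa> g0 h Kg \<theta> \<delta> q \<epsilon>"
proof -
  have kappa: "\<kappa> > 0" and fixed: "{x. x \<ge> 0 \<and> g x = x} = {0, \<kappa>}"
    and nn: "\<And>x. x \<ge> 0 \<Longrightarrow> g x \<ge> 0" and cont: "continuous_on {0..} g" and g0: "g0 > 1"
    and sm: "strict_mono_on {0..} g" and dk: "(g has_real_derivative gk) (at \<kappa>)" and gk: "gk < 1"
    using H unfolding hypH_def by auto
  have fx: "g 0 = 0" "g \<kappa> = \<kappa>" using fixed kappa by auto
  obtain e g' where e: "e > 0" "\<And>x. x \<in> ball \<kappa> e \<Longrightarrow> (g has_real_derivative g' x) (at x)"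
    "continuous_on (ball \<kappa> e) g'"
    using H unfolding hypH_def by blast
  obtain C \<theta> \<delta> where C: "C > 0" "\<theta> > 0" "\<delta> > 0"
    "\<And>u. 0 < u \<Longrightarrow> u \<le> \<delta> \<Longrightarrow> \<bar>g u / u - g0\<bar> \<le> C * u powr \<theta>"
    using H unfolding hypH_def by blast
  define q where "q = (1 + max gk 0) / 2"
  have q: "0 < q" "q < 1" "gk < q" using gk by (auto simp: q_def max_def)
  have kin: "\<kappa> \<in> ball \<kappa> e" using e(1) by simp
  then have "g' \<kappa> = gk" using DERIV_unique[OF e(2) dk] by blast
  moreover have "isCont g' \<kappa>" using e(3) kin by (simp add: continuous_on_eq_continuous_at)
  ultimately have "\<forall>\<^sub>F x in at \<kappa>. g' x < q" using q(3) unfolding isCont_def by (intro order_tendstoD) auto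
  then obtain r where r: "r > 0" "\<And>x. x \<noteq> \<kappa> \<Longrightarrow> dist x \<kappa> < r \<Longrightarrow> g' x < q"
    unfolding eventually_at by auto
  define \<epsilon> where "\<epsilon> = min (min r e) \<kappa> / 2"
  have eps: "0 < \<epsilon>" "\<epsilon> < \<kappa>" "\<epsilon> < r" "\<epsilon> < e" using r e kappa by (auto simp: \<epsilon>_def)
  have "monostable g \<kappa> g0 h C \<theta> \<delta> q \<epsilon>"
  proof
    show "g x < g y" if "0 \<le> x" "x < y" for x y using strict_mono_onD[OF sm] that by auto
    show "x = 0 \<or> x = \<kappa>" if "0 \<le> x" "g x = x" for x using fixed that by blast
    show "\<bar>g u - g0 * u\<bar> \<le> C * u powr (1 + \<theta>)" if u: "0 < u" "u \<le> \<delta>" for u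
    proof -
      have "\<bar>g u - g0 * u\<bar> = \<bar>u * (g u / u - g0)\<bar>" using u by (simp add: algebra_simps)
      also have "\<dots> = u * \<bar>g u / u - g0\<bar>" using u by (simp add: abs_mult)
      also have "\<dots> \<le> u * (C * u powr \<theta>)" using C(4)[OF u] u by (intro mult_left_mono) auto
      also have "\<dots> = C * u powr (1 + \<theta>)" using u by (simp add: powr_add)
      finally show ?thesis .
    qed
    show "g y - g x \<le> q * (y - x)" if xy: "\<kappa> - \<epsilon> \<le> x" "x \<le> y" "y \<le> \<kappa>" for x y
    proof -
      have "g y - q * y \<le> g x - q * x"
      proof (rule deriv_nonpos_ge[OF xy(2), where f' = "\<lambda>s. g' s - q"])
        fix s assume s: "x \<le> s" "s \<le> y"
        have d: "dist s \<kappa> < r" "s \<in> ball \<kappa> e" using s xy eps by (auto simp: dist_real_def)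
        have "g' s < q" using r(2)[of s] d q \<open>g' \<kappa> = gk\<close> by (cases "s = \<kappa>") auto
        then show "g' s - q \<le> 0" by simp
        show "((\<lambda>x. g x - q * x) has_real_derivative g' s - q) (at s)"
          by (auto intro!: derivative_eq_intros e(2)[OF d(2)])
      qed
      then show ?thesis by (simp add: algebra_simps)
    qed
  qed (use h g0 kappa nn cont fx C q eps in auto)
  then show ?thesis by (rule that)
qed

text \<open>A positive nonincreasing function cannot tend to 0 at -\<infinity>, so the profile must
  be increasing.\<close>

lemma (in monostable) front_profile_of_front:
  assumes "front g \<kappa> h c \<phi>"
  obtains \<phi>1 \<phi>2 where "front_profile g \<kappa> g0 h Kg \<theta> \<delta> q \<epsilon> c \<phi> \<phi>1 \<phi>2"
proof -
  obtain \<phi>1 \<phi>2 where f: "c > 0" "\<And>t. (\<phi> has_real_derivative \<phi>1 t) (at t)"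
    "\<And>t. (\<phi>1 has_real_derivative \<phi>2 t) (at t)"
    "\<And>t. \<phi>2 t - c * \<phi>1 t - \<phi> t + g (\<phi> (t - c * h)) = 0"
    "\<And>t. \<phi> t > 0" "mono \<phi> \<or> antimono \<phi>" "(\<phi> \<longlongrightarrow> 0) at_bot" "(\<phi> \<longlongrightarrow> \<kappa>) at_top"
    using assms unfolding front_def by blast
  have "\<not> antimono \<phi>"
  proof
    assume a: "antimono \<phi>"
    have "\<phi> 0 \<le> 0"
    proof (rule tendsto_lowerbound[OF f(7)])
      show "\<forall>\<^sub>F t in at_bot. \<phi> 0 \<le> \<phi> t"
        using eventually_le_at_bot[of 0] by eventually_elim (rule antimonoD[OF a])
    qed simp
    then show False using f(5)[of 0] by simp
  qed
  then have "mono \<phi>" using f(6) by blast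
  moreover have "\<phi>2 t - c * \<phi>1 t - \<phi> t = - g (\<phi> (t - c * h))" for t using f(4)[of t] by linarith
  ultimately have "front_profile g \<kappa> g0 h Kg \<theta> \<delta> q \<epsilon> c \<phi> \<phi>1 \<phi>2"
    using f by unfold_locales (auto simp: twice_diff_def)
  then show ?thesis by (rule that)
qed

text \<open>Needed to place a constructed profile in the set defining \<open>c_star\<close>;
  continuity of the second derivative is read off from the equation.\<close>

lemma (in front_profile) front: "front g \<kappa> h c \<phi>"
proof -
  have "\<phi>2 t = c * \<phi>1 t + \<phi> t - g (\<phi> (t - c * h))" for t using eq[of t] by linarith
  then have e: "\<phi>2 = (\<lambda>t. c * \<phi>1 t + \<phi> t - g (\<phi> (t - c * h)))" by (rule ext)
  have "continuous_on UNIV \<phi>1"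
    by (intro continuous_at_imp_continuous_on ballI DERIV_isCont[OF d2])
  moreover have "continuous_on UNIV (\<lambda>t. \<phi> (t - c * h))"
    by (rule continuous_on_compose2[OF cont_on[of UNIV]]) (auto intro: continuous_intros)
  then have "continuous_on UNIV (\<lambda>t. g (\<phi> (t - c * h)))"
    by (rule continuous_on_compose2[OF g_cont]) (auto simp: less_imp_le pos)
  ultimately have "continuous_on UNIV \<phi>2"
    unfolding e by (intro continuous_intros cont_on)
  moreover have "bounded (range \<phi>)"
    unfolding bounded_iff using le_kappa pos by (intro exI[of _ \<kappa>]) (auto simp: less_imp_le)
  moreover have "\<phi>2 t - c * \<phi>1 t - \<phi> t + g (\<phi> (t - c * h)) = 0" for t using eq[of t] by simp
  ultimately show ?thesis
    unfolding front_def using c d1 d2 pos mono lim_bot lim_top by blast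
qed

lemma exp_order_normalize:
  assumes "exp_order (\<lambda>t. f t - a * exp (l * t)) (l + \<sigma>)" "a > 0" "l > 0"
  shows "\<exists>s0. (\<lambda>t. f (t + s0) - exp (l * t)) \<in> O[at_bot](\<lambda>t. exp ((l + \<sigma>) * t))"
proof -
  obtain C T where CT: "C \<ge> 0" "T \<le> 0" "\<And>t. t \<le> T \<Longrightarrow> \<bar>f t - a * exp (l * t)\<bar> \<le> C * exp ((l + \<sigma>) * t)"
    by (rule exp_orderE[OF assms(1)]) (rule that)
  \<comment> \<open>The translation that absorbs the coefficient: a exp(l s0) = 1.\<close>
  define s0 where "s0 = - ln a / l"
  have "l * s0 = - ln a" using assms by (simp add: s0_def)
  then have "a * exp (l * s0) = 1" using assms by (simp add: exp_minus)
  then have e: "a * exp (l * (t + s0)) = exp (l * t)" for t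
    by (simp add: distrib_left exp_add mult.left_commute)
  show ?thesis
  proof (intro exI bigoI)
    show "\<forall>\<^sub>F t in at_bot. norm (f (t + s0) - exp (l * t)) \<le> (C * exp ((l + \<sigma>) * s0)) * norm (exp ((l + \<sigma>) * t))"
      using eventually_le_at_bot[of "T - s0"]
    proof eventually_elim
      case (elim t)
      then have "\<bar>f (t + s0) - exp (l * t)\<bar> \<le> C * exp ((l + \<sigma>) * (t + s0))"
        using CT(3)[of "t + s0"] unfolding e by simp
      also have "\<dots> = (C * exp ((l + \<sigma>) * s0)) * exp ((l + \<sigma>) * t)" by (simp add: distrib_left exp_add)
      finally show ?case by simp
    qed
  qed
qed

theorem theorem4:
  fixes g \<phi> :: "real \<Rightarrow> real" and \<kappa> g0 gk h c :: real
  assumes "h > 0"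
    and "hypH g \<kappa> g0 gk"
    and "front g \<kappa> h c \<phi>"
  shows "\<exists>s0 \<sigma>. \<sigma> > 0 \<and>
    (c > c_star g \<kappa> h \<longrightarrow>
       (\<lambda>t. \<phi> (t + s0) - exp (lambda2 g0 h c * t)) \<in> O[at_bot](\<lambda>t. exp ((lambda2 g0 h c + \<sigma>) * t))) \<and>
    (c = c_star g \<kappa> h \<and> c_star g \<kappa> h > c_sharp g0 h \<longrightarrow>
       (\<lambda>t. \<phi> (t + s0) - exp (lambda1 g0 h c * t)) \<in> O[at_bot](\<lambda>t. exp ((lambda1 g0 h c + \<sigma>) * t)))"
proof -
  obtain Kg \<theta> \<delta> q \<epsilon> where m: "monostable g \<kappa> g0 h Kg \<theta> \<delta> q \<epsilon>"
    using assms(1,2) by (rule monostable_of_hypH)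
  interpret monostable g \<kappa> g0 h Kg \<theta> \<delta> q \<epsilon> by (rule m)
  obtain \<phi>1 \<phi>2 where F: "front_profile g \<kappa> g0 h Kg \<theta> \<delta> q \<epsilon> c \<phi> \<phi>1 \<phi>2"
    using assms(3) by (rule front_profile_of_front)
  interpret F: front_profile g \<kappa> g0 h Kg \<theta> \<delta> q \<epsilon> c \<phi> \<phi>1 \<phi>2 by (rule F)
  define S where "S = {c. c \<ge> 0 \<and> (\<exists>\<phi>. front g \<kappa> h c \<phi>)}"
  have star: "c_star g \<kappa> h = Inf S" by (simp add: c_star_def S_def)
  have cS: "c \<in> S" using F.c assms(3) by (auto simp: S_def)
  have bdd: "bdd_below S" by (rule bdd_belowI[of _ 0]) (simp add: S_def)
  \<comment> \<open>The first two cases exclude each other, so s0 and \<sigma> may be chosen case by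
    case; in the third both implications are vacuous.\<close>
  consider "c > c_star g \<kappa> h" | "c = c_star g \<kappa> h" "c_star g \<kappa> h > c_sharp g0 h"
    | "\<not> c > c_star g \<kappa> h" "\<not> (c = c_star g \<kappa> h \<and> c_star g \<kappa> h > c_sharp g0 h)" by blast
  then show ?thesis
  proof cases
    case 1
    then obtain c' where c': "c' \<in> S" "c' < c" using cS cInf_lessD[of S c] unfolding star by blast
    then obtain \<psi> where "front g \<kappa> h c' \<psi>" unfolding S_def by blast
    then obtain \<psi>1 \<psi>2 where P: "front_profile g \<kappa> g0 h Kg \<theta> \<delta> q \<epsilon> c' \<psi> \<psi>1 \<psi>2"
      by (rule front_profile_of_front)
    have "c > c_sharp g0 h" using front_profile.speed_ge_c_sharp[OF P] c' by simp
    then obtain l2 l1 where l: "0 < l2" "l2 < l1" "chi g0 h l2 c = 0" "chi g0 h l1 c = 0"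
      by (rule roots_above_c_sharp)
    interpret front_roots g \<kappa> g0 h Kg \<theta> \<delta> q \<epsilon> c \<phi> \<phi>1 \<phi>2 l2 l1
      by unfold_locales (rule l)+
    obtain a \<sigma> where a: "a > 0" "\<sigma> > 0" "exp_order (\<lambda>t. \<phi> t - a * exp (l2 * t)) (l2 + \<sigma>)"
      by (rule slow_if_slower_front[OF P c'(2)]) (rule that)
    show ?thesis
      using exp_order_normalize[OF a(3,1) l(1)] a(2) 1 unfolding lambda_eq[OF l(3,4,1,2)] by blast
  next
    case 2
    then have "c > c_sharp g0 h" by simp
    then obtain l2 l1 where l: "0 < l2" "l2 < l1" "chi g0 h l2 c = 0" "chi g0 h l1 c = 0"
      by (rule roots_above_c_sharp)
    interpret front_roots g \<kappa> g0 h Kg \<theta> \<delta> q \<epsilon> c \<phi> \<phi>1 \<phi>2 l2 l1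
      by unfold_locales (rule l)+
    obtain a \<rho> where a: "0 \<le> a" "0 < \<rho>" "\<rho> < l1 - l2" "exp_order (\<lambda>t. \<phi> t - a * exp (l2 * t)) (l2 + \<rho>)"
      by (rule slow_asymptotics)
    \<comment> \<open>A positive coefficient would yield a front of speed below the infimum.\<close>
    have "a = 0"
    proof (rule ccontr)
      assume "a \<noteq> 0"
      then have "a > 0" using a by simp
      then obtain c' \<psi> \<psi>1 \<psi>2 where P: "c' < c" "front_profile g \<kappa> g0 h Kg \<theta> \<delta> q \<epsilon> c' \<psi> \<psi>1 \<psi>2"
        using a(2,4) by (rule slower_front_exists)
      have "c' \<in> S" using front_profile.front[OF P(2)] front_profile.c[OF P(2)] by (auto simp: S_def)
      then have "Inf S \<le> c'" by (rule cInf_lower[OF _ bdd])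
      then show False using P(1) 2 star by simp
    qed
    then have o: "exp_order \<phi> (l2 + \<rho>)" using a(4) by simp
    have "l2 < l2 + \<rho>" "l2 + \<rho> < l1" using a by auto
    with o obtain b \<sigma> where b: "b > 0" "\<sigma> > 0" "exp_order (\<lambda>t. \<phi> t - b * exp (l1 * t)) (l1 + \<sigma>)"
      by (rule fast_asymptotics) (rule that)
    have "l1 > 0" using l by simp
    from exp_order_normalize[OF b(3,1) this] b(2) 2 show ?thesis
      unfolding lambda_eq[OF l(3,4,1,2)] by (metis less_irrefl)
  next
    case 3
    then show ?thesis by (intro exI[of _ 0] exI[of _ 1]) auto
  qed
qed

end
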